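(* Let $a,b>0$ with $(ab)^{-1}=n\in\mathbb{N}$ be fixed. For $\gamma>0$ let $$g_2(t) = C\,e^{-\gamma t}\,\chi_{[0,2/b]}(t),\quad t\in\mathbb{R},$$ where $C=C(b,\gamma)>0$ is chosen such that $\|g_2\|_2=1$, and let $A(\gamma)$ and $B(\gamma)$ be the sharp lower and upper frame bounds of the Gabor system $\mathcal{G}(g_2,a\mathbb{Z}\times b\mathbb{Z})$, regarded as functions of $\gamma\in(0,\infty)$. Then: (i) The lower frame bound $A(\gamma)$ has a unique maximum, which depends on $n$ and $a=1/(bn)$. It is attained at the unique positive solution $\gamma$ of the equation $$-1+\frac{1}{\gamma a}-\coth(\gamma a) = -\,n\,\coth\left(\frac{\gamma n a}{2}\right)\operatorname{sech}(\gamma n a).$$ (ii) For $n\in\{1,2\}$ we have $B(\gamma)>2$ and $B'(\gamma)>0$ for all $\gamma>0$. (iii) For $n\ge 3$, $B$ has a local maximum and a local minimum, which may be global (depending on $n$ and $a$). Denoting the point of the local maximum and of the local minimum by $\gamma^*$ and $\gamma_*$, respectively, we have $$\gamma^* < \frac{\operatorname{arccosh}\left(\frac{1+\sqrt5}{2}\right)}{na} < \gamma_*.$$ If $B(\gamma_* )<2$, then the minimum is global. Moreover, $B'(\gamma)>0$ for all $\gamma>\gamma_*$.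
   Context: For $g\in L^2(\mathbb{R})$ and $\lambda=(x,\omega)\in\mathbb{R}^2$ put $\pi(\lambda)g(t) = g(t-x)e^{2\pi i\omega t}$. For a lattice $\Lambda\subset\mathbb{R}^2$ the Gabor system is $\mathcal{G}(g,\Lambda)=\{\pi(\lambda)g \mid \lambda\in\Lambda\}$. The sharp lower and upper frame bounds are the largest constant $A\geq 0$ and the smallest constant $B$ such that $A\|f\|_2^2 \le \sum_{\lambda\in\Lambda}|\langle f,\pi(\lambda)g\rangle|^2 \le B\|f\|_2^2$ for all $f\in L^2(\mathbb{R})$. $\chi_E$ denotes the indicator function of a set $E$, $\mathbb{N}=\{1,2,3,\dots\}$, and $'$ denotes differentiation with respect to $\gamma$. *)

theory Defs
  imports "HOL-Analysis.Analysis"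
begin

text \<open>Every class in $L^2(R)$ has a Borel representative, so it suffices to work with
  Borel measurable functions; no quotient by null sets is taken, as all notions below depend on
  the almost-everywhere class only.\<close>

definition square_integrable :: "(real \<Rightarrow> complex) \<Rightarrow> bool" where
  "square_integrable f \<longleftrightarrow>
     f \<in> borel_measurable lborel \<and> integrable lborel (\<lambda>t. (cmod (f t))\<^sup>2)"

definition L2_inner :: "(real \<Rightarrow> complex) \<Rightarrow> (real \<Rightarrow> complex) \<Rightarrow> complex" where
  "L2_inner f g = (LINT t|lborel. f t * cnj (g t))"

definition L2_norm :: "(real \<Rightarrow> complex) \<Rightarrow> real" where
  "L2_norm f = sqrt (LINT t|lborel. (cmod (f t))\<^sup>2)"

definition tf_shift :: "real \<times> real \<Rightarrow> (real \<Rightarrow> complex) \<Rightarrow> real \<Rightarrow> complex" where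
  "tf_shift l g = (\<lambda>t. g (t - fst l) * exp (2 * complex_of_real pi * \<i> * complex_of_real (snd l * t)))"

text \<open>The Gabor system of \<open>g\<close> and \<open>\<Lambda>\<close> is treated as the family of all \<open>tf_shift l g\<close> indexed by
  \<open>l \<in> \<Lambda>\<close>. The sum is taken in \<^typ>\<open>ennreal\<close>, so a divergent sum has value \<open>\<infinity>\<close> instead of the
  default value 0 of a real-valued sum.\<close>

definition gabor_sum :: "(real \<Rightarrow> complex) \<Rightarrow> (real \<times> real) set \<Rightarrow> (real \<Rightarrow> complex) \<Rightarrow> ennreal" where
  "gabor_sum g \<Lambda> f = (\<Sum>\<^sub>\<infinity>l\<in>\<Lambda>. ennreal ((cmod (L2_inner f (tf_shift l g)))\<^sup>2))"

definition lower_frame_bound :: "(real \<Rightarrow> complex) \<Rightarrow> (real \<times> real) set \<Rightarrow> real" where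
  "lower_frame_bound g \<Lambda> = (GREATEST A. 0 \<le> A \<and>
     (\<forall>f. square_integrable f \<longrightarrow> ennreal (A * (L2_norm f)\<^sup>2) \<le> gabor_sum g \<Lambda> f))"

text \<open>An upper bound is automatically nonnegative; \<open>0 \<le> B\<close> is stated because \<^const>\<open>ennreal\<close>
  maps negative numbers to 0.\<close>

definition upper_frame_bound :: "(real \<Rightarrow> complex) \<Rightarrow> (real \<times> real) set \<Rightarrow> real" where
  "upper_frame_bound g \<Lambda> = (LEAST B. 0 \<le> B \<and>
     (\<forall>f. square_integrable f \<longrightarrow> gabor_sum g \<Lambda> f \<le> ennreal (B * (L2_norm f)\<^sup>2)))"

definition rect_lattice :: "real \<Rightarrow> real \<Rightarrow> (real \<times> real) set" where
  "rect_lattice a b = {(a * of_int k, b * of_int l) | k l. True}"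

definition g2 :: "real \<Rightarrow> real \<Rightarrow> real \<Rightarrow> real \<Rightarrow> complex" where
  "g2 b C \<gamma> = (\<lambda>t. complex_of_real (C * exp (- \<gamma> * t) * indicator {0..2 / b} t))"

definition coth :: "real \<Rightarrow> real" where
  "coth x = cosh x / sinh x"

definition sech :: "real \<Rightarrow> real" where
  "sech x = 1 / cosh x"

definition is_local_max_on :: "(real \<Rightarrow> real) \<Rightarrow> real set \<Rightarrow> real \<Rightarrow> bool" where
  "is_local_max_on F S x \<longleftrightarrow> x \<in> S \<and> (\<forall>\<^sub>F y in at x within S. F y \<le> F x)"

definition is_local_min_on :: "(real \<Rightarrow> real) \<Rightarrow> real set \<Rightarrow> real \<Rightarrow> bool" where
  "is_local_min_on F S x \<longleftrightarrow> x \<in> S \<and> (\<forall>\<^sub>F y in at x within S. F x \<le> F y)"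

end

theory Submission
  imports Defs "HOL-Real_Asymp.Real_Asymp"
begin

text \<open>
  Put \<open>T = n a = 1/b\<close> and \<open>q = exp (- \<gamma> T)\<close>. The window lives on two periods of length \<open>T\<close>, and on the
  second period it is \<open>q\<close> times its own copy on the first. For a fixed translation \<open>a k\<close> the inner
  products of \<open>f\<close> with all modulated windows are therefore the Fourier coefficients, over one period,
  of \<open>C exp (- \<gamma> (t - a k)) (f t + q f (t + T))\<close>. Parseval's identity (\<open>parseval\<close>) removes the sum
  over the modulations, and summing over \<open>k\<close> gives (\<open>gabor_sum_g2\<close>)
  \<open>T C\<^sup>2 \<integral> W t |f t + q f (t + T)|\<^sup>2 dt\<close>,
  where the weight \<open>W\<close> is \<open>a\<close>-periodic and decreases on \<open>[0, a)\<close> from \<open>S = \<Sum>r<n. exp (- 2 \<gamma> a r)\<close>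
  towards \<open>exp (- 2 \<gamma> a) S\<close>.

  The weight is estimated by its extreme values and the norm of \<open>f + q f (\<cdot> + T)\<close> lies between
  \<open>(1 - q) \<parallel>f\<parallel>\<close> and \<open>(1 + q) \<parallel>f\<parallel>\<close>. Both estimates can be made almost sharp by one and the same
  \<open>f\<close>: a long \<open>T\<close>-periodic comb of short teeth, with constant signs and teeth at the left end of a
  period cell of \<open>W\<close> for the upper bound, with alternating signs and teeth at the right end for the
  lower bound. Together with \<open>C\<^sup>2 = 2 \<gamma> / (1 - q\<^sup>4)\<close> this gives, for \<open>x = a \<gamma>\<close>
  (\<open>frame_bounds_closed_form\<close>),
  \<open>B = n x (1 + coth x) (1 + sech (n x))\<close> and \<open>A = n x (coth x - 1) (1 - sech (n x))\<close>.

  The rest is calculus with logarithmic derivatives. That of \<open>A\<close> is strictly decreasing from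
  \<open>\<infinity>\<close> to a negative value, and its zero is the equation of the statement. That of \<open>B\<close> is
  \<open>1 - L x - n \<psi> (n x)\<close>, with the Langevin function \<open>L x = coth x - 1/x\<close> and
  \<open>\<psi> y = sech y tanh (y/2)\<close>. The function \<open>\<psi>\<close> has a single maximum, at the point where \<open>cosh y\<close> is the
  golden ratio. For \<open>n \<le> 2\<close> the positivity of the logarithmic derivative is a rational bound for the
  logarithm (\<open>upper_slope_pos_1_2\<close>). For \<open>n \<ge> 3\<close> it is negative at the maximum of \<open>n \<psi> (n x)\<close>; on
  the left of that point it is strictly decreasing, and on the right the quotient
  \<open>n \<psi> (n x) / (1 - L x)\<close> is strictly decreasing beyond a stretch on which the sign is still
  negative, so that there is exactly one change of sign on either side (\<open>upper_slope_sign_changes\<close>).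
\<close>

section \<open>Fourier series on one period\<close>

text \<open>Half-open, so that for \<open>T = n a\<close> every point lies in exactly \<open>n\<close> of the intervals that start at
  the multiples of \<open>a\<close>.\<close>

definition period_measure :: "real \<Rightarrow> real \<Rightarrow> real measure" where
  "period_measure c T = restrict_space lborel {c..<c + T}"

definition fourier_mode :: "real \<Rightarrow> int \<Rightarrow> real \<Rightarrow> complex" where
  "fourier_mode T l t = cis (2 * pi * real_of_int l * t / T)"

lemma space_period_measure [simp]: "space (period_measure c T) = {c..<c + T}"
  by (simp add: period_measure_def space_restrict_space)

lemma finite_period_measure: "finite_measure (period_measure c T)"
  by standard (cases "T \<ge> 0"; simp add: period_measure_def emeasure_restrict_space space_restrict_space)

lemma measure_period_measure: "T \<ge> 0 \<Longrightarrow> measure (period_measure c T) {c..<c + T} = T"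
  by (simp add: period_measure_def measure_restrict_space)

lemma measurable_period_measure:
  "f \<in> borel_measurable lborel \<Longrightarrow> f \<in> borel_measurable (period_measure c T)"
  unfolding period_measure_def by (rule measurable_restrict_space1)

lemma fourier_mode_measurable: "fourier_mode T l \<in> borel_measurable borel"
  unfolding fourier_mode_def divide_inverse by (intro borel_measurable_continuous_onI continuous_intros)

lemma fourier_mode_measurable' [measurable]: "fourier_mode T l \<in> borel_measurable (period_measure c T)"
  using fourier_mode_measurable by (intro measurable_period_measure) simp

lemma norm_fourier_mode [simp]: "cmod (fourier_mode T l t) = 1"
  by (simp add: fourier_mode_def)

lemma fourier_mode_add: "fourier_mode T k t * fourier_mode T l t = fourier_mode T (k + l) t"
  by (simp add: fourier_mode_def cis_mult add_divide_distrib ring_distribs)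

lemma fourier_mode_cnj: "fourier_mode T k t * cnj (fourier_mode T l t) = fourier_mode T (k - l) t"
  by (simp add: fourier_mode_def cis_mult cis_cnj diff_divide_distrib ring_distribs)

lemma integral_period_measure_eq_Icc:
  fixes f :: "real \<Rightarrow> complex"
  shows "(LINT t|period_measure c T. f t) = (LINT t|lborel. indicator {c..c + T} t *\<^sub>R f t)"
proof -
  have "(LINT t|period_measure c T. f t) = (LINT t|lborel. indicator {c..<c + T} t *\<^sub>R f t)"
    unfolding period_measure_def by (rule integral_restrict_space) simp
  also have "\<dots> = (LINT t|lborel. indicator {c..c + T} t *\<^sub>R f t)"
  proof (rule integral_discrete_difference[where X = "{c + T}"])
    fix x :: real assume "x \<in> space lborel" "x \<notin> {c + T}"
    then show "indicator {c..<c + T} x *\<^sub>R f x = indicator {c..c + T} x *\<^sub>R f x"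
      by (auto simp: indicator_def)
  qed auto
  finally show ?thesis .
qed

lemma integral_fourier_mode:
  assumes "T > 0"
  shows "(LINT t|period_measure c T. fourier_mode T l t) = (if l = 0 then of_real T else 0)"
proof (cases "l = 0")
  case True
  then show ?thesis using assms
    by (simp add: fourier_mode_def measure_period_measure scaleR_conv_of_real)
next
  case False
  define w where "w = 2 * pi * real_of_int l / T"
  have w: "w \<noteq> 0" using False assms by (simp add: w_def)
  have eq: "fourier_mode T l t = cis (w * t)" for t by (simp add: fourier_mode_def w_def)
  define F where "F t = cis (w * t) / (\<i> * of_real w)" for t
  have deriv: "(F has_vector_derivative fourier_mode T l t) (at t within S)" for t S
  proof -
    have "((\<lambda>t. cis (w * t)) has_vector_derivative (w *\<^sub>R (\<i> * cis (w * t)))) (at t within S)"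
      unfolding has_vector_derivative_def
      by (rule derivative_eq_intros refl | simp)+ (auto simp: algebra_simps scaleR_conv_of_real)
    from has_vector_derivative_divide[OF this, of "\<i> * of_real w"] show ?thesis
      unfolding F_def eq using w by (simp add: scaleR_conv_of_real)
  qed
  \<comment> \<open>The primitive of a nonconstant mode is periodic.\<close>
  have "(LINT t|lborel. indicator {c..c + T} t *\<^sub>R fourier_mode T l t) = F (c + T) - F c"
    using assms deriv
    by (intro integral_FTC_Icc) (auto simp: fourier_mode_def intro!: continuous_intros)
  moreover have "F (c + T) = F c"
  proof -
    have "w * (c + T) = w * c + 2 * pi * real_of_int l"
      using assms by (simp add: w_def field_simps)
    then show ?thesis by (simp add: F_def cis_mult[symmetric] cis_multiple_2pi)
  qed
  ultimately show ?thesis using False by (simp add: integral_period_measure_eq_Icc)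
qed

definition trig_sum :: "real \<Rightarrow> int set \<Rightarrow> (int \<Rightarrow> complex) \<Rightarrow> real \<Rightarrow> complex" where
  "trig_sum T F d t = (\<Sum>l\<in>F. d l * fourier_mode T l t)"

definition L2_on :: "real \<Rightarrow> real \<Rightarrow> (real \<Rightarrow> complex) \<Rightarrow> bool" where
  "L2_on c T h \<longleftrightarrow> h \<in> borel_measurable (period_measure c T) \<and>
     integrable (period_measure c T) (\<lambda>t. (cmod (h t))\<^sup>2)"

lemma L2_on_diff:
  assumes "L2_on c T h" "L2_on c T k" shows "L2_on c T (\<lambda>t. h t - k t)"
  unfolding L2_on_def
proof
  show "(\<lambda>t. h t - k t) \<in> borel_measurable (period_measure c T)"
    using assms by (auto simp: L2_on_def)
  show "integrable (period_measure c T) (\<lambda>t. (cmod (h t - k t))\<^sup>2)"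
  proof (rule Bochner_Integration.integrable_bound)
    show "integrable (period_measure c T) (\<lambda>t. 2 * (cmod (h t))\<^sup>2 + 2 * (cmod (k t))\<^sup>2)"
      using assms by (auto simp: L2_on_def)
    show "(\<lambda>t. (cmod (h t - k t))\<^sup>2) \<in> borel_measurable (period_measure c T)"
      using assms by (auto simp: L2_on_def)
    have "(cmod (h t - k t))\<^sup>2 \<le> 2 * (cmod (h t))\<^sup>2 + 2 * (cmod (k t))\<^sup>2" for t
    proof -
      have "(cmod (h t - k t))\<^sup>2 \<le> (cmod (h t) + cmod (k t))\<^sup>2"
        by (intro power_mono norm_triangle_ineq4) auto
      also have "\<dots> \<le> 2 * (cmod (h t))\<^sup>2 + 2 * (cmod (k t))\<^sup>2"
        using sum_squares_bound[of "cmod (h t)" "cmod (k t)"] by (simp add: power2_sum)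
      finally show ?thesis .
    qed
    then show "AE t in period_measure c T. norm ((cmod (h t - k t))\<^sup>2) \<le>
        norm (2 * (cmod (h t))\<^sup>2 + 2 * (cmod (k t))\<^sup>2)"
      by simp
  qed
qed

lemma L2_on_bounded:
  assumes "h \<in> borel_measurable (period_measure c T)"
    and "\<And>t. t \<in> {c..<c + T} \<Longrightarrow> cmod (h t) \<le> K"
  shows "L2_on c T h"
proof -
  interpret finite_measure "period_measure c T" by (rule finite_period_measure)
  show ?thesis
    unfolding L2_on_def
  proof (intro conjI assms(1) integrable_const_bound[where B = "K\<^sup>2"])
    show "AE x in period_measure c T. norm ((cmod (h x))\<^sup>2) \<le> K\<^sup>2"
      using assms(2) by (intro AE_I2) (auto intro!: power_mono)
    show "(\<lambda>t. (cmod (h t))\<^sup>2) \<in> borel_measurable (period_measure c T)"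
      using assms by auto
  qed
qed

lemma L2_on_mode: "L2_on c T (\<lambda>t. d * fourier_mode T l t)"
  by (rule L2_on_bounded[where K = "cmod d"]) (auto simp: norm_mult)

lemma L2_on_integrable_times_mode:
  assumes "L2_on c T h"
  shows "integrable (period_measure c T) (\<lambda>t. h t * cnj (fourier_mode T l t))"
proof -
  interpret finite_measure "period_measure c T" by (rule finite_period_measure)
  have [measurable]: "h \<in> borel_measurable (period_measure c T)" using assms by (simp add: L2_on_def)
  show ?thesis
  proof (rule Bochner_Integration.integrable_bound)
    show "integrable (period_measure c T) (\<lambda>t. 1 + (cmod (h t))\<^sup>2)"
      using assms by (auto simp: L2_on_def)
    have "x \<le> 1 + x\<^sup>2" for x :: real
    proof -
      have "0 \<le> x\<^sup>2 + 1 - 2 * x" using zero_le_power2[of "x - 1"] by (simp add: power2_diff)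
      then show ?thesis using zero_le_power2[of x] by linarith
    qed
    then show "AE t in period_measure c T. norm (h t * cnj (fourier_mode T l t)) \<le> norm (1 + (cmod (h t))\<^sup>2)"
      by (simp add: norm_mult)
    have "(\<lambda>t. cnj (fourier_mode T l t)) \<in> borel_measurable (period_measure c T)"
      by (rule borel_measurable_continuous_on[OF _ fourier_mode_measurable']) (intro continuous_intros)
    then show "(\<lambda>t. h t * cnj (fourier_mode T l t)) \<in> borel_measurable (period_measure c T)"
      by measurable
  qed
qed

lemma L2_on_trig_sum: "L2_on c T (trig_sum T F d)"
proof (rule L2_on_bounded[where K = "\<Sum>l\<in>F. cmod (d l)"])
  show "trig_sum T F d \<in> borel_measurable (period_measure c T)"
    unfolding trig_sum_def by measurable
  show "cmod (trig_sum T F d t) \<le> (\<Sum>l\<in>F. cmod (d l))" for t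
    unfolding trig_sum_def by (rule order_trans[OF norm_sum]) (simp add: norm_mult)
qed

definition fourier_coeff :: "real \<Rightarrow> real \<Rightarrow> (real \<Rightarrow> complex) \<Rightarrow> int \<Rightarrow> complex" where
  "fourier_coeff c T h l = (LINT t|period_measure c T. h t * cnj (fourier_mode T l t))"

lemma cmod_diff_sq: "(cmod (z - w))\<^sup>2 = (cmod z)\<^sup>2 - 2 * Re (cnj w * z) + (cmod w)\<^sup>2"
  unfolding cmod_power2 by (simp add: power2_eq_square algebra_simps)

text \<open>One step of the orthogonal expansion; iterating it over the modes of a trigonometric sum uses
  only that a mode already subtracted does not change the coefficients of the others.\<close>

lemma dist_subtract_mode:
  assumes "T > 0" "L2_on c T h"
  shows "(LINT t|period_measure c T. (cmod (h t - d * fourier_mode T l t))\<^sup>2) =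
    (LINT t|period_measure c T. (cmod (h t))\<^sup>2) - 2 * Re (cnj d * fourier_coeff c T h l) + T * (cmod d)\<^sup>2"
proof -
  interpret finite_measure "period_measure c T" by (rule finite_period_measure)
  have T: "measure (period_measure c T) {c..<c + T} = T"
    using assms by (simp add: period_measure_def measure_restrict_space)
  have pt: "(cmod (h t - d * fourier_mode T l t))\<^sup>2 =
      (cmod (h t))\<^sup>2 - 2 * Re (cnj d * (h t * cnj (fourier_mode T l t))) + (cmod d)\<^sup>2" for t
    using cmod_diff_sq[of "h t" "d * fourier_mode T l t"] by (simp add: norm_mult mult_ac)
  have i: "integrable (period_measure c T) (\<lambda>t. cnj d * (h t * cnj (fourier_mode T l t)))"
    using L2_on_integrable_times_mode[OF assms(2)] by simp
  define g where "g t = cnj d * (h t * cnj (fourier_mode T l t))" for t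
  have g: "complex_integrable (period_measure c T) g"
    using i by (simp add: g_def[abs_def])
  have "(LINT t|period_measure c T. (cmod (h t - d * fourier_mode T l t))\<^sup>2) =
    (LINT t|period_measure c T. (cmod (h t))\<^sup>2) - (LINT t|period_measure c T. 2 * Re (g t)) + T * (cmod d)\<^sup>2"
    unfolding pt g_def[symmetric] using g assms(2) T by (simp add: L2_on_def)
  also have "(LINT t|period_measure c T. 2 * Re (g t)) = 2 * Re (cnj d * fourier_coeff c T h l)"
  proof -
    have "integral\<^sup>L (period_measure c T) g = cnj d * fourier_coeff c T h l"
      by (simp add: g_def[abs_def] fourier_coeff_def)
    then show ?thesis using g by (simp add: integral_Re)
  qed
  finally show ?thesis .
qed

lemma dist_trig_sum:
  assumes "T > 0" "L2_on c T h" "finite F"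
  shows "(LINT t|period_measure c T. (cmod (h t - trig_sum T F d t))\<^sup>2) =
    (LINT t|period_measure c T. (cmod (h t))\<^sup>2)
      + (\<Sum>l\<in>F. T * (cmod (d l))\<^sup>2 - 2 * Re (cnj (d l) * fourier_coeff c T h l))"
  using assms(3)
proof (induction F rule: finite_induct)
  case empty
  then show ?case by (simp add: trig_sum_def)
next
  case (insert m F)
  define r where "r t = h t - trig_sum T F d t" for t
  have r: "L2_on c T r" unfolding r_def by (intro L2_on_diff assms L2_on_trig_sum)
  have "fourier_coeff c T r m = fourier_coeff c T h m -
      (LINT t|period_measure c T. (\<Sum>l\<in>F. d l * fourier_mode T (l - m) t))"
  proof -
    have eq: "r t * cnj (fourier_mode T m t) = h t * cnj (fourier_mode T m t) -
        (\<Sum>l\<in>F. d l * fourier_mode T (l - m) t)" for t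
      by (simp add: r_def trig_sum_def left_diff_distrib sum_distrib_right mult.assoc fourier_mode_cnj)
    have "integrable (period_measure c T) (\<lambda>t. \<Sum>l\<in>F. d l * fourier_mode T (l - m) t)"
      using L2_on_integrable_times_mode[OF L2_on_mode[of c T 1], of _ 0]
      by (intro Bochner_Integration.integrable_sum integrable_mult_right) (simp add: fourier_mode_cnj)
    then show ?thesis unfolding fourier_coeff_def eq
      using L2_on_integrable_times_mode[OF assms(2)] by simp
  qed
  also have "(LINT t|period_measure c T. (\<Sum>l\<in>F. d l * fourier_mode T (l - m) t)) = 0"
  proof -
    have "integrable (period_measure c T) (fourier_mode T k)" for k
      using L2_on_integrable_times_mode[OF L2_on_mode[of c T 1 k], of 0] by (simp add: fourier_mode_cnj)
    then have "(LINT t|period_measure c T. (\<Sum>l\<in>F. d l * fourier_mode T (l - m) t))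
        = (\<Sum>l\<in>F. d l * (LINT t|period_measure c T. fourier_mode T (l - m) t))"
      by (subst Bochner_Integration.integral_sum) auto
    also have "\<dots> = 0"
      using insert.hyps assms(1) by (intro sum.neutral) (auto simp: integral_fourier_mode)
    finally show ?thesis .
  qed
  finally have co: "fourier_coeff c T r m = fourier_coeff c T h m" by simp
  have "h t - trig_sum T (insert m F) d t = r t - d m * fourier_mode T m t" for t
    using insert.hyps by (simp add: r_def trig_sum_def)
  then have "(LINT t|period_measure c T. (cmod (h t - trig_sum T (insert m F) d t))\<^sup>2) =
    (LINT t|period_measure c T. (cmod (r t))\<^sup>2) - 2 * Re (cnj (d m) * fourier_coeff c T h m) + T * (cmod (d m))\<^sup>2"
    using dist_subtract_mode[OF assms(1) r, of "d m" m] co by simp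
  then show ?case using insert by (simp add: r_def)
qed

text \<open>The squared distance of \<open>h\<close> from its Fourier partial sum is nonnegative.\<close>

lemma bessel:
  assumes "T > 0" "L2_on c T h" "finite F"
  shows "(\<Sum>l\<in>F. (cmod (fourier_coeff c T h l))\<^sup>2) \<le> T * (LINT t|period_measure c T. (cmod (h t))\<^sup>2)"
proof -
  let ?c = "fourier_coeff c T h"
  have "0 \<le> (LINT t|period_measure c T. (cmod (h t - trig_sum T F (\<lambda>l. ?c l / T) t))\<^sup>2)"
    by simp
  also have "\<dots> = (LINT t|period_measure c T. (cmod (h t))\<^sup>2)
      + (\<Sum>l\<in>F. T * (cmod (?c l / T))\<^sup>2 - 2 * Re (cnj (?c l / T) * ?c l))"
    by (rule dist_trig_sum[OF assms])
  also have "(\<Sum>l\<in>F. T * (cmod (?c l / T))\<^sup>2 - 2 * Re (cnj (?c l / T) * ?c l)) = - (\<Sum>l\<in>F. (cmod (?c l))\<^sup>2) / T"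
  proof -
    have "T * (cmod (z / T))\<^sup>2 - 2 * Re (cnj (z / T) * z) = - ((cmod z)\<^sup>2 / T)" for z :: complex
    proof -
      have "Re (cnj (z / T) * z) = (cmod z)\<^sup>2 / T"
        unfolding cmod_power2 by (simp add: power2_eq_square add_divide_distrib)
      then show ?thesis using assms(1) by (simp add: norm_divide power_divide field_simps power2_eq_square)
    qed
    then show ?thesis by (simp add: sum_negf sum_divide_distrib)
  qed
  finally show ?thesis using assms(1) by (simp add: field_simps)
qed

text \<open>Among all sums over the modes in \<open>F\<close> the Fourier partial sum is closest to \<open>h\<close>, so every
  trigonometric sum close to \<open>h\<close> bounds the coefficients of \<open>h\<close> from below. This reduces Parseval's
  identity to the density of the trigonometric polynomials.\<close>

lemma fourier_coeffs_lower_bound: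
  assumes "T > 0" "L2_on c T h" "finite F"
  shows "T * ((LINT t|period_measure c T. (cmod (h t))\<^sup>2)
      - (LINT t|period_measure c T. (cmod (h t - trig_sum T F d t))\<^sup>2))
    \<le> (\<Sum>l\<in>F. (cmod (fourier_coeff c T h l))\<^sup>2)"
proof -
  let ?c = "fourier_coeff c T h"
  have "2 * Re (cnj z * w) - T * (cmod z)\<^sup>2 \<le> (cmod w)\<^sup>2 / T" for z w :: complex
  proof -
    have "0 \<le> (cmod (T * z - w))\<^sup>2" by simp
    also have "\<dots> = T\<^sup>2 * (cmod z)\<^sup>2 - 2 * T * Re (cnj z * w) + (cmod w)\<^sup>2"
      unfolding cmod_diff_sq by (simp add: norm_mult power_mult_distrib algebra_simps)
    finally show ?thesis using assms(1) by (simp add: field_simps power2_eq_square)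
  qed
  then have "(\<Sum>l\<in>F. 2 * Re (cnj (d l) * ?c l) - T * (cmod (d l))\<^sup>2) \<le> (\<Sum>l\<in>F. (cmod (?c l))\<^sup>2 / T)"
    by (intro sum_mono) auto
  moreover have "(LINT t|period_measure c T. (cmod (h t))\<^sup>2)
      - (LINT t|period_measure c T. (cmod (h t - trig_sum T F d t))\<^sup>2) =
     (\<Sum>l\<in>F. 2 * Re (cnj (d l) * ?c l) - T * (cmod (d l))\<^sup>2)"
    by (simp add: dist_trig_sum[OF assms] sum_subtractf)
  ultimately show ?thesis using assms(1) by (simp add: sum_divide_distrib[symmetric] field_simps)
qed

text \<open>The inductive form makes closure under products a plain induction;
  \<open>trig_poly_eq_trig_sum\<close> gives the normal form.\<close>

inductive trig_poly :: "real \<Rightarrow> (real \<Rightarrow> complex) \<Rightarrow> bool" for T where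
  mode: "trig_poly T (\<lambda>t. d * fourier_mode T l t)"
| add: "trig_poly T p \<Longrightarrow> trig_poly T q \<Longrightarrow> trig_poly T (\<lambda>t. p t + q t)"

lemma trig_poly_mult:
  assumes "trig_poly T p" "trig_poly T q"
  shows "trig_poly T (\<lambda>t. p t * q t)"
  using assms
proof (induction p rule: trig_poly.induct)
  case (mode d l)
  from mode show ?case
  proof (induction q rule: trig_poly.induct)
    case (mode d' l')
    have "d * fourier_mode T l t * (d' * fourier_mode T l' t) = (d * d') * fourier_mode T (l + l') t" for t
      by (simp add: fourier_mode_add[symmetric] mult_ac)
    then show ?case by (simp only: trig_poly.mode)
  next
    case (add p q)
    then show ?case by (simp add: distrib_left trig_poly.add)
  qed
next
  case (add p1 p2)
  then show ?case by (simp add: distrib_right trig_poly.add)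
qed

lemma trig_poly_const: "trig_poly T (\<lambda>t. d)"
  using trig_poly.mode[of T d 0] by (simp add: fourier_mode_def)

lemma trig_poly_eq_trig_sum:
  assumes "trig_poly T p"
  obtains F d where "finite F" "p = trig_sum T F d"
proof -
  from assms have "\<exists>F d. finite F \<and> p = trig_sum T F d"
  proof (induction rule: trig_poly.induct)
    case (mode d l)
    then show ?case
      by (intro exI[of _ "{l}"] exI[of _ "\<lambda>_. d"]) (auto simp: trig_sum_def)
  next
    case (add p q)
    then obtain F d G d' where *: "finite F" "p = trig_sum T F d" "finite G" "q = trig_sum T G d'"
      by blast
    define d'' where "d'' l = (if l \<in> F then d l else 0) + (if l \<in> G then d' l else 0)" for l
    have "(\<Sum>l\<in>F. d l * fourier_mode T l t) = (\<Sum>l\<in>F \<union> G. (if l \<in> F then d l else 0) * fourier_mode T l t)" for t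
      using * by (intro sum.mono_neutral_cong_left) auto
    moreover have "(\<Sum>l\<in>G. d' l * fourier_mode T l t) = (\<Sum>l\<in>F \<union> G. (if l \<in> G then d' l else 0) * fourier_mode T l t)" for t
      using * by (intro sum.mono_neutral_cong_left) auto
    ultimately have "(\<lambda>t. p t + q t) = trig_sum T (F \<union> G) d''"
      by (auto simp: *(2,4) trig_sum_def d''_def distrib_right sum.distrib)
    with * show ?case by blast
  qed
  then show ?thesis using that by blast
qed

text \<open>A real linear form on the complex plane is a combination of \<open>z\<close> and \<open>cnj z\<close>, and on the unit
  circle \<open>cnj z\<close> is the mode of index \<open>-1\<close>.\<close>

lemma trig_poly_real_polynomial:
  assumes "real_polynomial_function p"
  shows "trig_poly T (\<lambda>t. of_real (p (fourier_mode T 1 t)))"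
  using assms
proof (induction rule: real_polynomial_function.induct)
  case (linear f)
  have "of_real (f (fourier_mode T 1 t)) =
      ((f 1 - \<i> * f \<i>) / 2) * fourier_mode T 1 t + ((f 1 + \<i> * f \<i>) / 2) * fourier_mode T (- 1) t" for t
  proof -
    let ?z = "fourier_mode T 1 t"
    have "f ?z = f (Re ?z *\<^sub>R 1 + Im ?z *\<^sub>R \<i>)"
      by (rule arg_cong[of _ _ f]) (simp add: complex_eq_iff)
    also have "\<dots> = Re ?z * f 1 + Im ?z * f \<i>"
      using linear by (simp add: linear_simps)
    finally have 1: "f ?z = Re ?z * f 1 + Im ?z * f \<i>" .
    have 2: "fourier_mode T (- 1) t = cnj ?z" by (simp add: fourier_mode_def cis_cnj)
    show ?thesis unfolding 1 2 by (simp add: complex_eq_iff field_simps)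
  qed
  then show ?case by (simp only: trig_poly.intros)
next
  case (const c)
  then show ?case by (simp add: trig_poly_const)
next
  case (add f g)
  then show ?case by (simp add: trig_poly.add)
next
  case (mult f g)
  then show ?case by (simp add: trig_poly_mult)
qed

lemma trig_poly_polynomial:
  fixes p :: "complex \<Rightarrow> complex"
  assumes "polynomial_function p"
  shows "trig_poly T (\<lambda>t. p (fourier_mode T 1 t))"
proof -
  have "real_polynomial_function (Re \<circ> p)" "real_polynomial_function (Im \<circ> p)"
    using assms bounded_linear_Re bounded_linear_Im unfolding polynomial_function_def by blast+
  then have "trig_poly T (\<lambda>t. of_real ((Re \<circ> p) (fourier_mode T 1 t)) + \<i> * of_real ((Im \<circ> p) (fourier_mode T 1 t)))"
    by (intro trig_poly.add trig_poly_mult trig_poly_const trig_poly_real_polynomial)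
  then show ?thesis by (simp add: complex_eq[symmetric])
qed

text \<open>A continuous function with equal values at the two ends of the period factors through the circle,
  because the first mode is a quotient map from the closed interval onto the circle. There the
  Stone-Weierstrass theorem applies.\<close>

lemma trig_poly_uniform_approximation:
  fixes f :: "real \<Rightarrow> complex"
  assumes T: "T > 0" and f: "continuous_on {c..c + T} f" and periodic: "f (c + T) = f c" and "e > 0"
  obtains p where "trig_poly T p" "\<And>t. t \<in> {c..c + T} \<Longrightarrow> cmod (f t - p t) < e"
proof -
  let ?E = "fourier_mode T 1" and ?I = "{c..c + T}"
  have cont: "continuous_on ?I ?E"
    unfolding fourier_mode_def using T by (intro continuous_intros) auto
  \<comment> \<open>The first mode identifies only the two end points.\<close>
  have eq: "s = t \<or> {s, t} = {c, c + T}" if "s \<in> ?I" "t \<in> ?I" "?E s = ?E t" for s t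
  proof -
    have "exp (\<i> * of_real (2 * pi * s / T)) = exp (\<i> * of_real (2 * pi * t / T))"
      using that(3) by (simp add: fourier_mode_def cis_conv_exp)
    then obtain n :: int where "\<i> * of_real (2 * pi * s / T) = \<i> * of_real (2 * pi * t / T) + of_int (2 * n) * pi * \<i>"
      unfolding exp_eq by auto
    then have "Im (\<i> * of_real (2 * pi * s / T)) = Im (\<i> * of_real (2 * pi * t / T) + of_int (2 * n) * pi * \<i>)"
      by simp
    then have "2 * pi * s / T = 2 * pi * t / T + 2 * n * pi" by simp
    then have "2 * pi * (s - (t + n * T)) = 0" using T by (simp add: field_simps)
    then have "s = t + n * T" by simp
    moreover have "n \<in> {-1, 0, 1}"
    proof -
      have "\<bar>n * T\<bar> \<le> T" using that(1,2) \<open>s = t + n * T\<close> by auto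
      then have "\<bar>real_of_int n\<bar> \<le> 1" using T by (simp add: abs_mult)
      then show ?thesis by auto
    qed
    ultimately show ?thesis using that by auto
  qed
  \<comment> \<open>The function that \<open>f\<close> induces on the circle.\<close>
  define F where "F z = f (SOME t. t \<in> ?I \<and> ?E t = z)" for z
  have F: "F (?E t) = f t" if "t \<in> ?I" for t
  proof -
    have *: "(SOME s. s \<in> ?I \<and> ?E s = ?E t) \<in> ?I \<and> ?E (SOME s. s \<in> ?I \<and> ?E s = ?E t) = ?E t"
      using that by (intro someI[where P = "\<lambda>s. s \<in> ?I \<and> ?E s = ?E t"]) auto
    show ?thesis unfolding F_def using eq[of "SOME s. s \<in> ?I \<and> ?E s = ?E t" t] * that periodic
      by (auto simp: doubleton_eq_iff)
  qed
  have "quotient_map (top_of_set ?I) (top_of_set (?E ` ?I)) ?E"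
    using cont by (intro continuous_imp_quotient_map)
      (auto simp: continuous_map_iff_continuous continuous_map_in_subtopology compact_space_subtopology Hausdorff_space_subtopology)
  moreover have "continuous_map (top_of_set ?I) euclidean (F \<circ> ?E)"
    using f F by (auto simp: continuous_map_iff_continuous intro: continuous_on_eq)
  ultimately have "continuous_map (top_of_set (?E ` ?I)) euclidean F"
    by (rule continuous_compose_quotient_map)
  then have "continuous_on (?E ` ?I) F" by (simp add: continuous_map_iff_continuous)
  moreover have "compact (?E ` ?I)" using cont by (intro compact_continuous_image) auto
  ultimately obtain g where g: "polynomial_function g" "\<forall>z\<in>?E ` ?I. cmod (F z - g z) < e"
    using Stone_Weierstrass_polynomial_function[of "?E ` ?I" F e] \<open>e > 0\<close> by auto
  show thesis
  proof (rule that)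
    show "trig_poly T (\<lambda>t. g (?E t))" by (rule trig_poly_polynomial[OF g(1)])
    show "cmod (f t - g (?E t)) < e" if "t \<in> ?I" for t
    proof -
      have "?E t \<in> ?E ` ?I" using that by (rule imageI)
      then show ?thesis using g(2) F[OF that] by metis
    qed
  qed
qed

definition L2_approximable :: "real \<Rightarrow> real \<Rightarrow> (real \<Rightarrow> complex) \<Rightarrow> bool" where
  "L2_approximable c T h \<longleftrightarrow>
     (\<forall>e>0. \<exists>p. trig_poly T p \<and> (LINT t|period_measure c T. (cmod (h t - p t))\<^sup>2) < e)"

lemma L2_on_trig_poly: "trig_poly T p \<Longrightarrow> L2_on c T p"
  by (metis trig_poly_eq_trig_sum L2_on_trig_sum)

lemma integral_square_triangle:
  assumes "L2_on c T f" "L2_on c T g" "L2_on c T h"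
  shows "(LINT t|period_measure c T. (cmod (f t - h t))\<^sup>2) \<le>
    2 * (LINT t|period_measure c T. (cmod (f t - g t))\<^sup>2) + 2 * (LINT t|period_measure c T. (cmod (g t - h t))\<^sup>2)"
proof -
  have int: "integrable (period_measure c T) (\<lambda>t. (cmod (u t - v t))\<^sup>2)" if "L2_on c T u" "L2_on c T v" for u v
    using L2_on_diff[OF that] by (simp add: L2_on_def)
  have "(cmod (f t - h t))\<^sup>2 \<le> 2 * (cmod (f t - g t))\<^sup>2 + 2 * (cmod (g t - h t))\<^sup>2" for t
  proof -
    have "(cmod (f t - h t))\<^sup>2 \<le> (cmod (f t - g t) + cmod (g t - h t))\<^sup>2"
      using norm_triangle_ineq[of "f t - g t" "g t - h t"] by (intro power_mono) auto
    also have "\<dots> \<le> 2 * (cmod (f t - g t))\<^sup>2 + 2 * (cmod (g t - h t))\<^sup>2"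
      using sum_squares_bound[of "cmod (f t - g t)" "cmod (g t - h t)"] by (simp add: power2_sum)
    finally show ?thesis .
  qed
  then have "(LINT t|period_measure c T. (cmod (f t - h t))\<^sup>2) \<le>
      (LINT t|period_measure c T. 2 * (cmod (f t - g t))\<^sup>2 + 2 * (cmod (g t - h t))\<^sup>2)"
    using assms by (intro integral_mono int Bochner_Integration.integrable_add integrable_mult_right) auto
  then show ?thesis using int assms by simp
qed

lemma L2_approximable_limit:
  assumes "L2_on c T h" "\<And>n. L2_on c T (g n)" "\<And>n. L2_approximable c T (g n)"
    and lim: "(\<lambda>n. LINT t|period_measure c T. (cmod (h t - g n t))\<^sup>2) \<longlonglongrightarrow> 0"
  shows "L2_approximable c T h"
  unfolding L2_approximable_def
proof (intro allI impI)
  fix e :: real assume "e > 0"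
  then have "eventually (\<lambda>n. (LINT t|period_measure c T. (cmod (h t - g n t))\<^sup>2) < e / 4) sequentially"
    using lim by (intro order_tendstoD) auto
  then obtain n where n: "(LINT t|period_measure c T. (cmod (h t - g n t))\<^sup>2) < e / 4"
    by (auto simp: eventually_sequentially)
  obtain p where p: "trig_poly T p" "(LINT t|period_measure c T. (cmod (g n t - p t))\<^sup>2) < e / 4"
    using assms(3)[of n] \<open>e > 0\<close> unfolding L2_approximable_def by (meson divide_pos_pos zero_less_numeral)
  have "(LINT t|period_measure c T. (cmod (h t - p t))\<^sup>2) < e"
    using integral_square_triangle[OF assms(1,2) L2_on_trig_poly[OF p(1)], of n] n p(2) by simp
  with p(1) show "\<exists>p. trig_poly T p \<and> (LINT t|period_measure c T. (cmod (h t - p t))\<^sup>2) < e" by blast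
qed

lemma L2_approximable_continuous:
  assumes "T > 0" "continuous_on {c..c + T} f" "f (c + T) = f c"
  shows "L2_approximable c T f"
  unfolding L2_approximable_def
proof (intro allI impI)
  interpret finite_measure "period_measure c T" by (rule finite_period_measure)
  fix e :: real assume "e > 0"
  define d where "d = sqrt (e / (2 * T))"
  have "d > 0" using \<open>e > 0\<close> assms by (simp add: d_def)
  then obtain p where p: "trig_poly T p" "\<And>t. t \<in> {c..c + T} \<Longrightarrow> cmod (f t - p t) < d"
    using trig_poly_uniform_approximation[OF assms] by blast
  have "(LINT t|period_measure c T. (cmod (f t - p t))\<^sup>2) \<le> (LINT t|period_measure c T. d\<^sup>2)"
    using p(2) \<open>d > 0\<close> by (intro integral_mono') (auto intro!: power_mono less_imp_le)
  also have "\<dots> = e / 2"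
    using assms(1) \<open>e > 0\<close> by (simp add: measure_period_measure d_def)
  finally show "\<exists>p. trig_poly T p \<and> (LINT t|period_measure c T. (cmod (f t - p t))\<^sup>2) < e"
    using p(1) \<open>e > 0\<close> by (intro exI[of _ p]) auto
qed

text \<open>A measurable function is an almost everywhere limit of continuous functions \<open>g n\<close>. Projecting
  their values to the disc of radius \<open>K\<close> gives a dominated sequence, and the trapezoidal cut-off
  \<open>b n\<close>, which vanishes at both ends of the interval, makes the approximants periodic.\<close>

lemma L2_approximable_bounded:
  assumes T: "T > 0" and h: "h \<in> borel_measurable borel" and K: "\<And>t. cmod (h t) \<le> K"
  shows "L2_approximable c T h"
proof -
  let ?M = "period_measure c T"
  interpret finite_measure ?M by (rule finite_period_measure)
  have "h \<in> borel_measurable lebesgue" using h by (simp add: measurable_completion)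
  then have "h measurable_on UNIV" by (intro lebesgue_measurable_imp_measurable_on) auto
  then obtain N g where N: "negligible N" and g: "\<And>n. continuous_on UNIV (g n)"
    and lim: "\<And>x. x \<notin> N \<Longrightarrow> (\<lambda>n. g n x) \<longlonglongrightarrow> h x"
    unfolding measurable_on_def by auto
  have K0: "K \<ge> 0" using K[of 0] norm_ge_zero[of "h 0"] by linarith
  let ?cp = "closest_point (cball (0::complex) K)"
  have cp: "continuous_on UNIV ?cp" "\<And>z. cmod (?cp z) \<le> K"
    using K0 continuous_on_closest_point[of "cball (0::complex) K"] closest_point_in_set[of "cball (0::complex) K"]
    by auto
  define b where "b n t = min 1 (real n * min (t - c) (c + T - t))" for n t
  define G where "G n t = of_real (b n t) * ?cp (g n t)" for n t
  have b: "b n t \<in> {0..1}" if "t \<in> {c..c + T}" for n t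
    using that by (auto simp: b_def)
  have b_lim: "(\<lambda>n. b n t) \<longlonglongrightarrow> 1" if "t \<in> {c<..<c + T}" for t
  proof -
    define m where "m = min (t - c) (c + T - t)"
    have "m > 0" using that by (auto simp: m_def)
    then obtain n0 :: nat where "1 / m < real n0" using reals_Archimedean2 by blast
    then have "b n t = 1" if "n \<ge> n0" for n
    proof -
      have "1 \<le> real n0 * m" using \<open>1 / m < real n0\<close> \<open>m > 0\<close> by (simp add: field_simps)
      also have "\<dots> \<le> real n * m" using that \<open>m > 0\<close> by simp
      finally show ?thesis by (simp add: b_def m_def)
    qed
    then show ?thesis by (intro tendsto_eventually) (auto simp: eventually_sequentially)
  qed
  have G_cont: "continuous_on S (G n)" for n S
    unfolding G_def b_def
    by (intro continuous_intros continuous_on_compose2[OF cp(1)] continuous_on_subset[OF g]) auto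
  have G_le: "cmod (G n t) \<le> K" if "t \<in> {c..<c + T}" for n t
  proof -
    have "cmod (G n t) = \<bar>b n t\<bar> * cmod (?cp (g n t))" by (simp add: G_def norm_mult)
    also have "\<dots> \<le> 1 * K" using b[of t n] that cp(2) by (intro mult_mono) auto
    finally show ?thesis by simp
  qed
  have G_meas: "G n \<in> borel_measurable ?M" for n
    using G_cont by (intro measurable_period_measure) (auto intro: borel_measurable_continuous_onI)
  have h_meas: "h \<in> borel_measurable ?M" using h by (intro measurable_period_measure) auto
  have "N \<in> null_sets lebesgue" using N by (simp add: negligible_iff_null_sets)
  then have "AE t in lebesgue. t \<notin> N" by (rule AE_not_in)
  then have "AE t in lborel. t \<notin> N" by (simp add: AE_completion_iff)
  moreover have "AE t in lborel. t \<noteq> c" by (rule AE_lborel_singleton)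
  ultimately have "AE t in lborel. t \<notin> N \<and> t \<noteq> c" by (rule AE_conjI)
  then have "AE t in lborel. t \<in> {c..<c + T} \<longrightarrow> (\<lambda>n. G n t) \<longlonglongrightarrow> h t"
  proof (rule eventually_mono, intro impI)
    fix t assume t: "t \<notin> N \<and> t \<noteq> c" "t \<in> {c..<c + T}"
    have "isCont ?cp (h t)" using cp(1) by (simp add: continuous_on_eq_continuous_at)
    then have "(\<lambda>n. ?cp (g n t)) \<longlonglongrightarrow> ?cp (h t)"
      using lim[of t] t(1) by (auto intro: isCont_tendsto_compose[where g = ?cp])
    moreover have "?cp (h t) = h t" using K by (intro closest_point_self) auto
    moreover have "(\<lambda>n. of_real (b n t) :: complex) \<longlonglongrightarrow> of_real 1" using t by (intro tendsto_of_real b_lim) auto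
    ultimately show "(\<lambda>n. G n t) \<longlonglongrightarrow> h t"
      unfolding G_def using tendsto_mult[of "\<lambda>n. of_real (b n t)" "of_real 1" sequentially] by simp
  qed
  then have ae: "AE t in ?M. (\<lambda>n. G n t) \<longlonglongrightarrow> h t"
    unfolding period_measure_def by (subst AE_restrict_space_iff) auto
  have "(\<lambda>n. LINT t|?M. (cmod (h t - G n t))\<^sup>2) \<longlonglongrightarrow> (LINT t|?M. 0)" (is "?S \<longlonglongrightarrow> _")
  proof (rule integral_dominated_convergence[where w = "\<lambda>_. (2 * K)\<^sup>2"])
    show "AE t in ?M. (\<lambda>n. (cmod (h t - G n t))\<^sup>2) \<longlonglongrightarrow> 0"
      using ae
    proof (rule eventually_mono)
      fix t assume "(\<lambda>n. G n t) \<longlonglongrightarrow> h t"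
      then have "(\<lambda>n. (cmod (h t - G n t))\<^sup>2) \<longlonglongrightarrow> (cmod (h t - h t))\<^sup>2" by (intro tendsto_intros)
      then show "(\<lambda>n. (cmod (h t - G n t))\<^sup>2) \<longlonglongrightarrow> 0" by simp
    qed
    show "AE t in ?M. norm ((cmod (h t - G n t))\<^sup>2) \<le> (2 * K)\<^sup>2" for n
    proof (intro AE_I2)
      fix t assume "t \<in> space ?M"
      then have "cmod (h t - G n t) \<le> K + K"
        by (intro order_trans[OF norm_triangle_ineq4 add_mono[OF K G_le]]) simp
      then have "(cmod (h t - G n t))\<^sup>2 \<le> (2 * K)\<^sup>2" by (intro power_mono) auto
      then show "norm ((cmod (h t - G n t))\<^sup>2) \<le> (2 * K)\<^sup>2" by simp
    qed
  qed (use G_meas h_meas in auto)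
  then have "?S \<longlonglongrightarrow> 0" by simp
  then show ?thesis
  proof (rule L2_approximable_limit[where g = G, rotated 3])
    show "L2_on c T h" using K by (intro L2_on_bounded h_meas) auto
    show "L2_on c T (G n)" for n using G_le by (intro L2_on_bounded G_meas) auto
    show "L2_approximable c T (G n)" for n
      using T G_cont by (intro L2_approximable_continuous) (auto simp: G_def b_def)
  qed
qed

text \<open>Truncation of the values reduces the claim to bounded functions.\<close>

lemma L2_approximable_L2:
  assumes T: "T > 0" and h: "h \<in> borel_measurable borel" "L2_on c T h"
  shows "L2_approximable c T h"
proof -
  let ?M = "period_measure c T"
  define H where "H n t = (if cmod (h t) \<le> real n then h t else 0)" for n t
  have H_meas: "H n \<in> borel_measurable borel" for n unfolding H_def using h(1) by measurable
  have H_L2: "L2_on c T (H n)" for n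
    by (rule L2_on_bounded[where K = "real n"]) (auto simp: H_meas measurable_period_measure H_def)
  have "(\<lambda>n. LINT t|?M. (cmod (h t - H n t))\<^sup>2) \<longlonglongrightarrow> (LINT t|?M. 0)" (is "?S \<longlonglongrightarrow> _")
  proof (rule integral_dominated_convergence[where w = "\<lambda>t. (cmod (h t))\<^sup>2"])
    show "AE t in ?M. (\<lambda>n. (cmod (h t - H n t))\<^sup>2) \<longlonglongrightarrow> 0"
    proof (intro AE_I2)
      fix t
      obtain n0 :: nat where "cmod (h t) < real n0" using reals_Archimedean2 by blast
      then have "H n t = h t" if "n \<ge> n0" for n using that by (auto simp: H_def)
      then show "(\<lambda>n. (cmod (h t - H n t))\<^sup>2) \<longlonglongrightarrow> 0"
        by (intro tendsto_eventually eventually_sequentiallyI[of n0]) simp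
    qed
    show "AE t in ?M. norm ((cmod (h t - H n t))\<^sup>2) \<le> (cmod (h t))\<^sup>2" for n
      by (intro AE_I2) (auto simp: H_def)
    show "(\<lambda>t. (cmod (h t - H n t))\<^sup>2) \<in> borel_measurable ?M" for n
      using L2_on_diff[OF h(2) H_L2] by (auto simp: L2_on_def)
  qed (use h in \<open>auto simp: L2_on_def\<close>)
  then have "?S \<longlonglongrightarrow> 0" by simp
  then show ?thesis
  proof (rule L2_approximable_limit[where g = H, rotated 3])
    show "L2_on c T h" by (rule h)
    show "L2_on c T (H n)" for n by (rule H_L2)
    show "L2_approximable c T (H n)" for n
      by (rule L2_approximable_bounded[OF T H_meas, of n "real n"]) (auto simp: H_def)
  qed
qed

text \<open>Bessel's inequality is one half; the other half tests the coefficients against trigonometric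
  polynomials close to \<open>h\<close>.\<close>

theorem parseval:
  assumes T: "T > 0" and h: "h \<in> borel_measurable borel" "L2_on c T h"
  shows "(\<Sum>\<^sub>\<infinity>l. ennreal ((cmod (fourier_coeff c T h l))\<^sup>2)) =
    ennreal (T * (LINT t|period_measure c T. (cmod (h t))\<^sup>2))"
proof -
  define E where "E = (LINT t|period_measure c T. (cmod (h t))\<^sup>2)"
  have "(\<Sum>\<^sub>\<infinity>l. ennreal ((cmod (fourier_coeff c T h l))\<^sup>2)) =
      (SUP F\<in>{F. finite F \<and> F \<subseteq> UNIV}. \<Sum>l\<in>F. ennreal ((cmod (fourier_coeff c T h l))\<^sup>2))"
    by (rule nonneg_infsum_complete) auto
  also have "\<dots> = ennreal (T * E)"
  proof (rule antisym)
    show "(SUP F\<in>{F. finite F \<and> F \<subseteq> UNIV}. \<Sum>l\<in>F. ennreal ((cmod (fourier_coeff c T h l))\<^sup>2)) \<le> ennreal (T * E)"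
      using bessel[OF T h(2)] by (intro SUP_least) (auto simp: E_def sum_ennreal intro!: ennreal_leI)
    show "ennreal (T * E) \<le> (SUP F\<in>{F. finite F \<and> F \<subseteq> UNIV}. \<Sum>l\<in>F. ennreal ((cmod (fourier_coeff c T h l))\<^sup>2))"
    proof (rule ennreal_le_epsilon)
      fix e :: real assume "e > 0"
      \<comment> \<open>The tolerance is divided by the factor \<open>T\<close> that the coefficient bound carries.\<close>
      then obtain p where p: "trig_poly T p" "(LINT t|period_measure c T. (cmod (h t - p t))\<^sup>2) < e / T"
        using L2_approximable_L2[OF T h] T unfolding L2_approximable_def by (meson divide_pos_pos)
      from p(1) obtain F d where F: "finite F" "p = trig_sum T F d" by (rule trig_poly_eq_trig_sum)
      have "T * E \<le> (\<Sum>l\<in>F. (cmod (fourier_coeff c T h l))\<^sup>2) + T * (LINT t|period_measure c T. (cmod (h t - p t))\<^sup>2)"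
        using fourier_coeffs_lower_bound[OF T h(2) F(1), of d] F(2) by (simp add: E_def algebra_simps)
      also have "\<dots> \<le> (\<Sum>l\<in>F. (cmod (fourier_coeff c T h l))\<^sup>2) + e"
        using p(2) T by (simp add: field_simps)
      finally have "ennreal (T * E) \<le> (\<Sum>l\<in>F. ennreal ((cmod (fourier_coeff c T h l))\<^sup>2)) + ennreal e"
        using \<open>e > 0\<close> by (simp add: sum_ennreal sum_nonneg flip: ennreal_plus)
      also have "\<dots> \<le> (SUP F\<in>{F. finite F \<and> F \<subseteq> UNIV}. \<Sum>l\<in>F. ennreal ((cmod (fourier_coeff c T h l))\<^sup>2)) + ennreal e"
        using F(1) by (intro add_right_mono SUP_upper) auto
      finally show "ennreal (T * E) \<le> (SUP F\<in>{F. finite F \<and> F \<subseteq> UNIV}. \<Sum>l\<in>F. ennreal ((cmod (fourier_coeff c T h l))\<^sup>2)) + ennreal e" .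
    qed
  qed
  finally show ?thesis unfolding E_def .
qed

section \<open>The Gabor sum of the window as a weighted integral\<close>

text \<open>Turns unordered sums into integrals, for which Tonelli's theorem is available.\<close>

lemma infsum_eq_nn_integral_count_space:
  fixes f :: "'a::countable \<Rightarrow> ennreal"
  assumes "infinite (UNIV :: 'a set)"
  shows "infsum f UNIV = (\<integral>\<^sup>+x. f x \<partial>count_space UNIV)"
proof -
  have e: "bij_betw (from_nat_into (UNIV :: 'a set)) UNIV UNIV"
    using assms by (intro bij_betw_from_nat_into) auto
  have "infsum f UNIV = (\<Sum>\<^sub>\<infinity>i. f (from_nat_into UNIV i))"
    by (rule infsum_reindex_bij_betw[OF e, symmetric])
  also have "\<dots> = (\<Sum>i. f (from_nat_into UNIV i))"
  proof (rule sums_unique[OF has_sum_imp_sums])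
    show "((\<lambda>i. f (from_nat_into UNIV i)) has_sum (\<Sum>\<^sub>\<infinity>i. f (from_nat_into UNIV i))) UNIV"
      by (intro has_sum_infsum nonneg_summable_on_complete) auto
  qed
  also have "\<dots> = (\<integral>\<^sup>+i. f (from_nat_into UNIV i) \<partial>count_space UNIV)"
    by (rule nn_integral_count_space_nat[symmetric])
  also have "\<dots> = (\<integral>\<^sup>+x. f x \<partial>count_space UNIV)"
    by (rule nn_integral_bij_count_space[OF e])
  finally show ?thesis .
qed

lemma gabor_sum_rect_lattice:
  assumes "a > 0" "b > 0"
  shows "gabor_sum g (rect_lattice a b) f =
    (\<integral>\<^sup>+k. (\<Sum>\<^sub>\<infinity>l. ennreal ((cmod (L2_inner f (tf_shift (a * of_int k, b * of_int l) g)))\<^sup>2))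
       \<partial>count_space (UNIV :: int set))"
proof -
  define \<phi> where "\<phi> = (\<lambda>(k::int, l::int). (a * of_int k, b * of_int l))"
  define v where "v = (\<lambda>l. ennreal ((cmod (L2_inner f (tf_shift l g)))\<^sup>2))"
  have "rect_lattice a b = range \<phi>"
    by (auto simp: rect_lattice_def \<phi>_def)
  moreover have "inj \<phi>" using assms by (auto simp: inj_on_def \<phi>_def)
  ultimately have "gabor_sum g (rect_lattice a b) f = infsum (v \<circ> \<phi>) UNIV"
    by (simp add: gabor_sum_def infsum_reindex v_def o_def)
  also have "\<dots> = (\<integral>\<^sup>+x. (v \<circ> \<phi>) x \<partial>count_space UNIV)"
    by (rule infsum_eq_nn_integral_count_space) (simp add: finite_prod)
  also have "\<dots> = (\<integral>\<^sup>+k. \<integral>\<^sup>+l. (v \<circ> \<phi>) (k, l) \<partial>count_space UNIV \<partial>count_space UNIV)"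
    by (rule nn_integral_fst_count_space[symmetric])
  also have "\<dots> = (\<integral>\<^sup>+k. (\<Sum>\<^sub>\<infinity>l. (v \<circ> \<phi>) (k, l)) \<partial>count_space UNIV)"
    by (simp add: infsum_eq_nn_integral_count_space)
  finally show ?thesis by (simp add: v_def \<phi>_def)
qed

text \<open>For \<open>q = exp (- \<gamma> T)\<close> these are the two terms that survive when a function times the window is
  periodised with period \<open>T\<close>.\<close>

definition shift_sum :: "real \<Rightarrow> real \<Rightarrow> (real \<Rightarrow> complex) \<Rightarrow> real \<Rightarrow> complex" where
  "shift_sum T q f t = f t + of_real q * f (t + T)"

lemma integrable_times_bounded_support:
  fixes f w :: "real \<Rightarrow> complex"
  assumes f: "square_integrable f" and w: "w \<in> borel_measurable borel"
    and bound: "\<And>t. cmod (w t) \<le> K * indicator {u..v} t"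
  shows "integrable lborel (\<lambda>t. f t * w t)"
proof (rule Bochner_Integration.integrable_bound)
  have [measurable]: "f \<in> borel_measurable borel" using f by (simp add: square_integrable_def)
  have [measurable]: "w \<in> borel_measurable borel" by (rule w)
  show "(\<lambda>t. f t * w t) \<in> borel_measurable lborel" by measurable
  have fi: "integrable lborel (\<lambda>t. (cmod (f t))\<^sup>2)" using f by (simp add: square_integrable_def)
  have "integrable lborel (indicator {u..v} :: real \<Rightarrow> real)"
    by (intro integrable_real_indicator) (auto simp: emeasure_lborel_Icc_eq)
  then show "integrable lborel (\<lambda>t. \<bar>K\<bar> * (indicator {u..v} t + (cmod (f t))\<^sup>2))"
    using fi by (intro integrable_mult_right Bochner_Integration.integrable_add)
  have "cmod (f t * w t) \<le> \<bar>K\<bar> * (indicator {u..v} t + (cmod (f t))\<^sup>2)" for t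
  proof (cases "t \<in> {u..v}")
    case True
    have "0 \<le> (cmod (f t))\<^sup>2 + 1 - 2 * cmod (f t)"
      using zero_le_power2[of "cmod (f t) - 1"] by (simp add: power2_diff)
    then have "cmod (f t) \<le> 1 + (cmod (f t))\<^sup>2" using norm_ge_zero[of "f t"] by linarith
    moreover have "cmod (w t) \<le> \<bar>K\<bar>" using bound[of t] True by simp
    ultimately have "cmod (f t) * cmod (w t) \<le> (1 + (cmod (f t))\<^sup>2) * \<bar>K\<bar>"
      by (intro mult_mono) auto
    then show ?thesis using True by (simp add: norm_mult mult.commute)
  next
    case False
    then have "w t = 0" using bound[of t] by simp
    then show ?thesis by simp
  qed
  then show "AE t in lborel. norm (f t * w t) \<le> norm (\<bar>K\<bar> * (indicator {u..v} t + (cmod (f t))\<^sup>2))"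
    by (intro AE_I2) (simp add: abs_mult)
qed

text \<open>The window covers \<open>[x, x + 2 T]\<close> after the translation by \<open>x\<close>. Moving the second half of the
  integral back by \<open>T\<close> leaves the modulation unchanged and multiplies the window by \<open>exp (- \<gamma> T)\<close>.\<close>

lemma L2_inner_tf_shift_g2:
  assumes T: "T > 0" and b: "b = 1 / T" and \<gamma>: "\<gamma> > 0" and C: "C > 0" and f: "square_integrable f"
  shows "L2_inner f (tf_shift (x, b * of_int l) (g2 b C \<gamma>)) =
    fourier_coeff x T (\<lambda>t. of_real (C * exp (- \<gamma> * (t - x))) * shift_sum T (exp (- \<gamma> * T)) f t) l"
proof -
  have [measurable]: "f \<in> borel_measurable borel" using f by (simp add: square_integrable_def)
  have [measurable]: "fourier_mode T l \<in> borel_measurable borel" by (rule fourier_mode_measurable)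
  have [measurable]: "(\<lambda>t. cnj (fourier_mode T l t)) \<in> borel_measurable borel"
    by (rule borel_measurable_continuous_on[OF _ fourier_mode_measurable]) (intro continuous_intros)
  define w where "w t = of_real (C * exp (- \<gamma> * (t - x)) * indicator {x..x + 2 * T} t) * cnj (fourier_mode T l t)" for t
  define u where "u t = f t * w t" for t
  have w_meas: "w \<in> borel_measurable borel" unfolding w_def by measurable
  have w_bound: "cmod (w t) \<le> C * indicator {x..x + 2 * T} t" for t
    using C \<gamma> by (auto simp: w_def norm_mult indicator_def)
  have u_int: "integrable lborel u"
    unfolding u_def by (rule integrable_times_bounded_support[OF f w_meas w_bound])
  have set_int: "integrable lborel (\<lambda>t. indicator S t *\<^sub>R u t)" if "S \<in> sets borel" for S
    using u_int that by (intro integrable_mult_indicator) auto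
  have "L2_inner f (tf_shift (x, b * of_int l) (g2 b C \<gamma>)) = (LINT t|lborel. u t)"
    unfolding L2_inner_def
  proof (rule Bochner_Integration.integral_cong[OF refl])
    fix t
    have ind: "indicator {0..2 / b} (t - x) = (indicator {x..x + 2 * T} t :: real)"
      by (auto simp: b indicator_def)
    have e: "exp (2 * complex_of_real pi * \<i> * complex_of_real (b * of_int l * t)) = fourier_mode T l t"
      by (simp add: fourier_mode_def cis_conv_exp b mult_ac)
    show "f t * cnj (tf_shift (x, b * of_int l) (g2 b C \<gamma>) t) = u t"
      unfolding tf_shift_def g2_def u_def w_def fst_conv snd_conv ind e by (simp add: mult.assoc)
  qed
  also have "\<dots> = (LINT t|lborel. indicator {x..<x + T} t *\<^sub>R u t + indicator {x + T..<x + 2 * T} t *\<^sub>R u t)"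
  \<comment> \<open>The closed support and the two half-open periods differ by one point.\<close>
  proof (rule integral_discrete_difference[where X = "{x + 2 * T}"])
    fix t :: real assume "t \<in> space lborel" "t \<notin> {x + 2 * T}"
    then show "u t = indicator {x..<x + T} t *\<^sub>R u t + indicator {x + T..<x + 2 * T} t *\<^sub>R u t"
      using T by (auto simp: indicator_def u_def w_def)
  qed auto
  also have "\<dots> = (LINT t|lborel. indicator {x..<x + T} t *\<^sub>R u t) + (LINT t|lborel. indicator {x + T..<x + 2 * T} t *\<^sub>R u t)"
    using set_int by simp
  also have "(LINT t|lborel. indicator {x + T..<x + 2 * T} t *\<^sub>R u t) =
      (LINT t|lborel. indicator {x..<x + T} t *\<^sub>R u (t + T))"
  proof -
    have "indicator {x + T..<x + 2 * T} (T + 1 * t) = (indicator {x..<x + T} t :: real)" for t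
      by (auto simp: indicator_def)
    then show ?thesis
      using lborel_integral_real_affine[of 1 "\<lambda>t. indicator {x + T..<x + 2 * T} t *\<^sub>R u t" T]
      by (simp add: add.commute)
  qed
  also have "(LINT t|lborel. indicator {x..<x + T} t *\<^sub>R u t) + (LINT t|lborel. indicator {x..<x + T} t *\<^sub>R u (t + T)) =
      (LINT t|lborel. indicator {x..<x + T} t *\<^sub>R u t + indicator {x..<x + T} t *\<^sub>R u (t + T))"
  proof (rule Bochner_Integration.integral_add[symmetric])
    show "integrable lborel (\<lambda>t. indicator {x..<x + T} t *\<^sub>R u t)" by (rule set_int) simp
    have "integrable lborel (\<lambda>t. u (T + 1 * t))"
      using u_int by (subst lborel_integrable_real_affine_iff) auto
    then show "integrable lborel (\<lambda>t. indicator {x..<x + T} t *\<^sub>R u (t + T))"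
      by (intro integrable_mult_indicator) (simp_all add: add.commute)
  qed
  also have "\<dots> = (LINT t|lborel. indicator {x..<x + T} t *\<^sub>R
      (of_real (C * exp (- \<gamma> * (t - x))) * shift_sum T (exp (- \<gamma> * T)) f t * cnj (fourier_mode T l t)))"
  proof (rule Bochner_Integration.integral_cong[OF refl])
    fix t
    have per: "fourier_mode T l (t + T) = fourier_mode T l t"
    proof -
      have "2 * pi * real_of_int l * (t + T) / T = 2 * pi * real_of_int l * t / T + 2 * pi * real_of_int l"
        using T by (simp add: field_simps)
      then show ?thesis by (simp add: fourier_mode_def cis_mult[symmetric] cis_multiple_2pi)
    qed
    have ex: "exp (- \<gamma> * (t + T - x)) = exp (- \<gamma> * (t - x)) * exp (- \<gamma> * T)"
      by (simp add: exp_add[symmetric] algebra_simps)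
    show "indicator {x..<x + T} t *\<^sub>R u t + indicator {x..<x + T} t *\<^sub>R u (t + T) = indicator {x..<x + T} t *\<^sub>R
      (of_real (C * exp (- \<gamma> * (t - x))) * shift_sum T (exp (- \<gamma> * T)) f t * cnj (fourier_mode T l t))"
    proof (cases "t \<in> {x..<x + T}")
      case True
      then have "u t + u (t + T) = of_real (C * exp (- \<gamma> * (t - x))) * shift_sum T (exp (- \<gamma> * T)) f t * cnj (fourier_mode T l t)"
        using T unfolding u_def w_def per ex shift_sum_def
        by (simp add: algebra_simps)
      with True show ?thesis by simp
    qed simp
  qed
  also have "\<dots> = fourier_coeff x T (\<lambda>t. of_real (C * exp (- \<gamma> * (t - x))) * shift_sum T (exp (- \<gamma> * T)) f t) l"
    unfolding fourier_coeff_def period_measure_def by (rule integral_restrict_space[symmetric]) simp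
  finally show ?thesis .
qed

text \<open>The difference \<open>t - a \<lfloor>t / a\<rfloor>\<close> is the position of \<open>t\<close> in its period cell, so the weight is
  \<open>a\<close>-periodic; \<open>window_weight_eq_sum\<close> shows that it sums the squared window (for \<open>C = 1\<close>) over
  the \<open>n\<close> translates whose first half contains \<open>t\<close>.\<close>

definition window_weight :: "real \<Rightarrow> nat \<Rightarrow> real \<Rightarrow> real \<Rightarrow> real" where
  "window_weight a n \<gamma> t = exp (- 2 * \<gamma> * (t - a * of_int \<lfloor>t / a\<rfloor>)) * (\<Sum>r<n. exp (- 2 * \<gamma> * a * real r))"

lemma window_weight_measurable [measurable]: "window_weight a n \<gamma> \<in> borel_measurable borel"
  unfolding window_weight_def[abs_def] by measurable

lemma window_weight_eq_sum:
  assumes "a > 0"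
  shows "(\<integral>\<^sup>+k. ennreal (exp (- 2 * \<gamma> * (t - a * of_int k))) * indicator {a * of_int k..<a * of_int k + real n * a} t
      \<partial>count_space (UNIV :: int set)) = ennreal (window_weight a n \<gamma> t)"
proof -
  define m where "m = \<lfloor>t / a\<rfloor>"
  \<comment> \<open>Exactly \<open>n\<close> consecutive intervals contain \<open>t\<close>.\<close>
  have iff: "t \<in> {a * of_int k..<a * of_int k + real n * a} \<longleftrightarrow> k \<in> {m - int n + 1..m}" for k :: int
  proof -
    have "a * of_int k \<le> t \<longleftrightarrow> k \<le> m"
      using assms by (simp add: m_def le_floor_iff pos_le_divide_eq mult.commute)
    moreover have "t < a * of_int k + real n * a \<longleftrightarrow> m < k + int n"
      using assms by (simp add: m_def floor_less_iff pos_divide_less_eq algebra_simps)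
    ultimately show ?thesis by auto
  qed
  have "(\<integral>\<^sup>+k. ennreal (exp (- 2 * \<gamma> * (t - a * of_int k))) * indicator {a * of_int k..<a * of_int k + real n * a} t
      \<partial>count_space (UNIV :: int set)) =
    (\<Sum>k\<in>{m - int n + 1..m}. ennreal (exp (- 2 * \<gamma> * (t - a * of_int k))) * indicator {a * of_int k..<a * of_int k + real n * a} t)"
    using iff by (intro nn_integral_count_space') (auto simp: indicator_def)
  also have "\<dots> = (\<Sum>k\<in>{m - int n + 1..m}. ennreal (exp (- 2 * \<gamma> * (t - a * of_int k))))"
    using iff by (intro sum.cong) (auto simp: indicator_def)
  also have "\<dots> = (\<Sum>r<n. ennreal (exp (- 2 * \<gamma> * (t - a * of_int (m - int r)))))"
    by (rule sum.reindex_bij_witness[of _ "\<lambda>r. m - int r" "\<lambda>k. nat (m - k)"]) auto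
  also have "\<dots> = ennreal (\<Sum>r<n. exp (- 2 * \<gamma> * (t - a * of_int (m - int r))))"
    by (simp add: sum_ennreal)
  also have "(\<Sum>r<n. exp (- 2 * \<gamma> * (t - a * of_int (m - int r)))) = window_weight a n \<gamma> t"
    unfolding window_weight_def sum_distrib_left m_def[symmetric]
    by (intro sum.cong refl) (simp add: exp_add[symmetric] algebra_simps)
  finally show ?thesis .
qed

lemma square_integrable_shift:
  assumes "square_integrable f"
  shows "square_integrable (\<lambda>t. f (t + T))"
    and "(LINT t|lborel. (cmod (f (t + T)))\<^sup>2) = (LINT t|lborel. (cmod (f t))\<^sup>2)"
proof -
  have [measurable]: "f \<in> borel_measurable borel" using assms by (simp add: square_integrable_def)
  have "integrable lborel (\<lambda>t. (cmod (f (T + 1 * t)))\<^sup>2)"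
    using assms by (subst lborel_integrable_real_affine_iff[of 1 "\<lambda>t. (cmod (f t))\<^sup>2"]) (auto simp: square_integrable_def)
  then show "square_integrable (\<lambda>t. f (t + T))" by (simp add: square_integrable_def add.commute)
  show "(LINT t|lborel. (cmod (f (t + T)))\<^sup>2) = (LINT t|lborel. (cmod (f t))\<^sup>2)"
    using lborel_integral_real_affine[of 1 "\<lambda>t. (cmod (f t))\<^sup>2" T] by (simp add: add.commute)
qed

text \<open>Both inequalities follow from \<open>2 |u| |v| \<le> |u|\<^sup>2 + |v|\<^sup>2\<close>. They are stated pointwise in a form whose
  integrals are exact multiples of \<open>\<integral> |f|\<^sup>2\<close>, by translation invariance.\<close>

lemma shift_sum_bounds:
  assumes "0 \<le> q" "q \<le> 1"
  shows "(cmod (shift_sum T q f t))\<^sup>2 \<le> (1 + q) * ((cmod (f t))\<^sup>2 + q * (cmod (f (t + T)))\<^sup>2)"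
    and "(1 - q) * ((cmod (f t))\<^sup>2 - q * (cmod (f (t + T)))\<^sup>2) \<le> (cmod (shift_sum T q f t))\<^sup>2"
proof -
  define x y where "x = cmod (f t)" and "y = cmod (f (t + T))"
  define r where "r = Re (cnj (- of_real q * f (t + T)) * f t)"
  have eq: "(cmod (shift_sum T q f t))\<^sup>2 = x\<^sup>2 - 2 * r + q\<^sup>2 * y\<^sup>2"
    using cmod_diff_sq[of "f t" "- of_real q * f (t + T)"] assms
    by (simp add: shift_sum_def x_def y_def r_def norm_mult power_mult_distrib)
  have r: "\<bar>r\<bar> \<le> q * (x * y)"
    using abs_Re_le_cmod[of "cnj (- of_real q * f (t + T)) * f t"] assms
    by (simp add: r_def x_def y_def norm_mult mult_ac)
  have xy: "2 * (q * (x * y)) \<le> q * (x\<^sup>2 + y\<^sup>2)"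
    using mult_left_mono[OF sum_squares_bound[of x y] assms(1)] by (simp add: algebra_simps)
  show "(cmod (shift_sum T q f t))\<^sup>2 \<le> (1 + q) * ((cmod (f t))\<^sup>2 + q * (cmod (f (t + T)))\<^sup>2)"
    using r xy unfolding eq x_def[symmetric] y_def[symmetric]
    by (simp add: algebra_simps power2_eq_square)
  show "(1 - q) * ((cmod (f t))\<^sup>2 - q * (cmod (f (t + T)))\<^sup>2) \<le> (cmod (shift_sum T q f t))\<^sup>2"
    using r xy unfolding eq x_def[symmetric] y_def[symmetric]
    by (simp add: algebra_simps power2_eq_square)
qed

lemma shift_sum_integral_bounds:
  assumes q: "0 \<le> q" "q \<le> 1" and f: "square_integrable f"
  shows "square_integrable (shift_sum T q f)"
    and "(LINT t|lborel. (cmod (shift_sum T q f t))\<^sup>2) \<le> (1 + q)\<^sup>2 * (L2_norm f)\<^sup>2"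
    and "(1 - q)\<^sup>2 * (L2_norm f)\<^sup>2 \<le> (LINT t|lborel. (cmod (shift_sum T q f t))\<^sup>2)"
proof -
  note fT = square_integrable_shift[OF f, of T]
  have [measurable]: "f \<in> borel_measurable borel" using f by (simp add: square_integrable_def)
  have int: "integrable lborel (\<lambda>t. (cmod (f t))\<^sup>2)" "integrable lborel (\<lambda>t. (cmod (f (t + T)))\<^sup>2)"
    using f fT(1) by (auto simp: square_integrable_def)
  have norm: "(L2_norm f)\<^sup>2 = (LINT t|lborel. (cmod (f t))\<^sup>2)"
    by (simp add: L2_norm_def)
  have ub: "integrable lborel (\<lambda>t. (1 + q) * ((cmod (f t))\<^sup>2 + q * (cmod (f (t + T)))\<^sup>2))"
    using int by simp
  have fi: "integrable lborel (\<lambda>t. (cmod (shift_sum T q f t))\<^sup>2)"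
    using shift_sum_bounds(1)[OF q] q
    by (intro Bochner_Integration.integrable_bound[OF ub]) (auto simp: shift_sum_def)
  then show "square_integrable (shift_sum T q f)"
    by (simp add: square_integrable_def shift_sum_def[abs_def])
  have "(LINT t|lborel. (cmod (shift_sum T q f t))\<^sup>2) \<le> (LINT t|lborel. (1 + q) * ((cmod (f t))\<^sup>2 + q * (cmod (f (t + T)))\<^sup>2))"
    by (intro integral_mono fi ub shift_sum_bounds q)
  also have "\<dots> = (1 + q)\<^sup>2 * (L2_norm f)\<^sup>2"
    using int fT(2) unfolding norm by (simp add: power2_eq_square algebra_simps)
  finally show "(LINT t|lborel. (cmod (shift_sum T q f t))\<^sup>2) \<le> (1 + q)\<^sup>2 * (L2_norm f)\<^sup>2" .
  have "(1 - q)\<^sup>2 * (L2_norm f)\<^sup>2 = (LINT t|lborel. (1 - q) * ((cmod (f t))\<^sup>2 - q * (cmod (f (t + T)))\<^sup>2))"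
    using int fT(2) unfolding norm by (simp add: power2_eq_square algebra_simps)
  also have "\<dots> \<le> (LINT t|lborel. (cmod (shift_sum T q f t))\<^sup>2)"
    using int by (intro integral_mono fi shift_sum_bounds q) auto
  finally show "(1 - q)\<^sup>2 * (L2_norm f)\<^sup>2 \<le> (LINT t|lborel. (cmod (shift_sum T q f t))\<^sup>2)" .
qed

text \<open>Parseval's identity for each translate, then Tonelli's theorem for the sum over the translates.\<close>

lemma gabor_sum_g2:
  assumes a: "a > 0" and n: "n \<ge> 1" and b: "b = 1 / (real n * a)" and \<gamma>: "\<gamma> > 0" and C: "C > 0"
    and f: "square_integrable f"
  shows "gabor_sum (g2 b C \<gamma>) (rect_lattice a b) f =
    (\<integral>\<^sup>+t. ennreal (real n * a * C\<^sup>2 * window_weight a n \<gamma> t *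
        (cmod (shift_sum (real n * a) (exp (- \<gamma> * (real n * a))) f t))\<^sup>2) \<partial>lborel)"
proof -
  define T where "T = real n * a"
  define q where "q = exp (- \<gamma> * T)"
  have T: "T > 0" using a n by (simp add: T_def)
  have b': "b = 1 / T" by (simp add: b T_def)
  have q: "0 \<le> q" "q \<le> 1" using \<gamma> T by (auto simp: q_def)
  let ?F = "shift_sum T q f"
  have F: "square_integrable ?F" using q f by (rule shift_sum_integral_bounds(1))
  have F_meas [measurable]: "?F \<in> borel_measurable borel" using F by (simp add: square_integrable_def)
  have "(\<Sum>\<^sub>\<infinity>l. ennreal ((cmod (L2_inner f (tf_shift (a * of_int k, b * of_int l) (g2 b C \<gamma>))))\<^sup>2)) =
      (\<integral>\<^sup>+t. ennreal (T * C\<^sup>2 * (cmod (?F t))\<^sup>2) * (ennreal (exp (- 2 * \<gamma> * (t - a * of_int k)))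
         * indicator {a * of_int k..<a * of_int k + real n * a} t) \<partial>lborel)" for k :: int
  proof -
    define x where "x = a * real_of_int k"
    define h where "h t = of_real (C * exp (- \<gamma> * (t - x))) * ?F t" for t
    have h_meas [measurable]: "h \<in> borel_measurable borel" unfolding h_def by measurable
    have h_sq: "(cmod (h t))\<^sup>2 = C\<^sup>2 * exp (- 2 * \<gamma> * (t - x)) * (cmod (?F t))\<^sup>2" for t
      using C by (simp add: h_def norm_mult power_mult_distrib exp_of_nat_mult[symmetric] algebra_simps exp_double[symmetric])
    have h_L2: "L2_on x T h"
      unfolding L2_on_def
    proof
      show "h \<in> borel_measurable (period_measure x T)" by (intro measurable_period_measure) simp
      have "integrable (period_measure x T) (\<lambda>t. (cmod (h t))\<^sup>2) \<longleftrightarrow>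
          integrable lborel (\<lambda>t. indicator {x..<x + T} t *\<^sub>R (cmod (h t))\<^sup>2)"
        unfolding period_measure_def by (rule integrable_restrict_space) simp
      also have "\<dots>"
      proof (rule Bochner_Integration.integrable_bound)
        show "integrable lborel (\<lambda>t. C\<^sup>2 * (cmod (?F t))\<^sup>2)"
          using F by (auto simp: square_integrable_def)
        show "AE t in lborel. norm (indicator {x..<x + T} t *\<^sub>R (cmod (h t))\<^sup>2) \<le> norm (C\<^sup>2 * (cmod (?F t))\<^sup>2)"
          using \<gamma> by (intro AE_I2) (auto simp: indicator_def h_sq abs_mult intro!: mult_right_mono mult_left_le)
      qed measurable
      finally show "integrable (period_measure x T) (\<lambda>t. (cmod (h t))\<^sup>2)" .
    qed
    have "(\<Sum>\<^sub>\<infinity>l. ennreal ((cmod (L2_inner f (tf_shift (x, b * of_int l) (g2 b C \<gamma>))))\<^sup>2)) =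
        (\<Sum>\<^sub>\<infinity>l. ennreal ((cmod (fourier_coeff x T h l))\<^sup>2))"
      unfolding L2_inner_tf_shift_g2[OF T b' \<gamma> C f] h_def q_def ..
    also have "\<dots> = ennreal (T * (LINT t|period_measure x T. (cmod (h t))\<^sup>2))"
      by (rule parseval[OF T h_meas h_L2])
    also have "\<dots> = ennreal T * (\<integral>\<^sup>+t. ennreal ((cmod (h t))\<^sup>2) \<partial>period_measure x T)"
      using T h_L2 by (simp add: ennreal_mult' nn_integral_eq_integral L2_on_def)
    also have "(\<integral>\<^sup>+t. ennreal ((cmod (h t))\<^sup>2) \<partial>period_measure x T) =
        (\<integral>\<^sup>+t. ennreal ((cmod (h t))\<^sup>2) * indicator {x..<x + T} t \<partial>lborel)"
      unfolding period_measure_def by (rule nn_integral_restrict_space) simp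
    also have "ennreal T * \<dots> = (\<integral>\<^sup>+t. ennreal T * (ennreal ((cmod (h t))\<^sup>2) * indicator {x..<x + T} t) \<partial>lborel)"
      by (rule nn_integral_cmult[symmetric]) measurable
    also have "\<dots> = (\<integral>\<^sup>+t. ennreal (T * C\<^sup>2 * (cmod (?F t))\<^sup>2) * (ennreal (exp (- 2 * \<gamma> * (t - x)))
         * indicator {x..<x + T} t) \<partial>lborel)"
      using T by (intro nn_integral_cong) (simp add: h_sq ennreal_mult' mult_ac)
    finally show ?thesis unfolding x_def T_def .
  qed
  then have "gabor_sum (g2 b C \<gamma>) (rect_lattice a b) f =
      (\<integral>\<^sup>+k. \<integral>\<^sup>+t. ennreal (T * C\<^sup>2 * (cmod (?F t))\<^sup>2) * (ennreal (exp (- 2 * \<gamma> * (t - a * of_int k)))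
         * indicator {a * of_int k..<a * of_int k + real n * a} t) \<partial>lborel \<partial>count_space (UNIV :: int set))"
    using a T b' by (subst gabor_sum_rect_lattice) auto
  also have "\<dots> = (\<integral>\<^sup>+t. \<integral>\<^sup>+k. ennreal (T * C\<^sup>2 * (cmod (?F t))\<^sup>2) * (ennreal (exp (- 2 * \<gamma> * (t - a * of_int k)))
         * indicator {a * of_int k..<a * of_int k + real n * a} t) \<partial>count_space (UNIV :: int set) \<partial>lborel)"
    by (rule nn_integral_count_space_nn_integral[symmetric]) auto
  also have "\<dots> = (\<integral>\<^sup>+t. ennreal (T * C\<^sup>2 * (cmod (?F t))\<^sup>2) * ennreal (window_weight a n \<gamma> t) \<partial>lborel)"
    unfolding window_weight_eq_sum[OF a, symmetric] by (intro nn_integral_cong nn_integral_cmult) simp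
  also have "\<dots> = (\<integral>\<^sup>+t. ennreal (T * C\<^sup>2 * window_weight a n \<gamma> t * (cmod (?F t))\<^sup>2) \<partial>lborel)"
    using T by (intro nn_integral_cong) (simp add: ennreal_mult'[symmetric] mult_ac flip: ennreal_mult'')
  finally show ?thesis unfolding T_def q_def .
qed

section \<open>Sharpness and closed forms of the frame bounds\<close>

text \<open>The value \<open>\<beta> j\<close> on the tooth \<open>[j T + c, j T + c + d)\<close> of each cell. Defining the comb through the
  floor function makes the action of the shift by \<open>T\<close> a shift of \<open>\<beta>\<close> (\<open>shift_sum_comb_fun\<close>).\<close>

definition comb_fun :: "real \<Rightarrow> real \<Rightarrow> real \<Rightarrow> (int \<Rightarrow> real) \<Rightarrow> real \<Rightarrow> real" where
  "comb_fun T c d \<beta> t = (if t - T * of_int \<lfloor>t / T\<rfloor> \<in> {c..<c + d} then \<beta> \<lfloor>t / T\<rfloor> else 0)"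

lemma comb_fun_eq_sum:
  assumes T: "T > 0" and c: "0 \<le> c" "c + d \<le> T" and J: "finite J" "\<And>j. j \<notin> J \<Longrightarrow> \<beta> j = 0"
  shows "comb_fun T c d \<beta> = (\<lambda>t. \<Sum>j\<in>J. indicator {T * of_int j + c..<T * of_int j + c + d} t * \<beta> j)"
proof
  fix t
  have ind: "indicator {T * of_int j + c..<T * of_int j + c + d} t =
      (if j = \<lfloor>t / T\<rfloor> then indicator {c..<c + d} (t - T * of_int \<lfloor>t / T\<rfloor>) else (0::real))" for j
  proof (cases "j = \<lfloor>t / T\<rfloor>")
    case False
    have "t \<notin> {T * of_int j + c..<T * of_int j + c + d}"
    proof
      assume "t \<in> {T * of_int j + c..<T * of_int j + c + d}"
      then have "T * of_int j \<le> t" "t < T * of_int j + T" using c by auto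
      then have "\<lfloor>t / T\<rfloor> = j" using T by (intro floor_unique) (auto simp: field_simps)
      with False show False by simp
    qed
    with False show ?thesis by simp
  qed (auto simp: indicator_def)
  have "(\<Sum>j\<in>J. indicator {T * of_int j + c..<T * of_int j + c + d} t * \<beta> j) =
      (\<Sum>j\<in>J. if j = \<lfloor>t / T\<rfloor> then indicator {c..<c + d} (t - T * of_int \<lfloor>t / T\<rfloor>) * \<beta> \<lfloor>t / T\<rfloor> else 0)"
    unfolding ind by (intro sum.cong) auto
  also have "\<dots> = comb_fun T c d \<beta> t"
    using J by (simp add: comb_fun_def indicator_def)
  finally show "comb_fun T c d \<beta> t = (\<Sum>j\<in>J. indicator {T * of_int j + c..<T * of_int j + c + d} t * \<beta> j)" ..
qed

lemma comb_fun_integral: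
  assumes T: "T > 0" and c: "0 \<le> c" "c + d \<le> T" and "d \<ge> 0" and J: "finite J" "\<And>j. j \<notin> J \<Longrightarrow> \<beta> j = 0"
  shows "integrable lborel (comb_fun T c d \<beta>)" and "(LINT t|lborel. comb_fun T c d \<beta> t) = d * (\<Sum>j\<in>J. \<beta> j)"
proof -
  have i: "integrable lborel (indicator {T * of_int j + c..<T * of_int j + c + d} :: real \<Rightarrow> real)" for j
    using \<open>d \<ge> 0\<close> by (intro integrable_real_indicator) auto
  have eq: "comb_fun T c d \<beta> = (\<lambda>t. \<Sum>j\<in>J. indicator {T * of_int j + c..<T * of_int j + c + d} t * \<beta> j)"
    by (rule comb_fun_eq_sum[OF T c J(1)]) (rule J(2))
  show "integrable lborel (comb_fun T c d \<beta>)"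
    unfolding eq using i by auto
  show "(LINT t|lborel. comb_fun T c d \<beta> t) = d * (\<Sum>j\<in>J. \<beta> j)"
    unfolding eq using i \<open>d \<ge> 0\<close>
    by (subst Bochner_Integration.integral_sum) (auto simp: sum_distrib_left)
qed

lemma comb_fun_measurable [measurable]: "comb_fun T c d \<beta> \<in> borel_measurable borel"
  unfolding comb_fun_def[abs_def] by measurable

lemma comb_fun_square: "(comb_fun T c d \<beta> t)\<^sup>2 = comb_fun T c d (\<lambda>j. (\<beta> j)\<^sup>2) t"
  by (simp add: comb_fun_def)

lemma shift_sum_comb_fun:
  assumes "T > 0"
  shows "shift_sum T q (\<lambda>t. of_real (comb_fun T c d \<beta> t)) t =
    of_real (comb_fun T c d (\<lambda>j. \<beta> j + q * \<beta> (j + 1)) t)"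
proof -
  have "(t + T) / T = t / T + 1" using assms by (simp add: field_simps)
  then have "\<lfloor>(t + T) / T\<rfloor> = \<lfloor>t / T\<rfloor> + 1" by simp
  then show ?thesis by (simp add: shift_sum_def comb_fun_def algebra_simps)
qed

definition alternating_block :: "real \<Rightarrow> nat \<Rightarrow> int \<Rightarrow> real" where
  "alternating_block s m j = (if 0 \<le> j \<and> j \<le> int m then s ^ nat j else 0)"

text \<open>Inside the block two neighbouring values combine to \<open>\<plusminus>(1 + s q)\<close>; the two ends contribute
  \<open>q\<^sup>2\<close> and \<open>1\<close>, which is negligible for long blocks.\<close>

lemma sum_alternating_block:
  assumes s: "s\<^sup>2 = 1"
  shows "(\<Sum>j\<in>{-1..int m}. (alternating_block s m j)\<^sup>2) = real m + 1"
    and "(\<Sum>j\<in>{-1..int m}. (alternating_block s m j + q * alternating_block s m (j + 1))\<^sup>2) =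
      q\<^sup>2 + 1 + real m * (1 + s * q)\<^sup>2"
proof -
  have sk: "(s ^ k)\<^sup>2 = 1" for k
    using s by (simp add: power_mult[symmetric] power_mult mult.commute[of k])
  have split: "{-1..int m} = insert (-1) (insert (int m) {0..<int m})" by auto
  show "(\<Sum>j\<in>{-1..int m}. (alternating_block s m j)\<^sup>2) = real m + 1"
    unfolding split by (simp add: alternating_block_def sk)
  have "(alternating_block s m j + q * alternating_block s m (j + 1))\<^sup>2 = (1 + s * q)\<^sup>2" if "j \<in> {0..<int m}" for j
  proof -
    have "alternating_block s m j + q * alternating_block s m (j + 1) = s ^ nat j * (1 + s * q)"
      using that by (simp add: alternating_block_def nat_add_distrib algebra_simps)
    then show ?thesis by (simp add: power_mult_distrib sk)
  qed
  then show "(\<Sum>j\<in>{-1..int m}. (alternating_block s m j + q * alternating_block s m (j + 1))\<^sup>2) =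
      q\<^sup>2 + 1 + real m * (1 + s * q)\<^sup>2"
    unfolding split by (simp add: alternating_block_def sk)
qed

lemma window_weight_nonneg: "0 \<le> window_weight a n \<gamma> t"
  by (simp add: window_weight_def sum_nonneg)

lemma window_weight_bounds:
  assumes a: "a > 0" and \<gamma>: "\<gamma> > 0"
  shows "exp (- 2 * \<gamma> * a) * (\<Sum>r<n. exp (- 2 * \<gamma> * a * real r)) \<le> window_weight a n \<gamma> t"
    and "window_weight a n \<gamma> t \<le> (\<Sum>r<n. exp (- 2 * \<gamma> * a * real r))"
proof -
  have "a * of_int \<lfloor>t / a\<rfloor> \<le> t"
    using a of_int_floor_le[of "t / a"] by (simp add: pos_le_divide_eq mult.commute del: of_int_floor_le)
  moreover have "t \<le> a * of_int \<lfloor>t / a\<rfloor> + a"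
    using a real_of_int_floor_add_one_ge[of "t / a"] by (simp add: field_simps)
  ultimately have f: "0 \<le> t - a * of_int \<lfloor>t / a\<rfloor>" "t - a * of_int \<lfloor>t / a\<rfloor> \<le> a"
    by auto
  have S: "0 \<le> (\<Sum>r<n. exp (- 2 * \<gamma> * a * real r))" by (intro sum_nonneg) simp
  have "exp (- 2 * \<gamma> * a) \<le> exp (- 2 * \<gamma> * (t - a * of_int \<lfloor>t / a\<rfloor>))" using f \<gamma> by simp
  then show "exp (- 2 * \<gamma> * a) * (\<Sum>r<n. exp (- 2 * \<gamma> * a * real r)) \<le> window_weight a n \<gamma> t"
    unfolding window_weight_def by (rule mult_right_mono) (rule S)
  have "exp (- 2 * \<gamma> * (t - a * of_int \<lfloor>t / a\<rfloor>)) \<le> 1" using f \<gamma> by simp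
  from mult_right_mono[OF this S] show "window_weight a n \<gamma> t \<le> (\<Sum>r<n. exp (- 2 * \<gamma> * a * real r))"
    unfolding window_weight_def by simp
qed

text \<open>The period \<open>T = n a\<close> of the comb is a multiple of the period \<open>a\<close> of the weight, so all teeth
  see the same values of the weight.\<close>

lemma window_weight_on_comb:
  assumes a: "a > 0" and n: "n \<ge> 1" and \<gamma>: "\<gamma> > 0" and c: "0 \<le> c" "c + d \<le> a"
    and t: "t - (real n * a) * of_int \<lfloor>t / (real n * a)\<rfloor> \<in> {c..<c + d}"
  shows "exp (- 2 * \<gamma> * (c + d)) * (\<Sum>r<n. exp (- 2 * \<gamma> * a * real r)) \<le> window_weight a n \<gamma> t"
    and "window_weight a n \<gamma> t \<le> exp (- 2 * \<gamma> * c) * (\<Sum>r<n. exp (- 2 * \<gamma> * a * real r))"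
proof -
  define j where "j = \<lfloor>t / (real n * a)\<rfloor>"
  define u where "u = t - (real n * a) * of_int j"
  have u: "c \<le> u" "u < c + d" using t by (auto simp: u_def j_def)
  have eq: "t = a * of_int (int n * j) + u" by (simp add: u_def)
  have "\<lfloor>t / a\<rfloor> = int n * j"
  proof (rule floor_unique)
    show "of_int (int n * j) \<le> t / a" using a u c unfolding eq by (simp add: field_simps)
    show "t / a < of_int (int n * j) + 1" using a u c unfolding eq by (simp add: field_simps)
  qed
  then have w: "window_weight a n \<gamma> t = exp (- 2 * \<gamma> * u) * (\<Sum>r<n. exp (- 2 * \<gamma> * a * real r))"
    by (simp add: window_weight_def u_def algebra_simps)
  have S: "0 \<le> (\<Sum>r<n. exp (- 2 * \<gamma> * a * real r))" by (intro sum_nonneg) simp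
  show "exp (- 2 * \<gamma> * (c + d)) * (\<Sum>r<n. exp (- 2 * \<gamma> * a * real r)) \<le> window_weight a n \<gamma> t"
    unfolding w using u \<gamma> by (intro mult_right_mono S) simp
  show "window_weight a n \<gamma> t \<le> exp (- 2 * \<gamma> * c) * (\<Sum>r<n. exp (- 2 * \<gamma> * a * real r))"
    unfolding w using u \<gamma> by (intro mult_right_mono S) simp
qed

text \<open>These are the almost extremal functions: \<open>s = 1\<close> with \<open>c = 0\<close> for the upper frame bound,
  \<open>s = -1\<close> with \<open>c + d = a\<close> for the lower one.\<close>

lemma gabor_sum_test_function:
  fixes a \<gamma> c d C s :: real and n m :: nat
  assumes a: "a > 0" and n: "n \<ge> 1" and b: "b = 1 / (real n * a)" and \<gamma>: "\<gamma> > 0" and C: "C > 0"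
    and c: "0 \<le> c" "c + d \<le> a" and d: "d > 0" and s: "s\<^sup>2 = 1"
  defines "T \<equiv> real n * a"
  defines "q \<equiv> exp (- \<gamma> * T)"
  defines "S \<equiv> (\<Sum>r<n. exp (- 2 * \<gamma> * a * real r))"
  defines "f \<equiv> (\<lambda>t. complex_of_real (comb_fun T c d (alternating_block s m) t))"
  defines "Q \<equiv> d * (q\<^sup>2 + 1 + real m * (1 + s * q)\<^sup>2)"
  shows "square_integrable f" and "(L2_norm f)\<^sup>2 = d * (real m + 1)"
    and "ennreal (T * C\<^sup>2 * (exp (- 2 * \<gamma> * (c + d)) * S) * Q) \<le> gabor_sum (g2 b C \<gamma>) (rect_lattice a b) f"
    and "gabor_sum (g2 b C \<gamma>) (rect_lattice a b) f \<le> ennreal (T * C\<^sup>2 * (exp (- 2 * \<gamma> * c) * S) * Q)"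
proof -
  have T: "T > 0" using a n by (simp add: T_def)
  have "a \<le> T" using a n by (simp add: T_def)
  then have cT: "c + d \<le> T" using c by linarith
  let ?\<beta> = "alternating_block s m"
  define \<alpha> where "\<alpha> j = (?\<beta> j + q * ?\<beta> (j + 1))\<^sup>2" for j
  have J: "?\<beta> j = 0" "(?\<beta> j)\<^sup>2 = 0" "\<alpha> j = 0" if "j \<notin> {-1..int m}" for j
    using that by (auto simp: alternating_block_def \<alpha>_def)
  have fsq: "(cmod (f t))\<^sup>2 = comb_fun T c d (\<lambda>j. (?\<beta> j)\<^sup>2) t" for t
    by (simp add: f_def comb_fun_square)
  have d0: "d \<ge> 0" using d by simp
  show f: "square_integrable f"
    unfolding square_integrable_def fsq using comb_fun_integral(1)[OF T c(1) cT d0, of "{-1..int m}" "\<lambda>j. (?\<beta> j)\<^sup>2"] J(2)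
    by (simp add: f_def)
  show "(L2_norm f)\<^sup>2 = d * (real m + 1)"
    unfolding L2_norm_def fsq using comb_fun_integral(2)[OF T c(1) cT d0, of "{-1..int m}" "\<lambda>j. (?\<beta> j)\<^sup>2"] J(2) d0
    by (simp add: sum_alternating_block(1)[OF s])
  define K where "K = T * C\<^sup>2"
  have K: "K \<ge> 0" using T by (simp add: K_def)
  have gs: "gabor_sum (g2 b C \<gamma>) (rect_lattice a b) f =
      (\<integral>\<^sup>+t. ennreal (K * window_weight a n \<gamma> t * comb_fun T c d \<alpha> t) \<partial>lborel)"
  proof -
    have "(cmod (shift_sum T q f t))\<^sup>2 = comb_fun T c d \<alpha> t" for t
      unfolding f_def shift_sum_comb_fun[OF T] by (simp add: comb_fun_square \<alpha>_def[abs_def])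
    then show ?thesis
      unfolding gabor_sum_g2[OF a n b \<gamma> C f] T_def[symmetric] q_def[symmetric] K_def by simp
  qed
  have nonneg: "0 \<le> comb_fun T c d \<alpha> t" for t by (simp add: comb_fun_def \<alpha>_def)
  have int: "integrable lborel (comb_fun T c d \<alpha>)" "(LINT t|lborel. comb_fun T c d \<alpha> t) = Q"
    using comb_fun_integral[OF T c(1) cT d0, of "{-1..int m}" \<alpha>] J(3) sum_alternating_block(2)[OF s, of m q]
    by (auto simp: \<alpha>_def Q_def)
  have Sn: "S \<ge> 0" unfolding S_def by (intro sum_nonneg) simp
  have const: "(\<integral>\<^sup>+t. ennreal (K * M * comb_fun T c d \<alpha> t) \<partial>lborel) = ennreal (K * M * Q)" if "M \<ge> 0" for M
    using that K int nonneg by (subst nn_integral_eq_integral) auto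
  have "(\<integral>\<^sup>+t. ennreal (K * (exp (- 2 * \<gamma> * (c + d)) * S) * comb_fun T c d \<alpha> t) \<partial>lborel)
     \<le> (\<integral>\<^sup>+t. ennreal (K * window_weight a n \<gamma> t * comb_fun T c d \<alpha> t) \<partial>lborel)"
    using window_weight_on_comb(1)[OF a n \<gamma> c] K nonneg
    by (intro nn_integral_mono ennreal_leI) (auto simp: comb_fun_def S_def T_def \<alpha>_def window_weight_nonneg intro!: mult_mono mult_nonneg_nonneg sum_nonneg)
  then show "ennreal (T * C\<^sup>2 * (exp (- 2 * \<gamma> * (c + d)) * S) * Q) \<le> gabor_sum (g2 b C \<gamma>) (rect_lattice a b) f"
    unfolding gs using Sn by (subst (asm) const) (auto simp: K_def)
  have "(\<integral>\<^sup>+t. ennreal (K * window_weight a n \<gamma> t * comb_fun T c d \<alpha> t) \<partial>lborel)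
     \<le> (\<integral>\<^sup>+t. ennreal (K * (exp (- 2 * \<gamma> * c) * S) * comb_fun T c d \<alpha> t) \<partial>lborel)"
    using window_weight_on_comb(2)[OF a n \<gamma> c] K nonneg
    by (intro nn_integral_mono ennreal_leI) (auto simp: comb_fun_def S_def T_def \<alpha>_def window_weight_nonneg intro!: mult_mono mult_nonneg_nonneg sum_nonneg)
  then show "gabor_sum (g2 b C \<gamma>) (rect_lattice a b) f \<le> ennreal (T * C\<^sup>2 * (exp (- 2 * \<gamma> * c) * S) * Q)"
    unfolding gs using Sn by (subst (asm) const) (auto simp: K_def)
qed

text \<open>The largest value of the weight and the triangle inequality give an upper bound; the combs show
  that no smaller constant works.\<close>

lemma upper_frame_bound_g2:
  assumes a: "a > 0" and n: "n \<ge> 1" and b: "b = 1 / (real n * a)" and \<gamma>: "\<gamma> > 0" and C: "C > 0"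
  defines "T \<equiv> real n * a"
  defines "q \<equiv> exp (- \<gamma> * T)"
  defines "S \<equiv> (\<Sum>r<n. exp (- 2 * \<gamma> * a * real r))"
  shows "upper_frame_bound (g2 b C \<gamma>) (rect_lattice a b) = T * C\<^sup>2 * S * (1 + q)\<^sup>2"
proof -
  have T: "T > 0" using a n by (simp add: T_def)
  have q: "0 \<le> q" "q \<le> 1" using \<gamma> T by (auto simp: q_def)
  have S: "S \<ge> 0" unfolding S_def by (intro sum_nonneg) simp
  define K where "K = T * C\<^sup>2"
  have K: "K \<ge> 0" using T by (simp add: K_def)
  show ?thesis
    unfolding upper_frame_bound_def
  proof (rule Least_equality, intro conjI allI impI)
    show "0 \<le> T * C\<^sup>2 * S * (1 + q)\<^sup>2" using T S by simp
  next
    fix f assume f: "square_integrable f"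
    note F = shift_sum_integral_bounds[OF q f, of T]
    have "gabor_sum (g2 b C \<gamma>) (rect_lattice a b) f =
        (\<integral>\<^sup>+t. ennreal (K * window_weight a n \<gamma> t * (cmod (shift_sum T q f t))\<^sup>2) \<partial>lborel)"
      unfolding gabor_sum_g2[OF a n b \<gamma> C f] T_def q_def K_def by simp
    also have "\<dots> \<le> (\<integral>\<^sup>+t. ennreal (K * S * (cmod (shift_sum T q f t))\<^sup>2) \<partial>lborel)"
      using window_weight_bounds(2)[OF a \<gamma>, of n] K
      by (intro nn_integral_mono ennreal_leI mult_right_mono mult_left_mono) (auto simp: S_def)
    also have "\<dots> = ennreal (K * S * (LINT t|lborel. (cmod (shift_sum T q f t))\<^sup>2))"
      using F(1) K S by (subst nn_integral_eq_integral) (auto simp: square_integrable_def)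
    also have "\<dots> \<le> ennreal (K * S * ((1 + q)\<^sup>2 * (L2_norm f)\<^sup>2))"
      using F(2) K S by (intro ennreal_leI mult_left_mono) auto
    finally show "gabor_sum (g2 b C \<gamma>) (rect_lattice a b) f \<le> ennreal (T * C\<^sup>2 * S * (1 + q)\<^sup>2 * (L2_norm f)\<^sup>2)"
      by (simp add: K_def mult_ac)
  next
    fix B assume B: "0 \<le> B \<and> (\<forall>f. square_integrable f \<longrightarrow>
       gabor_sum (g2 b C \<gamma>) (rect_lattice a b) f \<le> ennreal (B * (L2_norm f)\<^sup>2))"
    have "K * (exp (- 2 * \<gamma> * (a / (real m + 1))) * S) * ((q\<^sup>2 + 1) / (real m + 1) + real m / (real m + 1) * (1 + q)\<^sup>2) \<le> B" for m
    proof -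
      \<comment> \<open>Blocks of \<open>m + 1\<close> teeth whose width shrinks as the block grows: one limit serves both.\<close>
      define d where "d = a / (real m + 1)"
      have d: "d > 0" "0 + d \<le> a" using a by (auto simp: d_def field_simps)
      note test = gabor_sum_test_function[OF a n b \<gamma> C order_refl d(2) d(1), of 1 m, folded T_def, folded q_def S_def]
      let ?Q = "q\<^sup>2 + 1 + real m * (1 + q)\<^sup>2"
      have "ennreal (K * (exp (- 2 * \<gamma> * d) * S) * (d * ?Q)) \<le> ennreal (B * (d * (real m + 1)))"
        using order_trans[OF test(3)] B test(1) test(2) by (auto simp: K_def)
      then have "K * (exp (- 2 * \<gamma> * d) * S) * (d * ?Q) \<le> B * (d * (real m + 1))"
        using B d by (subst (asm) ennreal_le_iff) auto
      then have "d * (K * (exp (- 2 * \<gamma> * d) * S) * ?Q) \<le> d * (B * (real m + 1))"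
        by (simp only: mult_ac)
      then have "K * (exp (- 2 * \<gamma> * d) * S) * ?Q \<le> B * (real m + 1)"
        using d(1) by (simp only: mult_le_cancel_left_pos)
      then have "K * (exp (- 2 * \<gamma> * d) * S) * (?Q / (real m + 1)) \<le> B"
        by (simp add: field_simps)
      then show ?thesis by (simp add: d_def add_divide_distrib)
    qed
    moreover have "(\<lambda>m. K * (exp (- 2 * \<gamma> * (a / (real m + 1))) * S) * ((q\<^sup>2 + 1) / (real m + 1) + real m / (real m + 1) * (1 + q)\<^sup>2))
        \<longlonglongrightarrow> K * (exp (- 2 * \<gamma> * 0) * S) * (0 + 1 * (1 + q)\<^sup>2)"
      by (intro tendsto_intros) real_asymp+
    ultimately have "K * (exp (- 2 * \<gamma> * 0) * S) * (0 + 1 * (1 + q)\<^sup>2) \<le> B"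
      by (intro LIMSEQ_le_const2) auto
    then show "T * C\<^sup>2 * S * (1 + q)\<^sup>2 \<le> B" by (simp add: K_def)
  qed
qed

lemma lower_frame_bound_g2:
  assumes a: "a > 0" and n: "n \<ge> 1" and b: "b = 1 / (real n * a)" and \<gamma>: "\<gamma> > 0" and C: "C > 0"
  defines "T \<equiv> real n * a"
  defines "q \<equiv> exp (- \<gamma> * T)"
  defines "S \<equiv> (\<Sum>r<n. exp (- 2 * \<gamma> * a * real r))"
  shows "lower_frame_bound (g2 b C \<gamma>) (rect_lattice a b) = T * C\<^sup>2 * (exp (- 2 * \<gamma> * a) * S) * (1 - q)\<^sup>2"
proof -
  have T: "T > 0" using a n by (simp add: T_def)
  have q: "0 \<le> q" "q \<le> 1" using \<gamma> T by (auto simp: q_def)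
  have S: "S \<ge> 0" unfolding S_def by (intro sum_nonneg) simp
  define K where "K = T * C\<^sup>2"
  have K: "K \<ge> 0" using T by (simp add: K_def)
  define E where "E = exp (- 2 * \<gamma> * a) * S"
  have E: "E \<ge> 0" using S by (simp add: E_def)
  show ?thesis
    unfolding lower_frame_bound_def
  proof (rule Greatest_equality, intro conjI allI impI)
    show "0 \<le> T * C\<^sup>2 * (exp (- 2 * \<gamma> * a) * S) * (1 - q)\<^sup>2" using T S by simp
  next
    fix f assume f: "square_integrable f"
    note F = shift_sum_integral_bounds[OF q f, of T]
    have "ennreal (K * E * ((1 - q)\<^sup>2 * (L2_norm f)\<^sup>2)) \<le> ennreal (K * E * (LINT t|lborel. (cmod (shift_sum T q f t))\<^sup>2))"
      using F(3) K E by (intro ennreal_leI mult_left_mono) auto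
    also have "\<dots> = (\<integral>\<^sup>+t. ennreal (K * E * (cmod (shift_sum T q f t))\<^sup>2) \<partial>lborel)"
      using F(1) K E by (subst nn_integral_eq_integral) (auto simp: square_integrable_def)
    also have "\<dots> \<le> (\<integral>\<^sup>+t. ennreal (K * window_weight a n \<gamma> t * (cmod (shift_sum T q f t))\<^sup>2) \<partial>lborel)"
      using window_weight_bounds(1)[OF a \<gamma>, of n] K
      by (intro nn_integral_mono ennreal_leI mult_right_mono mult_left_mono) (auto simp: S_def E_def)
    also have "\<dots> = gabor_sum (g2 b C \<gamma>) (rect_lattice a b) f"
      unfolding gabor_sum_g2[OF a n b \<gamma> C f] T_def q_def K_def by simp
    finally show "ennreal (T * C\<^sup>2 * (exp (- 2 * \<gamma> * a) * S) * (1 - q)\<^sup>2 * (L2_norm f)\<^sup>2) \<le> gabor_sum (g2 b C \<gamma>) (rect_lattice a b) f"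
      by (simp add: K_def E_def mult_ac)
  next
    fix A assume A: "0 \<le> A \<and> (\<forall>f. square_integrable f \<longrightarrow>
       ennreal (A * (L2_norm f)\<^sup>2) \<le> gabor_sum (g2 b C \<gamma>) (rect_lattice a b) f)"
    have "A \<le> K * (exp (- 2 * \<gamma> * (a - a / (real m + 1))) * S) * ((q\<^sup>2 + 1) / (real m + 1) + real m / (real m + 1) * (1 - q)\<^sup>2)" for m
    proof -
      \<comment> \<open>The teeth end at \<open>a\<close>, where the weight approaches its infimum.\<close>
      define d where "d = a / (real m + 1)"
      have "d > 0" "d \<le> a" using a by (auto simp: d_def divide_le_eq)
      then have d: "d > 0" "a - d + d \<le> a" "0 \<le> a - d" by auto
      note test = gabor_sum_test_function[OF a n b \<gamma> C d(3,2,1), of "-1" m, folded T_def, folded q_def S_def]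
      let ?Q = "q\<^sup>2 + 1 + real m * (1 - q)\<^sup>2"
      have "ennreal (A * (d * (real m + 1))) \<le> ennreal (K * (exp (- 2 * \<gamma> * (a - d)) * S) * (d * ?Q))"
        using order_trans[OF _ test(4)] A test(1) test(2) by (auto simp: K_def)
      then have "A * (d * (real m + 1)) \<le> K * (exp (- 2 * \<gamma> * (a - d)) * S) * (d * ?Q)"
        using K S d by (subst (asm) ennreal_le_iff) auto
      then have "d * (A * (real m + 1)) \<le> d * (K * (exp (- 2 * \<gamma> * (a - d)) * S) * ?Q)"
        by (simp only: mult_ac)
      then have "A * (real m + 1) \<le> K * (exp (- 2 * \<gamma> * (a - d)) * S) * ?Q"
        using d(1) by (simp only: mult_le_cancel_left_pos)
      then have "A \<le> K * (exp (- 2 * \<gamma> * (a - d)) * S) * (?Q / (real m + 1))"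
        by (simp add: field_simps)
      then show ?thesis by (simp add: d_def add_divide_distrib)
    qed
    moreover have "(\<lambda>m. K * (exp (- 2 * \<gamma> * (a - a / (real m + 1))) * S) * ((q\<^sup>2 + 1) / (real m + 1) + real m / (real m + 1) * (1 - q)\<^sup>2))
        \<longlonglongrightarrow> K * (exp (- 2 * \<gamma> * (a - 0)) * S) * (0 + 1 * (1 - q)\<^sup>2)"
      by (intro tendsto_intros) real_asymp+
    ultimately have "A \<le> K * (exp (- 2 * \<gamma> * (a - 0)) * S) * (0 + 1 * (1 - q)\<^sup>2)"
      by (intro LIMSEQ_le_const) auto
    then show "A \<le> T * C\<^sup>2 * (exp (- 2 * \<gamma> * a) * S) * (1 - q)\<^sup>2" by (simp add: K_def)
  qed
qed

lemma L2_norm_g2: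
  assumes b: "b > 0" and \<gamma>: "\<gamma> > 0" and C: "C > 0"
  shows "(L2_norm (g2 b C \<gamma>))\<^sup>2 = C\<^sup>2 * (1 - exp (- 4 * \<gamma> / b)) / (2 * \<gamma>)"
proof -
  have sq: "(cmod (g2 b C \<gamma> t))\<^sup>2 = C\<^sup>2 * (exp (- 2 * \<gamma> * t) * indicator {0..2 / b} t)" for t
    using C by (simp add: g2_def norm_mult power_mult_distrib indicator_def exp_double[symmetric] abs_mult)
  have "(LINT t|lborel. exp (- 2 * \<gamma> * t) * indicator {0..2 / b} t) =
      - exp (- 2 * \<gamma> * (2 / b)) / (2 * \<gamma>) - - exp (- 2 * \<gamma> * 0) / (2 * \<gamma>)"
    using b \<gamma> by (intro integral_FTC_Icc_real) (auto intro!: derivative_eq_intros continuous_intros)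
  also have "\<dots> = (1 - exp (- 4 * \<gamma> / b)) / (2 * \<gamma>)"
    by (simp add: diff_divide_distrib)
  finally show ?thesis
    unfolding L2_norm_def sq using \<gamma> b by simp
qed

definition upper_profile :: "nat \<Rightarrow> real \<Rightarrow> real" where
  "upper_profile n x = real n * x * (1 + coth x) * (1 + sech (real n * x))"

definition lower_profile :: "nat \<Rightarrow> real \<Rightarrow> real" where
  "lower_profile n x = real n * x * (coth x - 1) * (1 - sech (real n * x))"

lemma geometric_sum_exp:
  assumes "x > 0"
  shows "(\<Sum>r<n. exp (- x * real r)) = (1 - exp (- x * real n)) / (1 - exp (- x))"
proof -
  have "(\<Sum>r<n. exp (- x * real r)) = (\<Sum>r<n. exp (- x) ^ r)"
    by (simp add: exp_of_nat_mult[symmetric] mult.commute)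
  also have "\<dots> = (1 - exp (- x) ^ n) / (1 - exp (- x))"
    using assms by (subst sum_gp_strict) auto
  finally show ?thesis by (simp add: exp_of_nat_mult[symmetric] mult.commute)
qed

lemma coth_exp: "x > 0 \<Longrightarrow> 1 + coth x = 2 / (1 - exp (- 2 * x))" "x > 0 \<Longrightarrow> coth x - 1 = 2 * exp (- 2 * x) / (1 - exp (- 2 * x))"
proof -
  assume x: "x > 0"
  have e: "exp (- 2 * x) = exp (- x) * exp (- x)" by (simp add: exp_add[symmetric])
  have "exp (- x) < exp x" using x by simp
  moreover have "exp x * exp (- x) = 1" by (simp add: exp_add[symmetric])
  moreover have "exp (- x) * exp (-x) < 1" using x by (simp add: exp_add[symmetric])
  ultimately show "1 + coth x = 2 / (1 - exp (- 2 * x))" "coth x - 1 = 2 * exp (- 2 * x) / (1 - exp (- 2 * x))"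
    unfolding coth_def cosh_def sinh_def e by (simp_all add: field_simps)
qed

lemma sech_exp: "sech y = 2 * exp (- y) / (1 + (exp (- y))\<^sup>2)"
proof -
  have "exp y * exp (- y) = 1" by (simp add: exp_add[symmetric])
  moreover have "exp y + exp (- y) > 0" "1 + (exp (- y))\<^sup>2 > 0" by (auto intro!: add_pos_pos)
  ultimately show ?thesis
    unfolding sech_def cosh_def by (simp add: field_simps power2_eq_square)
qed

text \<open>The normalisation gives \<open>C\<^sup>2 = 2 \<gamma> / (1 - q\<^sup>4)\<close>; the factor \<open>1 - q\<^sup>2\<close> cancels against the geometric
  sum, and \<open>(1 \<plusminus> q)\<^sup>2 / (1 + q\<^sup>2) = 1 \<plusminus> sech (n x)\<close>.\<close>

lemma frame_bounds_closed_form: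
  assumes a: "a > 0" and n: "n \<ge> 1" and b: "b = 1 / (real n * a)" and \<gamma>: "\<gamma> > 0"
    and C: "C > 0" "L2_norm (g2 b C \<gamma>) = 1"
  shows "upper_frame_bound (g2 b C \<gamma>) (rect_lattice a b) = upper_profile n (a * \<gamma>)"
    and "lower_frame_bound (g2 b C \<gamma>) (rect_lattice a b) = lower_profile n (a * \<gamma>)"
proof -
  define x q S where "x = a * \<gamma>" and "q = exp (- \<gamma> * (real n * a))"
    and "S = (\<Sum>r<n. exp (- 2 * \<gamma> * a * real r))"
  have x: "x > 0" using a \<gamma> by (simp add: x_def)
  have q: "0 < q" "q < 1" using a n \<gamma> by (auto simp: q_def)
  then have q4: "q ^ 4 < 1" "q ^ 2 < 1" by (auto simp: power_less_one_iff)
  have "1 = C\<^sup>2 * (1 - exp (- 4 * \<gamma> / b)) / (2 * \<gamma>)"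
    using L2_norm_g2[of b \<gamma> C] C \<gamma> b a n by simp
  moreover have "exp (- 4 * \<gamma> / b) = q ^ 4"
    by (simp add: q_def b exp_of_nat_mult[symmetric])
  ultimately have C2: "C\<^sup>2 = 2 * \<gamma> / (1 - q ^ 4)"
    using \<gamma> q4 by (simp add: field_simps)
  have S: "S = (1 - q\<^sup>2) / (1 - exp (- 2 * x))"
  proof -
    have "S = (1 - exp (- (2 * x) * real n)) / (1 - exp (- (2 * x)))"
      unfolding S_def using geometric_sum_exp[of "2 * x" n] x by (simp add: x_def mult_ac)
    moreover have "exp (- (2 * x) * real n) = q\<^sup>2"
      by (simp add: q_def x_def exp_double[symmetric] mult_ac)
    ultimately show ?thesis by simp
  qed
  have qe: "exp (- (real n * x)) = q" by (simp add: q_def x_def mult_ac)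
  have common: "real n * a * C\<^sup>2 * S = real n * x * (2 / (1 - exp (- 2 * x))) / (1 + q\<^sup>2)"
  proof -
    have "1 - q ^ 4 = (1 - q\<^sup>2) * (1 + q\<^sup>2)" by (simp add: algebra_simps flip: power_add)
    then have "real n * a * C\<^sup>2 * S = real n * a * (2 * \<gamma>) * (1 - q\<^sup>2) / ((1 - q\<^sup>2) * (1 + q\<^sup>2)) / (1 - exp (- 2 * x))"
      unfolding C2 S by simp
    also have "\<dots> = real n * x * 2 / (1 + q\<^sup>2) / (1 - exp (- 2 * x))"
      using q4 by (simp add: x_def)
    finally show ?thesis by (simp add: field_simps)
  qed
  have pos: "1 + q\<^sup>2 > 0" using q by (auto intro: add_pos_pos)
  have "upper_frame_bound (g2 b C \<gamma>) (rect_lattice a b) = (real n * a * C\<^sup>2 * S) * (1 + q)\<^sup>2"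
    unfolding upper_frame_bound_g2[OF a n b \<gamma> C(1)] S_def q_def by simp
  also have "\<dots> = real n * x * (1 + coth x) * ((1 + q)\<^sup>2 / (1 + q\<^sup>2))"
    unfolding common coth_exp(1)[OF x] by simp
  also have "(1 + q)\<^sup>2 / (1 + q\<^sup>2) = 1 + sech (real n * x)"
    unfolding sech_exp qe using pos by (simp add: field_simps power2_eq_square)
  finally show "upper_frame_bound (g2 b C \<gamma>) (rect_lattice a b) = upper_profile n (a * \<gamma>)"
    by (simp add: upper_profile_def x_def)
  have "lower_frame_bound (g2 b C \<gamma>) (rect_lattice a b) = exp (- 2 * x) * (real n * a * C\<^sup>2 * S) * (1 - q)\<^sup>2"
    unfolding lower_frame_bound_g2[OF a n b \<gamma> C(1)] S_def q_def x_def by (simp add: mult_ac)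
  also have "\<dots> = real n * x * (coth x - 1) * ((1 - q)\<^sup>2 / (1 + q\<^sup>2))"
    unfolding common coth_exp(2)[OF x] by simp
  also have "(1 - q)\<^sup>2 / (1 + q\<^sup>2) = 1 - sech (real n * x)"
    unfolding sech_exp qe using pos by (simp add: field_simps power2_eq_square)
  finally show "lower_frame_bound (g2 b C \<gamma>) (rect_lattice a b) = lower_profile n (a * \<gamma>)"
    by (simp add: lower_profile_def x_def)
qed

section \<open>The Langevin function\<close>

lemma pos_from_deriv:
  fixes f f' :: "real \<Rightarrow> real"
  assumes "f 0 = 0" "\<And>x. (f has_real_derivative f' x) (at x)" "\<And>x. x > 0 \<Longrightarrow> f' x > 0" "x > 0"
  shows "f x > 0"
proof -
  have "f 0 < f x"
  proof (rule DERIV_pos_imp_increasing_open[OF assms(4)])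
    show "\<exists>y. (f has_real_derivative y) (at t) \<and> y > 0" if "0 < t" "t < x" for t
      using assms(2,3) that by blast
    show "continuous_on {0..x} f"
      using assms(2) by (meson DERIV_isCont continuous_at_imp_continuous_on)
  qed
  then show ?thesis using assms(1) by simp
qed

lemma sinh_less_times_cosh:
  assumes "(x::real) > 0" shows "sinh x < x * cosh x"
proof -
  have "x * cosh x - sinh x > 0"
    using assms by (intro pos_from_deriv[of "\<lambda>x. x * cosh x - sinh x" "\<lambda>x. x * sinh x" x])
      (auto intro!: derivative_eq_intros)
  then show ?thesis by simp
qed

lemma less_sinh:
  assumes "(x::real) > 0" shows "x < sinh x"
proof -
  have "sinh x - x > 0"
    using assms cosh_real_strict_mono[of 0]
    by (intro pos_from_deriv[of "\<lambda>x. sinh x - x" "\<lambda>x. cosh x - 1" x])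
      (auto intro!: derivative_eq_intros)
  then show ?thesis by simp
qed

text \<open>The bound \<open>sinh_less_times_cosh\<close>, this one and the next are the first three convergents of
  \<open>tanh x = x / (1 + x\<^sup>2 / (3 + x\<^sup>2 / (5 + \<dots>)))\<close>, in a form where the derivative of each later
  difference is \<open>x\<close> times the previous one.\<close>

lemma cosh_sinh_pade_lower:
  assumes "(x::real) > 0" shows "3 * x * cosh x < (3 + x\<^sup>2) * sinh x"
proof -
  have "(3 + x\<^sup>2) * sinh x - 3 * x * cosh x > 0"
    using sinh_less_times_cosh assms
    by (intro pos_from_deriv[of "\<lambda>x. (3 + x\<^sup>2) * sinh x - 3 * x * cosh x" "\<lambda>x. x * (x * cosh x - sinh x)" x])
      (auto intro!: derivative_eq_intros simp: algebra_simps power2_eq_square)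
  then show ?thesis by simp
qed

lemma cosh_sinh_pade_upper:
  assumes "(x::real) > 0" shows "(15 + 6 * x\<^sup>2) * sinh x < x * (15 + x\<^sup>2) * cosh x"
proof -
  have pos: "t * ((3 + t\<^sup>2) * sinh t - 3 * t * cosh t) > 0" if "t > 0" for t :: real
    using cosh_sinh_pade_lower[OF that] that by (intro mult_pos_pos) auto
  have "x * (15 + x\<^sup>2) * cosh x - (15 + 6 * x\<^sup>2) * sinh x > 0"
    using assms pos
    by (intro pos_from_deriv[of "\<lambda>x. x * (15 + x\<^sup>2) * cosh x - (15 + 6 * x\<^sup>2) * sinh x"
          "\<lambda>x. x * ((3 + x\<^sup>2) * sinh x - 3 * x * cosh x)" x])
      (auto intro!: derivative_eq_intros simp: algebra_simps power2_eq_square)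
  then show ?thesis by simp
qed

definition langevin :: "real \<Rightarrow> real" where
  "langevin x = coth x - 1 / x"

lemma coth_gt_1: "x > 0 \<Longrightarrow> coth x > 1"
  unfolding coth_def by (simp add: cosh_def sinh_def field_simps)

lemma langevin_upper: assumes "x > 0" shows "langevin x < x / 3"
proof -
  have "sinh x > 0" using assms by simp
  then show ?thesis using cosh_sinh_pade_lower[OF assms] assms
    by (simp add: langevin_def coth_def field_simps power2_eq_square)
qed

lemma langevin_lower: assumes "x > 0" shows "5 * x / (15 + x\<^sup>2) < langevin x"
proof -
  have p: "sinh x > 0" "15 + x\<^sup>2 > 0" using assms by (auto intro: add_pos_nonneg)
  have "5 * x / (15 + x\<^sup>2) + 1 / x = (15 + 6 * x\<^sup>2) / (x * (15 + x\<^sup>2))"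
    using assms p(2) by (simp add: field_simps power2_eq_square)
  also have "\<dots> < cosh x / sinh x"
    using cosh_sinh_pade_upper[OF assms] p assms by (simp add: divide_simps mult_ac)
  finally show ?thesis by (simp add: langevin_def coth_def)
qed

lemma langevin_pos: assumes "x > 0" shows "langevin x > 0"
proof -
  have "5 * x / (15 + x\<^sup>2) \<ge> 0" using assms by (simp add: add_nonneg_nonneg)
  with langevin_lower[OF assms] show ?thesis by linarith
qed

lemma langevin_less_1: assumes "x > 0" shows "langevin x < 1"
proof -
  have "cosh x - sinh x = exp (- x)" by (simp add: cosh_minus_sinh)
  moreover have "x * exp (- x) < x * 1" using assms by (intro mult_strict_left_mono) auto
  ultimately have "x * (cosh x - sinh x) < sinh x" using less_sinh[OF assms] by simp
  then show ?thesis using assms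
    by (simp add: langevin_def coth_def field_simps)
qed

text \<open>The derivative is expressed through the function itself (a Riccati equation), so that bounds for
  the function become bounds for its derivative.\<close>

lemma langevin_deriv:
  assumes "x > 0"
  shows "(langevin has_real_derivative 1 - (langevin x)\<^sup>2 - 2 * langevin x / x) (at x)"
proof -
  have s: "sinh x > 0" using assms by simp
  have "((\<lambda>x. cosh x / sinh x - 1 / x) has_real_derivative
      (sinh x * sinh x - cosh x * cosh x) / (sinh x * sinh x) + 1 / (x * x)) (at x)"
    using assms s by (auto intro!: derivative_eq_intros simp: field_simps)
  moreover have "(sinh x * sinh x - cosh x * cosh x) / (sinh x * sinh x) + 1 / (x * x) =
      1 - (langevin x)\<^sup>2 - 2 * langevin x / x"
    using assms s by (simp add: langevin_def coth_def field_simps power2_eq_square)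
  ultimately show ?thesis by (simp add: langevin_def[abs_def] coth_def)
qed

lemma langevin_deriv_pos:
  assumes "x > 0" shows "1 - (langevin x)\<^sup>2 - 2 * langevin x / x > 0"
proof -
  have s: "sinh x > 0" using assms by simp
  have "x < sinh x" by (rule less_sinh[OF assms])
  then have "x * x < sinh x * sinh x" using assms by (intro mult_strict_mono) auto
  moreover have "1 - (langevin x)\<^sup>2 - 2 * langevin x / x = 1 / (x * x) - 1 / (sinh x * sinh x)"
  proof -
    have "(cosh x)\<^sup>2 = 1 + (sinh x)\<^sup>2" using cosh_square_eq[of x] by simp
    then have "(coth x)\<^sup>2 = 1 + 1 / (sinh x * sinh x)"
      using s by (simp add: coth_def power_divide field_simps power2_eq_square)
    then show ?thesis using assms by (simp add: langevin_def power2_diff field_simps power2_eq_square)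
  qed
  ultimately show ?thesis using assms s by (simp add: frac_less2)
qed

lemma langevin_strict_mono: assumes "0 < x" "x < y" shows "langevin x < langevin y"
proof (rule DERIV_pos_imp_increasing[OF assms(2)])
  show "\<exists>d. (langevin has_real_derivative d) (at t) \<and> d > 0" if "x \<le> t" "t \<le> y" for t
    using langevin_deriv[of t] langevin_deriv_pos[of t] that assms by auto
qed

text \<open>A bound for the logarithmic derivative of \<open>1 - langevin x\<close>. By the Riccati equation the claim is
  \<open>x (1 - w) (1/2 + w) \<le> 2 w\<close> for \<open>w = langevin x\<close>. As \<open>(1 - w) (1/2 + w) / w\<close> decreases in \<open>w\<close>, it
  suffices to check it for a lower bound \<open>v\<close> of \<open>w\<close>: \<open>1 - 1/x\<close> for \<open>x \<ge> 2\<close> and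
  \<open>langevin_lower\<close> for \<open>x < 2\<close>.\<close>

lemma langevin_log_deriv_bound:
  assumes x: "x > 0"
  shows "1 - (langevin x)\<^sup>2 - 2 * langevin x / x \<le> (1 - langevin x) / 2"
proof -
  define w where "w = langevin x"
  have w: "0 < w" "w < 1" using langevin_pos langevin_less_1 x by (auto simp: w_def)
  \<comment> \<open>The monotonicity of \<open>(1 - w) (1/2 + w) / w\<close>, with the denominators cleared.\<close>
  have mono: "(1 - w) * (1 / 2 + w) * v \<le> (1 - v) * (1 / 2 + v) * w" if "0 < v" "v \<le> w" for v
  proof -
    have "(1 - v) * (1 / 2 + v) * w - (1 - w) * (1 / 2 + w) * v = (w - v) * (1 / 2 + v * w)"
      by (simp add: field_simps)
    also have "\<dots> \<ge> 0" using that w by (intro mult_nonneg_nonneg) auto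
    finally show ?thesis by simp
  qed
  have "x * ((1 - w) * (1 / 2 + w)) \<le> 2 * w"
  proof -
    obtain v where v: "0 < v" "v \<le> w" "x * ((1 - v) * (1 / 2 + v)) \<le> 2 * v"
    proof (cases "x \<ge> 2")
      case True
      show thesis
      proof (rule that[of "1 - 1 / x"])
        show "0 < 1 - 1 / x" "1 - 1 / x \<le> w"
          using True coth_gt_1[OF x] by (auto simp: w_def langevin_def)
        show "x * ((1 - (1 - 1 / x)) * (1 / 2 + (1 - 1 / x))) \<le> 2 * (1 - 1 / x)"
          using True by (simp add: field_simps)
      qed
    next
      case False
      show thesis
      proof (rule that[of "5 * x / (15 + x\<^sup>2)"])
        have p: "15 + x\<^sup>2 > 0" by (auto intro: add_pos_nonneg)
        show "0 < 5 * x / (15 + x\<^sup>2)" using x p by simp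
        show "5 * x / (15 + x\<^sup>2) \<le> w" using langevin_lower[OF x] by (simp add: w_def)
        \<comment> \<open>For \<open>x < 2\<close> the quartic below is majorised by a quadratic without real roots.\<close>
        have "x ^ 4 + 5 * x ^ 3 \<le> 14 * x\<^sup>2"
        proof -
          have "x * x \<le> 2 * 2" using False x by (intro mult_mono) auto
          then have "x * x + 5 * x \<le> 14" using False by linarith
          then have "x\<^sup>2 * (x * x + 5 * x) \<le> x\<^sup>2 * 14" by (intro mult_left_mono) auto
          then show ?thesis by (simp add: algebra_simps power2_eq_square power3_eq_cube power4_eq_xxxx)
        qed
        moreover have "0 < 26 * x\<^sup>2 - 75 * x + 75"
        proof -
          have "26 * x\<^sup>2 - 75 * x + 75 = 26 * (x - 75 / 52)\<^sup>2 + (75 - 5625 / 104)"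
            by (simp add: power2_eq_square algebra_simps)
          moreover have "0 \<le> (x - 75 / 52)\<^sup>2" by (rule zero_le_power2)
          ultimately show ?thesis by linarith
        qed
        ultimately have key: "x ^ 4 + 5 * x ^ 3 - 40 * x\<^sup>2 + 75 * x - 75 \<le> 0" by linarith
        have key': "(15 + x\<^sup>2 - 5 * x) * (15 + x\<^sup>2 + 10 * x) \<le> 20 * (15 + x\<^sup>2)"
          using key by (simp add: algebra_simps power2_eq_square power3_eq_cube power4_eq_xxxx)
        define r where "r = 15 + x\<^sup>2"
        have r: "r > 0" using p by (simp add: r_def)
        have "1 - 5 * x / r = (r - 5 * x) / r" "1 / 2 + 5 * x / r = (r + 10 * x) / (2 * r)"
          using r by (simp_all add: field_simps)
        then have "x * ((1 - 5 * x / r) * (1 / 2 + 5 * x / r)) = x / (2 * r * r) * ((r - 5 * x) * (r + 10 * x))"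
          by simp
        also have "\<dots> \<le> x / (2 * r * r) * (20 * r)"
          using key' r x unfolding r_def[symmetric] by (intro mult_left_mono) auto
        also have "\<dots> = 2 * (5 * x / r)" using r by simp
        finally show "x * ((1 - 5 * x / (15 + x\<^sup>2)) * (1 / 2 + 5 * x / (15 + x\<^sup>2))) \<le> 2 * (5 * x / (15 + x\<^sup>2))"
          unfolding r_def .
      qed
    qed
    have "(x * ((1 - w) * (1 / 2 + w))) * v \<le> x * ((1 - v) * (1 / 2 + v)) * w"
      using mult_left_mono[OF mono[OF v(1,2)], of x] x by (simp add: mult_ac)
    also have "\<dots> \<le> 2 * v * w" using v(3) w by (intro mult_right_mono) auto
    finally have "(x * ((1 - w) * (1 / 2 + w))) * v \<le> (2 * w) * v" by (simp add: mult_ac)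
    then show ?thesis using v(1) by simp
  qed
  then have "(1 - w) * (1 / 2 + w) \<le> 2 * w / x" using x by (simp add: field_simps)
  moreover have "(1 - w) * (1 / 2 + w) = 1 / 2 + w / 2 - w\<^sup>2"
    by (simp add: field_simps power2_eq_square)
  ultimately show ?thesis unfolding w_def[symmetric] by (simp add: diff_divide_distrib)
qed

section \<open>Monotonicity of the upper frame bound\<close>

text \<open>\<open>psi y = sech y tanh (y/2)\<close>, written without the half argument.\<close>

definition psi :: "real \<Rightarrow> real" where
  "psi y = sinh y / (cosh y * (1 + cosh y))"

lemma psi_pos: "y > 0 \<Longrightarrow> psi y > 0"
  unfolding psi_def by (intro divide_pos_pos mult_pos_pos add_pos_pos) auto

text \<open>The numerator of the derivative, \<open>1 + c - c\<^sup>2\<close> with \<open>c = cosh y\<close>, is where the golden ratio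
  comes from.\<close>

lemma psi_deriv:
  "(psi has_real_derivative (1 + cosh y - (cosh y)\<^sup>2) / ((cosh y)\<^sup>2 * (1 + cosh y))) (at y)"
proof -
  have p: "cosh y > 0" "1 + cosh y > 0" by (auto intro: add_pos_pos)
  then have nz: "cosh y \<noteq> 0" "1 + cosh y \<noteq> 0" by auto
  have s: "sinh y * sinh y = cosh y * cosh y - 1"
    using cosh_square_eq[of y] by (simp add: power2_eq_square)
  have d: "((\<lambda>y. cosh y * (1 + cosh y)) has_real_derivative sinh y * (1 + cosh y) + cosh y * sinh y) (at y)"
    by (auto intro!: derivative_eq_intros)
  have "(sinh has_real_derivative cosh y) (at y)"
    by (auto intro!: derivative_eq_intros)
  from DERIV_divide[OF this d] nz
  have "((\<lambda>y. sinh y / (cosh y * (1 + cosh y))) has_real_derivative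
     (cosh y * (cosh y * (1 + cosh y)) - sinh y * (sinh y * (1 + cosh y) + cosh y * sinh y))
       / ((cosh y * (1 + cosh y)) * (cosh y * (1 + cosh y)))) (at y)"
    by simp
  also have "(cosh y * (cosh y * (1 + cosh y)) - sinh y * (sinh y * (1 + cosh y) + cosh y * sinh y))
      = (1 + cosh y) * (1 + cosh y - (cosh y)\<^sup>2)"
  proof -
    have "sinh y * (sinh y * (1 + cosh y) + cosh y * sinh y) = (sinh y * sinh y) * (1 + 2 * cosh y)"
      by (simp add: algebra_simps)
    then show ?thesis unfolding s by (simp add: algebra_simps power2_eq_square)
  qed
  finally show ?thesis using nz by (simp add: psi_def[abs_def] power2_eq_square mult_ac)
qed

lemma psi_le_half: assumes "y > 0" shows "psi y \<le> y / 2"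
proof -
  have "sinh y * 2 \<le> (y * cosh y) * (1 + cosh y)"
    using sinh_less_times_cosh[OF assms] assms cosh_real_ge_1[of y] by (intro mult_mono) auto
  moreover have "cosh y * (1 + cosh y) > 0" by (intro mult_pos_pos add_pos_pos) auto
  ultimately show ?thesis by (simp add: psi_def divide_le_eq mult_ac)
qed

definition golden :: real where "golden = (1 + sqrt 5) / 2"

lemma golden_bounds: "golden\<^sup>2 = 1 + golden" "1.618 < golden" "golden < 1.8"
proof -
  show "golden\<^sup>2 = 1 + golden"
    by (simp add: golden_def power2_eq_square field_simps)
  have "2.236 < sqrt 5" by (rule real_less_rsqrt) (simp add: power2_eq_square)
  moreover have "sqrt 5 < 2.6" by (rule real_less_lsqrt) (auto simp: power2_eq_square)
  ultimately show "1.618 < golden" "golden < 1.8" by (auto simp: golden_def)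
qed

lemma golden_compare: assumes "c \<ge> 1" shows "1 + c - c\<^sup>2 > 0 \<longleftrightarrow> c < golden" "1 + c - c\<^sup>2 < 0 \<longleftrightarrow> c > golden"
proof -
  have eq: "1 + c - c\<^sup>2 = (golden - c) * (golden + c - 1)"
    using golden_bounds(1) by (simp add: algebra_simps power2_eq_square)
  have p: "golden + c - 1 > 0" using golden_bounds(2) assms by simp
  show "1 + c - c\<^sup>2 > 0 \<longleftrightarrow> c < golden" "1 + c - c\<^sup>2 < 0 \<longleftrightarrow> c > golden"
    unfolding eq using p by (simp_all add: zero_less_mult_iff mult_less_0_iff)
qed

definition y_golden :: real where "y_golden = arcosh golden"

lemma cosh_y_golden: "cosh y_golden = golden" "y_golden > 0"
  using golden_bounds by (auto simp: y_golden_def)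

lemma psi_strict_mono: assumes "0 < x" "x < y" "y \<le> y_golden" shows "psi x < psi y"
proof (rule DERIV_pos_imp_increasing_open[OF assms(2)])
  show "continuous_on {x..y} psi" using psi_deriv by (meson DERIV_isCont continuous_at_imp_continuous_on)
  show "\<exists>d. (psi has_real_derivative d) (at t) \<and> d > 0" if "x < t" "t < y" for t
  proof (intro exI conjI)
    have "cosh t < cosh y_golden" using that assms by (subst cosh_real_nonneg_less_iff) auto
    then show "(1 + cosh t - (cosh t)\<^sup>2) / ((cosh t)\<^sup>2 * (1 + cosh t)) > 0"
      using golden_compare(1)[OF cosh_real_ge_1[of t]]
      by (intro divide_pos_pos mult_pos_pos) (auto simp: cosh_y_golden intro: add_pos_pos)
  qed (rule psi_deriv)
qed

lemma psi_deriv_neg: assumes "t > y_golden" shows "(1 + cosh t - (cosh t)\<^sup>2) / ((cosh t)\<^sup>2 * (1 + cosh t)) < 0"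
proof -
  have "cosh t > cosh y_golden" using assms cosh_y_golden(2) by (subst cosh_real_nonneg_less_iff) auto
  then show ?thesis
    using golden_compare(2)[OF cosh_real_ge_1[of t]]
    by (intro divide_neg_pos mult_pos_pos) (auto simp: cosh_y_golden intro: add_pos_pos)
qed

lemma psi_strict_antimono: assumes "y_golden \<le> x" "x < y" shows "psi y < psi x"
proof (rule DERIV_neg_imp_decreasing_open[OF assms(2)])
  show "continuous_on {x..y} psi" using psi_deriv by (meson DERIV_isCont continuous_at_imp_continuous_on)
  show "\<exists>d. (psi has_real_derivative d) (at t) \<and> d < 0" if "x < t" "t < y" for t
    using psi_deriv psi_deriv_neg[of t] that assms by force
qed

lemma y_golden_lower: "1.05 < y_golden"
proof -
  define c s where "c = cosh (1.05 :: real)" and "s = sinh (1.05 :: real)"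
  \<comment> \<open>A rational upper bound for \<open>tanh 1.05\<close> gives one for \<open>cosh 1.05\<close>.\<close>
  have "(15 + 6 * 1.05\<^sup>2) * s < 1.05 * (15 + 1.05\<^sup>2) * c"
    unfolding c_def s_def by (rule cosh_sinh_pade_upper) simp
  then have "21.615 * s < 16.907625 * c" by (simp add: power2_eq_square)
  moreover have "s > 0" "c > 0" by (simp_all add: s_def c_def)
  ultimately have "(21.615 * s)\<^sup>2 < (16.907625 * c)\<^sup>2"
    by (intro power_strict_mono) auto
  moreover have "s\<^sup>2 = c\<^sup>2 - 1"
    using cosh_square_eq[of "1.05::real"] by (simp add: c_def s_def)
  ultimately have "c\<^sup>2 < 1.618\<^sup>2" by (simp add: power_mult_distrib power2_eq_square)
  then have "c < 1.618" by (rule power_less_imp_less_base) simp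
  then have "cosh 1.05 < cosh y_golden" using golden_bounds(2) by (simp add: c_def cosh_y_golden)
  then show ?thesis using cosh_y_golden(2) by (subst (asm) cosh_real_nonneg_less_iff) auto
qed

text \<open>The point that separates the two arguments on the right of the maximum of \<open>psi\<close>. It is chosen so
  that \<open>cosh\<close> and \<open>sinh\<close> are rational there, that \<open>psi\<close> is still close to its maximum, and that the
  logarithmic decay rate of \<open>psi\<close> already exceeds \<open>1/6\<close>.\<close>

definition y_cut :: real where "y_cut = ln (10 / 3)"

lemma y_cut: "cosh y_cut = 109 / 60" "sinh y_cut = 91 / 60" "psi y_cut = 5460 / 18421" "y_golden < y_cut"
proof -
  show c: "cosh y_cut = 109 / 60" and s: "sinh y_cut = 91 / 60"
    unfolding y_cut_def by (subst cosh_ln_real sinh_ln_real; simp)+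
  show "psi y_cut = 5460 / 18421" unfolding psi_def c s by simp
  have "cosh y_golden < cosh y_cut" using golden_bounds(3) unfolding c cosh_y_golden by simp
  moreover have "y_cut \<ge> 0" by (simp add: y_cut_def)
  ultimately show "y_golden < y_cut" using cosh_y_golden(2) by (subst (asm) cosh_real_nonneg_less_iff) auto
qed

text \<open>The decay rate \<open>tanh y - 1 / sinh y\<close> of \<open>psi\<close> increases with \<open>y\<close> and is larger than \<open>1/6\<close>
  at \<open>y_cut\<close>. The constant fits the slowest case \<open>n = 3\<close>, where \<open>n / 6\<close> equals the rate \<open>1/2\<close> of
  \<open>langevin_log_deriv_bound\<close>.\<close>

lemma psi_decay:
  assumes "y \<ge> y_cut"
  shows "(1 + cosh y - (cosh y)\<^sup>2) / ((cosh y)\<^sup>2 * (1 + cosh y)) < - psi y / 6"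
proof -
  have y: "y > 0" "y_cut > 0" using assms y_cut(4) cosh_y_golden(2) by auto
  have "sinh y_cut \<le> sinh y" using assms by simp
  then have s: "sinh y \<ge> 91 / 60" by (simp only: y_cut(2))
  have sq: "(cosh y)\<^sup>2 = (sinh y)\<^sup>2 + 1" by (rule cosh_square_eq)
  \<comment> \<open>The value of \<open>coth\<close> at \<open>y_cut\<close> is \<open>109 / 91\<close>.\<close>
  have c: "cosh y \<le> 109 / 91 * sinh y"
  proof (rule power2_le_imp_le)
    have "(91 / 60)\<^sup>2 \<le> (sinh y)\<^sup>2" using s by (intro power_mono) auto
    then show "(cosh y)\<^sup>2 \<le> (109 / 91 * sinh y)\<^sup>2" unfolding sq by (simp add: power_mult_distrib power2_eq_square)
    show "0 \<le> 109 / 91 * sinh y" using s by linarith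
  qed
  have "cosh y * (sinh y + 6) \<le> (109 / 91 * sinh y) * (sinh y + 6)"
    using c s by (intro mult_right_mono) auto
  also have "\<dots> = sinh y * (109 / 91 * (sinh y + 6))" by simp
  also have "\<dots> < sinh y * (6 * sinh y)"
  proof (rule mult_strict_left_mono)
    have "109 / 91 * (v + 6) < 6 * v" if "91 / 60 \<le> v" for v :: real
      using that by (simp add: field_simps)
    then show "109 / 91 * (sinh y + 6) < 6 * sinh y" using s by blast
    show "0 < sinh y" using s by linarith
  qed
  finally have key: "sinh y * cosh y < 6 * ((cosh y)\<^sup>2 - 1 - cosh y)"
    unfolding sq by (simp add: algebra_simps power2_eq_square)
  define den where "den = (cosh y)\<^sup>2 * (1 + cosh y)"
  have den: "den > 0" unfolding den_def by (intro mult_pos_pos add_pos_pos) auto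
  have "(1 + cosh y - (cosh y)\<^sup>2) / den < (- (sinh y * cosh y) / 6) / den"
    using key den by (intro divide_strict_right_mono) auto
  also have "\<dots> = - psi y / 6"
    by (simp add: psi_def den_def power2_eq_square)
  finally show ?thesis unfolding den_def .
qed

text \<open>The logarithmic derivative of \<open>upper_profile n\<close>.\<close>

definition upper_slope :: "nat \<Rightarrow> real \<Rightarrow> real" where
  "upper_slope n x = 1 - langevin x - real n * psi (real n * x)"

lemma coth_deriv: assumes "x > 0" shows "(coth has_real_derivative 1 - (coth x)\<^sup>2) (at x)"
proof -
  have s: "sinh x \<noteq> 0" using assms by simp
  have "((\<lambda>x. cosh x / sinh x) has_real_derivative (sinh x * sinh x - cosh x * cosh x) / (sinh x * sinh x)) (at x)"
    using s by (auto intro!: derivative_eq_intros)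
  moreover have "(sinh x * sinh x - cosh x * cosh x) / (sinh x * sinh x) = 1 - (coth x)\<^sup>2"
    using s by (simp add: coth_def diff_divide_distrib power2_eq_square)
  ultimately show ?thesis by (simp add: coth_def[abs_def])
qed

lemma sech_deriv: "((\<lambda>x. sech (k * x)) has_real_derivative - (k * sinh (k * x) / (cosh (k * x))\<^sup>2)) (at x)"
  unfolding sech_def by (auto intro!: derivative_eq_intros simp: power2_eq_square)

lemma upper_profile_deriv:
  assumes x: "x > 0"
  shows "(upper_profile n has_real_derivative upper_profile n x * upper_slope n x) (at x)"
proof -
  define s c where "s = sinh (real n * x)" and "c = cosh (real n * x)"
  have c: "c > 0" "1 + c > 0" unfolding c_def by (auto intro: add_pos_pos)
  have z: "- (real n * s / c\<^sup>2) = (1 + sech (real n * x)) * (- (real n * psi (real n * x)))"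
  proof -
    have "1 + 1 / c = (1 + c) / c" using c by (simp add: field_simps)
    then show ?thesis
      using c unfolding sech_def psi_def s_def[symmetric] c_def[symmetric] by (simp add: power2_eq_square)
  qed
  have "((\<lambda>x. real n * x * (1 + coth x)) has_real_derivative
      real n * (1 + coth x) + real n * x * (1 - (coth x)\<^sup>2)) (at x)"
    using coth_deriv[OF x] by (auto intro!: derivative_eq_intros simp: mult_ac)
  moreover have "((\<lambda>x. 1 + sech (real n * x)) has_real_derivative - (real n * s / c\<^sup>2)) (at x)"
    using sech_deriv[of "real n" x] unfolding s_def c_def by (auto intro!: derivative_eq_intros)
  ultimately have "((\<lambda>x. real n * x * (1 + coth x) * (1 + sech (real n * x))) has_real_derivative
      (real n * (1 + coth x) + real n * x * (1 - (coth x)\<^sup>2)) * (1 + sech (real n * x))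
        + - (real n * s / c\<^sup>2) * (real n * x * (1 + coth x))) (at x)"
    by (rule DERIV_mult)
  also have "(real n * (1 + coth x) + real n * x * (1 - (coth x)\<^sup>2)) * (1 + sech (real n * x))
        + - (real n * s / c\<^sup>2) * (real n * x * (1 + coth x)) = upper_profile n x * upper_slope n x"
    unfolding z upper_profile_def upper_slope_def langevin_def using x
    by (simp add: field_simps power2_eq_square)
  finally show ?thesis by (simp add: upper_profile_def[abs_def])
qed

lemma times_coth_gt_1: assumes "x > 0" shows "x * coth x > 1"
  using langevin_pos[OF assms] assms by (simp add: langevin_def field_simps)

lemma sech_pos: "sech x > 0"
  by (simp add: sech_def)

lemma upper_profile_lower_bound:
  assumes x: "x > 0" and n: "n \<ge> 1"
  shows "real n * (1 + x) * (1 + sech (real n * x)) < upper_profile n x"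
proof -
  have "1 + x < x * (1 + coth x)" using times_coth_gt_1[OF x] by (simp add: algebra_simps)
  then have "real n * (1 + x) < real n * (x * (1 + coth x))"
    using n by (intro mult_strict_left_mono) auto
  then have "real n * (1 + x) * (1 + sech (real n * x)) < real n * (x * (1 + coth x)) * (1 + sech (real n * x))"
    using sech_pos[of "real n * x"] by (intro mult_strict_right_mono) auto
  then show ?thesis by (simp add: upper_profile_def mult.assoc)
qed

lemma upper_profile_gt_n:
  assumes x: "x > 0" and n: "n \<ge> 1" shows "real n < upper_profile n x"
proof -
  have "real n * 1 \<le> real n * ((1 + x) * (1 + sech (real n * x)))"
    using x sech_pos[of "real n * x"] by (intro mult_left_mono) (auto simp: algebra_simps)
  then show ?thesis using upper_profile_lower_bound[OF assms] by (simp add: mult.assoc)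
qed

text \<open>For \<open>n = 1\<close> the limit at \<open>0\<close> is \<open>2\<close>, so this case needs the estimate
  \<open>cosh x \<le> exp x \<le> 1 / (1 - x)\<close>; for larger \<open>n\<close> the value exceeds \<open>n\<close>.\<close>

lemma upper_profile_gt_2:
  assumes x: "x > 0" and n: "n \<ge> 1" shows "2 < upper_profile n x"
proof (cases "n = 1")
  case True
  have "1 - x \<le> (1 + x) * sech x"
  proof (cases "x < 1")
    case x1: True
    have "(1 - x) * cosh x \<le> (1 - x) * exp x"
      using x x1 by (intro mult_left_mono) (auto simp: cosh_def)
    also have "\<dots> \<le> exp (- x) * exp x"
      using exp_ge_add_one_self[of "- x"] by (intro mult_right_mono) auto
    also have "\<dots> \<le> 1 + x" using x by (simp add: exp_add[symmetric])
    finally show ?thesis by (simp add: sech_def field_simps)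
  next
    case False
    have "0 \<le> (1 + x) * sech x" using x sech_pos[of x] by simp
    then show ?thesis using False by simp
  qed
  then have "2 \<le> (1 + x) * (1 + sech x)" by (simp add: algebra_simps)
  then show ?thesis using upper_profile_lower_bound[OF assms] True by simp
next
  case False
  then have "2 \<le> real n" using n by simp
  then show ?thesis using upper_profile_gt_n[OF assms] by simp
qed

lemma upper_profile_pos: "x > 0 \<Longrightarrow> n \<ge> 1 \<Longrightarrow> upper_profile n x > 0"
  using upper_profile_gt_2[of x n] by simp

lemma upper_profile_increasing:
  assumes "0 < u" "u < v" "n \<ge> 1" "\<And>t. u < t \<Longrightarrow> t < v \<Longrightarrow> upper_slope n t > 0"
  shows "upper_profile n u < upper_profile n v"
proof (rule DERIV_pos_imp_increasing_open[OF assms(2)])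
  show "\<exists>y. (upper_profile n has_real_derivative y) (at t) \<and> y > 0" if "u < t" "t < v" for t
    using upper_profile_deriv[of t n] upper_profile_pos[of t n] assms that
    by (intro exI[of _ "upper_profile n t * upper_slope n t"]) auto
  show "continuous_on {u..v} (upper_profile n)"
    using assms(1) by (intro continuous_at_imp_continuous_on ballI DERIV_isCont[OF upper_profile_deriv]) auto
qed

lemma upper_profile_decreasing:
  assumes "0 < u" "u < v" "n \<ge> 1" "\<And>t. u < t \<Longrightarrow> t < v \<Longrightarrow> upper_slope n t < 0"
  shows "upper_profile n v < upper_profile n u"
proof (rule DERIV_neg_imp_decreasing_open[OF assms(2)])
  show "\<exists>y. (upper_profile n has_real_derivative y) (at t) \<and> y < 0" if "u < t" "t < v" for t
    using upper_profile_deriv[of t n] upper_profile_pos[of t n] assms that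
    by (intro exI[of _ "upper_profile n t * upper_slope n t"]) (auto simp: mult_pos_neg)
  show "continuous_on {u..v} (upper_profile n)"
    using assms(1) by (intro continuous_at_imp_continuous_on ballI DERIV_isCont[OF upper_profile_deriv]) auto
qed

lemma upper_slope_continuous: assumes "S \<subseteq> {0<..}" shows "continuous_on S (upper_slope n)"
proof -
  have "continuous_on S langevin"
    using assms by (intro continuous_at_imp_continuous_on ballI DERIV_isCont[OF langevin_deriv]) auto
  moreover have "continuous_on UNIV psi"
    using psi_deriv by (meson DERIV_isCont continuous_at_imp_continuous_on)
  then have "continuous_on S (\<lambda>x. psi (real n * x))"
    by (rule continuous_on_compose2) (auto intro!: continuous_intros)
  ultimately show ?thesis unfolding upper_slope_def[abs_def] by (intro continuous_intros)
qed

lemma upper_slope_eventually_pos: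
  assumes n: "n \<ge> 1" shows "\<forall>\<^sub>F x in at_top. upper_slope n x > 0"
proof -
  \<comment> \<open>The two terms of the slope decay like \<open>1 / x\<close> and exponentially.\<close>
  have 1: "((\<lambda>x. x * (1 - langevin x)) \<longlongrightarrow> 1) at_top"
    unfolding langevin_def coth_def cosh_field_def sinh_field_def by real_asymp
  have "((\<lambda>y. y * psi y) \<longlongrightarrow> 0) at_top"
    unfolding psi_def cosh_field_def sinh_field_def by real_asymp
  moreover have "filterlim (\<lambda>x. real n * x) at_top at_top"
    using n by (intro filterlim_tendsto_pos_mult_at_top[OF tendsto_const]) (auto simp: filterlim_ident)
  ultimately have 2: "((\<lambda>x. (real n * x) * psi (real n * x)) \<longlongrightarrow> 0) at_top"
    by (rule filterlim_compose)
  have "((\<lambda>x. x * (1 - langevin x) - (real n * x) * psi (real n * x)) \<longlongrightarrow> 1 - 0) at_top"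
    by (intro tendsto_diff 1 2)
  then have "\<forall>\<^sub>F x in at_top. x * (1 - langevin x) - (real n * x) * psi (real n * x) > 0"
    by (rule order_tendstoD) simp
  then show ?thesis using eventually_gt_at_top[of 0]
  proof eventually_elim
    case (elim x)
    then have "x * upper_slope n x > 0" by (simp add: upper_slope_def algebra_simps)
    with elim show ?case by (simp add: zero_less_mult_iff)
  qed
qed

lemma upper_slope_pos_near_0:
  assumes n: "n \<ge> 1" and x: "0 < x" "x \<le> 1 / (real n)\<^sup>2" shows "upper_slope n x > 0"
proof -
  have "(1 / real n)\<^sup>2 \<le> 1" using n by (intro power_le_one) auto
  then have "1 / (real n)\<^sup>2 \<le> 1" by (simp add: power_one_over)
  then have "x / 3 \<le> 1 / 3" using x by simp
  moreover have "real n * psi (real n * x) \<le> real n * (real n * x / 2)"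
    using n x by (intro mult_left_mono psi_le_half) auto
  moreover have "real n * (real n * x / 2) \<le> 1 / 2"
    using x n by (simp add: field_simps power2_eq_square)
  ultimately show ?thesis using langevin_upper[OF x(1)] by (simp add: upper_slope_def)
qed

lemma upper_slope_strict_antimono:
  assumes n: "n \<ge> 1" and "0 < x" "x < y" "y \<le> y_golden / real n"
  shows "upper_slope n y < upper_slope n x"
proof -
  have "psi (real n * x) < psi (real n * y)"
    using assms by (intro psi_strict_mono) (auto simp: field_simps)
  then have "real n * psi (real n * x) < real n * psi (real n * y)" using n by simp
  then show ?thesis using langevin_strict_mono[OF assms(2,3)] by (simp add: upper_slope_def)
qed

text \<open>Here \<open>psi (n x)\<close> is at least \<open>psi y_cut \<approx> 0.2964\<close>. For \<open>n \<ge> 4\<close> this makes \<open>n psi (n x)\<close> larger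
  than \<open>1\<close>. The case \<open>n = 3\<close> is tight: \<open>3 \<cdot> 0.2964 \<approx> 0.889\<close> has to be compared with
  \<open>1 - langevin 0.35 < 0.885\<close>.\<close>

lemma upper_slope_neg_middle:
  assumes n: "n \<ge> 3" and x: "y_golden / real n \<le> x" "x \<le> y_cut / real n"
  shows "upper_slope n x < 0"
proof -
  have x': "y_golden \<le> real n * x" "real n * x \<le> y_cut" using n x by (auto simp: field_simps)
  have x0: "x > 0" using cosh_y_golden(2) n by (intro less_le_trans[OF _ x(1)]) simp
  have "psi y_cut \<le> psi (real n * x)"
    using x' psi_strict_antimono[of "real n * x" y_cut] by (cases "real n * x = y_cut") auto
  then have psi: "real n * (5460 / 18421) \<le> real n * psi (real n * x)"
    unfolding y_cut(3) by (intro mult_left_mono) auto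
  show ?thesis
  proof (cases "n = 3")
    case True
    then have "0.35 < x" using x(1) y_golden_lower by simp
    then have "langevin 0.35 < langevin x" by (intro langevin_strict_mono) auto
    moreover have "5 * 0.35 / (15 + 0.35\<^sup>2) < langevin 0.35" by (rule langevin_lower) simp
    ultimately have "5 * 0.35 / (15 + 0.35\<^sup>2) < langevin x" by linarith
    then show ?thesis using psi True by (simp add: upper_slope_def power2_eq_square)
  next
    case False
    then have "4 \<le> real n" using n by simp
    then show ?thesis using psi langevin_pos[OF x0] unfolding upper_slope_def by linarith
  qed
qed

text \<open>On the right of the maximum of \<open>psi\<close> both terms of \<open>upper_slope\<close> decrease, so their difference need not
  be monotone; their quotient is, from \<open>y_cut\<close> on.\<close>

definition slope_ratio :: "nat \<Rightarrow> real \<Rightarrow> real" where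
  "slope_ratio n x = real n * psi (real n * x) / (1 - langevin x)"

lemma upper_slope_sign:
  assumes "x > 0"
  shows "upper_slope n x > 0 \<longleftrightarrow> slope_ratio n x < 1" "upper_slope n x < 0 \<longleftrightarrow> slope_ratio n x > 1"
  using langevin_less_1[OF assms] by (auto simp: upper_slope_def slope_ratio_def field_simps)

text \<open>The numerator decays at a rate above \<open>n / 6 \<ge> 1 / 2\<close>, the denominator at a rate of at most
  \<open>1 / 2\<close>.\<close>

lemma slope_ratio_strict_antimono:
  assumes n: "n \<ge> 3" and x: "y_cut / real n \<le> x" "x < y"
  shows "slope_ratio n y < slope_ratio n x"
proof (rule DERIV_neg_imp_decreasing[OF x(2)])
  fix t assume t: "x \<le> t" "t \<le> y"
  have y1: "y_cut > 0" using y_cut(4) cosh_y_golden(2) by simp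
  have nt: "y_cut \<le> real n * t"
  proof -
    have "y_cut \<le> real n * x" using x n by (simp add: field_simps)
    also have "\<dots> \<le> real n * t" using t by (intro mult_left_mono) auto
    finally show ?thesis .
  qed
  have t0: "t > 0"
  proof -
    have "0 < real n * t" using nt y1 by linarith
    then show ?thesis using n by (simp add: zero_less_mult_iff)
  qed
  define p p' w w' where "p = psi (real n * t)"
    and "p' = (1 + cosh (real n * t) - (cosh (real n * t))\<^sup>2) / ((cosh (real n * t))\<^sup>2 * (1 + cosh (real n * t)))"
    and "w = langevin t" and "w' = 1 - (langevin t)\<^sup>2 - 2 * langevin t / t"
  have w: "1 - w > 0" using langevin_less_1[OF t0] by (simp add: w_def)
  have p: "p > 0" unfolding p_def using nt y1 by (intro psi_pos) simp
  have dp: "((\<lambda>t. psi (real n * t)) has_real_derivative p' * real n) (at t)"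
    unfolding p'_def by (rule DERIV_chain2[OF psi_deriv]) (auto intro!: derivative_eq_intros)
  have dw: "(langevin has_real_derivative w') (at t)"
    unfolding w'_def by (rule langevin_deriv[OF t0])
  have "(slope_ratio n has_real_derivative
      (real n * (p' * real n) * (1 - w) - real n * p * (- w')) / ((1 - w) * (1 - w))) (at t)"
    unfolding slope_ratio_def[abs_def] using dp dw w unfolding p_def w_def
    by (auto intro!: derivative_eq_intros)
  moreover have "(real n * (p' * real n) * (1 - w) - real n * p * (- w')) / ((1 - w) * (1 - w)) < 0"
  proof (rule divide_neg_pos)
    have "p' < - p / 6" using psi_decay[OF nt] by (simp add: p_def p'_def)
    then have "(p' * real n) * (1 - w) < (- p / 6 * real n) * (1 - w)"
      using w n by (intro mult_strict_right_mono) auto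
    also have "\<dots> \<le> (- p / 2) * (1 - w)"
      using w n p by (intro mult_right_mono) auto
    also have "\<dots> \<le> - p * w'"
    proof -
      have "w' \<le> (1 - w) / 2" using langevin_log_deriv_bound[OF t0] by (simp add: w_def w'_def)
      then have "p * w' \<le> p * ((1 - w) / 2)" using p by (intro mult_left_mono) auto
      then show ?thesis by simp
    qed
    finally have "(p' * real n) * (1 - w) + p * w' < 0" by simp
    then have "real n * ((p' * real n) * (1 - w) + p * w') < 0" using n by (intro mult_pos_neg) auto
    then show "real n * (p' * real n) * (1 - w) - real n * p * (- w') < 0" by (simp add: algebra_simps)
  qed (use w in simp)
  ultimately show "\<exists>d. (slope_ratio n has_real_derivative d) (at t) \<and> d < 0" by blast
qed

text \<open>The slope is strictly decreasing up to the maximum of \<open>psi\<close>, negative from there to the point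
  where \<open>n x = y_cut\<close>, and beyond that point its sign is governed by the decreasing \<open>slope_ratio\<close>.\<close>

lemma upper_slope_sign_changes:
  assumes n: "n \<ge> 3"
  obtains p r where "0 < p" "p < y_golden / real n" "y_golden / real n < r"
    "\<And>x. 0 < x \<Longrightarrow> x < p \<Longrightarrow> upper_slope n x > 0"
    "\<And>x. p < x \<Longrightarrow> x < r \<Longrightarrow> upper_slope n x < 0"
    "\<And>x. r < x \<Longrightarrow> upper_slope n x > 0"
proof -
  have n1: "n \<ge> 1" and n0: "real n > 0" using n by auto
  let ?g = "y_golden / real n" and ?o = "y_cut / real n"
  have go: "?g < ?o" using y_cut(4) n0 by (simp add: divide_strict_right_mono)
  have g0: "0 < ?g" using cosh_y_golden(2) n0 by simp
  \<comment> \<open>\<open>1 / n\<^sup>2\<close> is a point left of the maximum at which the slope is still positive.\<close>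
  have sq: "0 < 1 / (real n)\<^sup>2" "1 / (real n)\<^sup>2 < ?g"
  proof -
    show "0 < 1 / (real n)\<^sup>2" using n0 by simp
    have "1 < real n * y_golden"
      using y_golden_lower n mult_strict_mono[of 1 "real n" 1 y_golden] by simp
    then show "1 / (real n)\<^sup>2 < ?g" using n0 by (simp add: field_simps power2_eq_square)
  qed
  have neg_g: "upper_slope n ?g < 0" and neg_o: "upper_slope n ?o < 0"
    using upper_slope_neg_middle[OF n] go by auto
  have "\<exists>p\<ge>1 / (real n)\<^sup>2. p \<le> ?g \<and> upper_slope n p = 0"
  proof (rule IVT2')
    show "continuous_on {1 / (real n)\<^sup>2..?g} (upper_slope n)"
      by (intro upper_slope_continuous) (auto intro: less_le_trans[OF sq(1)])
  qed (use sq neg_g upper_slope_pos_near_0[OF n1 sq(1)] in auto)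
  then obtain p where p: "1 / (real n)\<^sup>2 \<le> p" "p \<le> ?g" "upper_slope n p = 0" by blast
  have "p \<noteq> ?g" using p(3) neg_g by auto
  then have p': "0 < p" "p < ?g" using less_le_trans[OF sq(1) p(1)] p(2) by simp_all
  obtain X where X: "X > ?o" "upper_slope n X > 0"
  proof -
    have "\<forall>\<^sub>F x in at_top. x > ?o \<and> upper_slope n x > 0"
      using eventually_gt_at_top upper_slope_eventually_pos[OF n1] by (rule eventually_conj)
    then show thesis using that eventually_happens[of _ "at_top :: real filter"] by auto
  qed
  have "\<exists>r\<ge>?o. r \<le> X \<and> upper_slope n r = 0"
  proof (rule IVT')
    show "continuous_on {?o..X} (upper_slope n)"
      using go g0 by (intro upper_slope_continuous) (auto intro: less_le_trans[OF less_trans[OF g0 go]])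
  qed (use neg_o X in auto)
  then obtain r where r: "?o \<le> r" "upper_slope n r = 0" by blast
  have r0: "r > 0" using r(1) go g0 by linarith
  have ratio_r: "slope_ratio n r = 1"
    using upper_slope_sign[OF r0, of n] r(2) by linarith
  show thesis
  proof (rule that[of p r])
    show "?g < r" using go r(1) by linarith
    show "upper_slope n x > 0" if "0 < x" "x < p" for x
      using upper_slope_strict_antimono[OF n1 that] p by simp
    show "upper_slope n x > 0" if "r < x" for x
      using slope_ratio_strict_antimono[OF n r(1) that] ratio_r upper_slope_sign(1)[of x n] r0 that by simp
    show "upper_slope n x < 0" if x: "p < x" "x < r" for x
    proof -
      consider "x \<le> ?g" | "?g \<le> x" "x \<le> ?o" | "?o \<le> x" by linarith
      then show ?thesis
      proof cases
        case 1
        then show ?thesis using upper_slope_strict_antimono[OF n1 p'(1) x(1)] p(3) by simp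
      next
        case 2
        then show ?thesis by (rule upper_slope_neg_middle[OF n])
      next
        case 3
        then show ?thesis
          using slope_ratio_strict_antimono[OF n 3 x(2)] ratio_r upper_slope_sign(2)[of x n] p'(1) x(1) by simp
      qed
    qed
  qed (use p' in auto)
qed

lemma less_by_deriv_at_1:
  fixes f g f' g' :: "real \<Rightarrow> real"
  assumes "f 1 = g 1" "\<And>E. E \<ge> 1 \<Longrightarrow> (f has_real_derivative f' E) (at E)"
    "\<And>E. E \<ge> 1 \<Longrightarrow> (g has_real_derivative g' E) (at E)" "\<And>E. E > 1 \<Longrightarrow> f' E < g' E" "E > 1"
  shows "f E < g E"
proof -
  have "g 1 - f 1 < g E - f E"
  proof (rule DERIV_pos_imp_increasing_open[OF assms(5)])
    have d: "((\<lambda>E. g E - f E) has_real_derivative g' t - f' t) (at t)" if "t \<ge> 1" for t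
      using assms(2,3) that by (intro DERIV_diff) auto
    show "\<exists>y. ((\<lambda>E. g E - f E) has_real_derivative y) (at t) \<and> y > 0" if "1 < t" "t < E" for t
      using d[of t] assms(4)[of t] that by (intro exI[of _ "g' t - f' t"]) auto
    show "continuous_on {1..E} (\<lambda>E. g E - f E)"
      by (intro continuous_at_imp_continuous_on ballI DERIV_isCont[OF d]) auto
  qed
  then show ?thesis using assms(1) by simp
qed

text \<open>Both sides vanish at \<open>E = 1\<close>; the hypothesis \<open>key\<close> compares their derivatives.\<close>

lemma ln_rational_bound:
  fixes d :: "real \<Rightarrow> real"
  assumes d: "\<And>E. E \<ge> 1 \<Longrightarrow> d E > 0" "\<And>E. E \<ge> 1 \<Longrightarrow> (d has_real_derivative d' E) (at E)"
    and key: "\<And>E. E > 1 \<Longrightarrow> (d E)\<^sup>2 < E * (4 * E ^ 3 * d E - (E ^ 4 - 1) * d' E)"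
    and E: "E > 1"
  shows "ln E < (E ^ 4 - 1) / d E"
proof (rule less_by_deriv_at_1[where f' = "\<lambda>E. 1 / E" and g' = "\<lambda>E. (4 * E ^ 3 * d E - (E ^ 4 - 1) * d' E) / (d E * d E)", OF _ _ _ _ E])
  show "((\<lambda>E. (E ^ 4 - 1) / d E) has_real_derivative (4 * t ^ 3 * d t - (t ^ 4 - 1) * d' t) / (d t * d t)) (at t)" if "t \<ge> 1" for t
  proof (rule DERIV_divide[OF _ d(2)[OF that]])
    show "((\<lambda>E. E ^ 4 - 1) has_real_derivative 4 * t ^ 3) (at t)"
      by (auto intro!: derivative_eq_intros)
    show "d t \<noteq> 0" using d(1)[OF that] by simp
  qed
  show "1 / t < (4 * t ^ 3 * d t - (t ^ 4 - 1) * d' t) / (d t * d t)" if "t > 1" for t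
    using key[OF that] d(1)[of t] that by (simp add: field_simps power2_eq_square)
qed (auto intro!: derivative_eq_intros)

text \<open>With \<open>E = exp x\<close> this is the positivity of \<open>upper_slope 1 x\<close>.\<close>

lemma ln_bound_1:
  assumes E: "(E::real) > 1"
  shows "ln E < (E ^ 4 - 1) / (2 * (E ^ 3 - E\<^sup>2 + E + 1))"
proof (rule ln_rational_bound[where d' = "\<lambda>E. 2 * (3 * E\<^sup>2 - 2 * E + 1)", OF _ _ _ E])
  fix t :: real
  { assume t: "t \<ge> 1"
    have "t ^ 3 - t\<^sup>2 = t\<^sup>2 * (t - 1)" by (simp add: algebra_simps power2_eq_square power3_eq_cube)
    also have "\<dots> \<ge> 0" using t by simp
    finally show "2 * (t ^ 3 - t\<^sup>2 + t + 1) > 0" using t by simp }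
  show "((\<lambda>E. 2 * (E ^ 3 - E\<^sup>2 + E + 1)) has_real_derivative 2 * (3 * t\<^sup>2 - 2 * t + 1)) (at t)"
    by (auto intro!: derivative_eq_intros)
  { assume t: "t > 1"
    define s where "s = t - 1"
    have s: "s > 0" "t = 1 + s" using t by (auto simp: s_def)
    \<comment> \<open>The difference has a zero at \<open>t = 1\<close>; expanded in \<open>s = t - 1\<close> all its coefficients are nonnegative.\<close>
    have "t * (4 * t ^ 3 * (2 * (t ^ 3 - t\<^sup>2 + t + 1)) - (t ^ 4 - 1) * (2 * (3 * t\<^sup>2 - 2 * t + 1)))
      - (2 * (t ^ 3 - t\<^sup>2 + t + 1))\<^sup>2 = 32 * s + 56 * s ^ 2 + 40 * s ^ 3 + 16 * s ^ 4 + 8 * s ^ 5 + 6 * s ^ 6 + 2 * s ^ 7"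
      unfolding s(2) by (simp add: power2_eq_square power3_eq_cube power4_eq_xxxx eval_nat_numeral algebra_simps)
    also have "\<dots> > 0" using s(1) by (intro add_pos_pos mult_pos_pos) auto
    finally show "(2 * (t ^ 3 - t\<^sup>2 + t + 1))\<^sup>2 <
      t * (4 * t ^ 3 * (2 * (t ^ 3 - t\<^sup>2 + t + 1)) - (t ^ 4 - 1) * (2 * (3 * t\<^sup>2 - 2 * t + 1)))" by simp }
qed

text \<open>With \<open>E = exp (2 x)\<close> this is the positivity of \<open>upper_slope 2 x\<close>.\<close>

lemma ln_bound_2:
  assumes E: "(E::real) > 1"
  shows "ln E < (E ^ 4 - 1) / (3 * E ^ 3 - 3 * E\<^sup>2 + 3 * E + 1)"
proof (rule ln_rational_bound[where d' = "\<lambda>E. 9 * E\<^sup>2 - 6 * E + 3", OF _ _ _ E])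
  fix t :: real
  { assume t: "t \<ge> 1"
    have "t ^ 3 - t\<^sup>2 = t\<^sup>2 * (t - 1)" by (simp add: algebra_simps power2_eq_square power3_eq_cube)
    also have "\<dots> \<ge> 0" using t by simp
    finally show "3 * t ^ 3 - 3 * t\<^sup>2 + 3 * t + 1 > 0" using t by simp }
  show "((\<lambda>E. 3 * E ^ 3 - 3 * E\<^sup>2 + 3 * E + 1) has_real_derivative 9 * t\<^sup>2 - 6 * t + 3) (at t)"
    by (auto intro!: derivative_eq_intros)
  { assume t: "t > 1"
    define s where "s = t - 1"
    have s: "s > 0" "t = 1 + s" using t by (auto simp: s_def)
    \<comment> \<open>Expanded in \<open>s = t - 1\<close>; the only negative term \<open>- 8 s\<^sup>4\<close> is absorbed in a square.\<close>
    have "t * (4 * t ^ 3 * (3 * t ^ 3 - 3 * t\<^sup>2 + 3 * t + 1) - (t ^ 4 - 1) * (9 * t\<^sup>2 - 6 * t + 3))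
      - (3 * t ^ 3 - 3 * t\<^sup>2 + 3 * t + 1)\<^sup>2 = 16 * s + 4 * s ^ 3 + 3 * s ^ 7 + s ^ 2 * (6 * (s\<^sup>2 - 2 / 3)\<^sup>2 + 64 / 3)"
      unfolding s(2) by (simp add: power2_eq_square power3_eq_cube power4_eq_xxxx eval_nat_numeral algebra_simps)
    also have "\<dots> > 0" using s(1) by (intro add_pos_pos mult_pos_pos add_nonneg_pos) auto
    finally show "(3 * t ^ 3 - 3 * t\<^sup>2 + 3 * t + 1)\<^sup>2 <
      t * (4 * t ^ 3 * (3 * t ^ 3 - 3 * t\<^sup>2 + 3 * t + 1) - (t ^ 4 - 1) * (9 * t\<^sup>2 - 6 * t + 3))" by simp }
qed

lemma coth_minus_1_exp: "x \<noteq> 0 \<Longrightarrow> coth x - 1 = 2 / ((exp x)\<^sup>2 - 1)"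
proof -
  assume "x \<noteq> 0"
  moreover have "exp x \<noteq> - 1" using exp_gt_zero[of x] by linarith
  ultimately have nz: "(exp x)\<^sup>2 - 1 \<noteq> 0" by (simp add: power2_eq_1_iff)
  have "coth x = ((exp x)\<^sup>2 + 1) / ((exp x)\<^sup>2 - 1)"
    unfolding coth_def cosh_field_def sinh_field_def exp_minus using nz
    by (simp add: field_simps power2_eq_square)
  then show ?thesis using nz by (simp add: field_simps)
qed

lemma psi_exp: "psi y = 2 * exp y * (exp y - 1) / (((exp y)\<^sup>2 + 1) * (exp y + 1))"
proof -
  define E where "E = exp y"
  have E: "E > 0" "E\<^sup>2 + 1 > 0" "E + 1 > 0" by (auto simp: E_def intro: add_pos_pos)
  have c: "cosh y = (E\<^sup>2 + 1) / (2 * E)" "1 + cosh y = (E + 1)\<^sup>2 / (2 * E)" "sinh y = (E - 1) * (E + 1) / (2 * E)"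
    unfolding cosh_field_def sinh_field_def exp_minus E_def[symmetric] using E(1)
    by (simp_all add: field_simps power2_eq_square)
  show ?thesis
    unfolding psi_def c(2) unfolding c(1,3) E_def[symmetric] using E by (simp add: power2_eq_square)
qed

text \<open>Written in \<open>E = exp (n x)\<close>, everything in the slope except \<open>1 / x\<close> is a rational function of \<open>E\<close>
  with denominator \<open>E\<^sup>4 - 1\<close>.\<close>

lemma upper_slope_pos_1_2:
  assumes n: "n \<in> {1, 2}" and x: "x > 0"
  shows "upper_slope n x > 0"
proof -
  define E where "E = exp (real n * x)"
  have E: "E > 1" using n x by (auto simp: E_def)
  have E4: "E ^ 4 - 1 = (E - 1) * (E + 1) * (E\<^sup>2 + 1)"
    by (simp add: algebra_simps power2_eq_square power4_eq_xxxx)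
  have pos: "E - 1 > 0" "E + 1 > 0" "E\<^sup>2 + 1 > 0" using E by (auto intro: add_pos_pos)
  have p4: "E ^ 4 - 1 > 0" unfolding E4 using pos by simp
  have lnE: "ln E = real n * x" by (simp add: E_def)
  have slope: "upper_slope n x = 1 / x - (coth x - 1) - real n * psi (real n * x)"
    by (simp add: upper_slope_def langevin_def)
  show ?thesis
  proof (cases "n = 1")
    case True
    have "coth x - 1 = 2 / (E\<^sup>2 - 1)" using x True by (simp add: coth_minus_1_exp E_def)
    also have "\<dots> = 2 * (E\<^sup>2 + 1) / (E ^ 4 - 1)"
    proof -
      have "E ^ 4 - 1 = (E\<^sup>2 - 1) * (E\<^sup>2 + 1)" unfolding E4 by (simp add: algebra_simps power2_eq_square)
      then show ?thesis using pos(3) by (metis mult_divide_mult_cancel_right less_irrefl)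
    qed
    finally have 1: "coth x - 1 = 2 * (E\<^sup>2 + 1) / (E ^ 4 - 1)" .
    have 2: "psi (real n * x) = 2 * E * (E - 1)\<^sup>2 / (E ^ 4 - 1)"
      unfolding psi_exp E_def[symmetric] E4 using pos by (simp add: power2_eq_square mult_ac)
    have d: "2 * (E ^ 3 - E\<^sup>2 + E + 1) = 2 * (E\<^sup>2 + 1) + 2 * E * (E - 1)\<^sup>2"
      by (simp add: algebra_simps power2_eq_square power3_eq_cube)
    have dpos: "2 * (E\<^sup>2 + 1) + 2 * E * (E - 1)\<^sup>2 > 0"
      using pos E by (intro add_pos_nonneg) auto
    have "x < (E ^ 4 - 1) / (2 * (E\<^sup>2 + 1) + 2 * E * (E - 1)\<^sup>2)"
      using ln_bound_1[OF E] lnE True unfolding d by simp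
    then have "(2 * (E\<^sup>2 + 1) + 2 * E * (E - 1)\<^sup>2) / (E ^ 4 - 1) < 1 / x"
      using p4 x dpos by (simp only: pos_less_divide_eq pos_divide_less_eq) (simp add: mult.commute pos_divide_less_eq)
    then show ?thesis unfolding slope 1 2 using True by (simp add: add_divide_distrib)
  next
    case False
    then have n2: "n = 2" using n by simp
    have "coth x - 1 = 2 / (E - 1)" using x n2 by (simp add: coth_minus_1_exp E_def exp_double)
    also have "\<dots> = 2 * ((E + 1) * (E\<^sup>2 + 1)) / (E ^ 4 - 1)"
    proof -
      have "E ^ 4 - 1 = (E - 1) * ((E + 1) * (E\<^sup>2 + 1))" unfolding E4 by (simp only: mult.assoc)
      moreover have "(E + 1) * (E\<^sup>2 + 1) \<noteq> 0" using pos by simp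
      ultimately show ?thesis by (metis mult_divide_mult_cancel_right)
    qed
    finally have 1: "coth x - 1 = 2 * ((E + 1) * (E\<^sup>2 + 1)) / (E ^ 4 - 1)" .
    have 2: "psi (real n * x) = 2 * E * (E - 1)\<^sup>2 / (E ^ 4 - 1)"
      unfolding psi_exp E_def[symmetric] E4 using pos by (simp add: power2_eq_square mult_ac)
    have d: "2 * (3 * E ^ 3 - 3 * E\<^sup>2 + 3 * E + 1) = 2 * ((E + 1) * (E\<^sup>2 + 1)) + 2 * (2 * E * (E - 1)\<^sup>2)"
      by (simp add: algebra_simps power2_eq_square power3_eq_cube)
    have dpos: "2 * ((E + 1) * (E\<^sup>2 + 1)) + 2 * (2 * E * (E - 1)\<^sup>2) > 0"
      using pos E by (intro add_pos_nonneg mult_pos_pos) auto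
    have "2 * x < (E ^ 4 - 1) / (3 * E ^ 3 - 3 * E\<^sup>2 + 3 * E + 1)"
      using ln_bound_2[OF E] lnE n2 by simp
    moreover have "2 * x < v \<Longrightarrow> x < v / 2" for v by simp
    ultimately have "x < (E ^ 4 - 1) / (3 * E ^ 3 - 3 * E\<^sup>2 + 3 * E + 1) / 2" by blast
    then have "x < (E ^ 4 - 1) / (2 * (3 * E ^ 3 - 3 * E\<^sup>2 + 3 * E + 1))"
      by (simp only: divide_divide_eq_left mult.commute)
    then have "x < (E ^ 4 - 1) / (2 * ((E + 1) * (E\<^sup>2 + 1)) + 2 * (2 * E * (E - 1)\<^sup>2))"
      unfolding d .
    then have "(2 * ((E + 1) * (E\<^sup>2 + 1)) + 2 * (2 * E * (E - 1)\<^sup>2)) / (E ^ 4 - 1) < 1 / x"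
      using p4 x dpos by (simp only: pos_less_divide_eq pos_divide_less_eq) (simp add: mult.commute pos_divide_less_eq)
    then show ?thesis unfolding slope 1 2 using n2 by (simp add: add_divide_distrib)
  qed
qed

section \<open>The maximum of the lower frame bound\<close>

text \<open>\<open>chi y = coth (y/2) sech y\<close> for \<open>y > 0\<close>, the function on the right-hand side of the equation for the
  maximum, written without the half argument.\<close>

definition chi :: "real \<Rightarrow> real" where
  "chi y = sinh y / (cosh y * (cosh y - 1))"

lemma cosh_gt_1: "(y::real) > 0 \<Longrightarrow> cosh y > 1"
  using cosh_real_strict_mono[of 0 y] by simp

lemma chi_eq: assumes "y > 0" shows "chi y = coth (y / 2) * sech y"
proof -
  have s: "sinh (y / 2) > 0" using assms by simp
  have "sinh y = 2 * sinh (y / 2) * cosh (y / 2)" using sinh_double[of "y / 2"] by simp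
  moreover have "cosh y - 1 = 2 * (sinh (y / 2))\<^sup>2" using cosh_double[of "y / 2"] cosh_square_eq[of "y / 2"] by simp
  ultimately show ?thesis using s by (simp add: chi_def coth_def sech_def power2_eq_square)
qed

lemma coth_strict_antimono: assumes "0 < x" "x < y" shows "coth y < coth x"
proof (rule DERIV_neg_imp_decreasing[OF assms(2)])
  fix t assume "x \<le> t" "t \<le> y"
  then have t: "t > 0" using assms(1) by simp
  have "1 < (coth t)\<^sup>2" using coth_gt_1[OF t] by (simp add: one_less_power)
  then show "\<exists>d. (coth has_real_derivative d) (at t) \<and> d < 0"
    using coth_deriv[OF t] by (intro exI[of _ "1 - (coth t)\<^sup>2"]) simp
qed

lemma sech_strict_antimono: "0 < x \<Longrightarrow> x < y \<Longrightarrow> sech y < sech x"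
  using cosh_real_strict_mono[of x y] by (simp add: sech_def frac_less2)

lemma chi_strict_antimono: assumes "0 < x" "x < y" shows "chi y < chi x"
proof -
  have "coth (y / 2) * sech y < coth (x / 2) * sech x"
    using assms coth_gt_1[of "y / 2"] coth_gt_1[of "x / 2"] sech_pos[of y]
    by (intro mult_strict_mono coth_strict_antimono sech_strict_antimono) auto
  then show ?thesis using assms by (simp add: chi_eq)
qed

text \<open>The logarithmic derivative of \<open>lower_profile n\<close>.\<close>

definition lower_slope :: "nat \<Rightarrow> real \<Rightarrow> real" where
  "lower_slope n x = real n * chi (real n * x) - 1 - langevin x"

lemma lower_profile_deriv:
  assumes x: "x > 0" and n: "n \<ge> 1"
  shows "(lower_profile n has_real_derivative lower_profile n x * lower_slope n x) (at x)"
proof -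
  define s c where "s = sinh (real n * x)" and "c = cosh (real n * x)"
  have c: "c > 1" unfolding c_def using x n by (intro cosh_gt_1) simp
  have z: "real n * s / c\<^sup>2 = (1 - sech (real n * x)) * (real n * chi (real n * x))"
  proof -
    have "1 - 1 / c = (c - 1) / c" using c by (simp add: field_simps)
    then show ?thesis
      using c unfolding sech_def chi_def s_def[symmetric] c_def[symmetric] by (simp add: power2_eq_square)
  qed
  have "((\<lambda>x. real n * x * (coth x - 1)) has_real_derivative
      real n * (coth x - 1) + real n * x * (1 - (coth x)\<^sup>2)) (at x)"
    using coth_deriv[OF x] by (auto intro!: derivative_eq_intros simp: mult_ac)
  moreover have "((\<lambda>x. 1 - sech (real n * x)) has_real_derivative real n * s / c\<^sup>2) (at x)"
    using sech_deriv[of "real n" x] unfolding s_def c_def by (auto intro!: derivative_eq_intros)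
  ultimately have "((\<lambda>x. real n * x * (coth x - 1) * (1 - sech (real n * x))) has_real_derivative
      (real n * (coth x - 1) + real n * x * (1 - (coth x)\<^sup>2)) * (1 - sech (real n * x))
        + real n * s / c\<^sup>2 * (real n * x * (coth x - 1))) (at x)"
    by (rule DERIV_mult)
  also have "(real n * (coth x - 1) + real n * x * (1 - (coth x)\<^sup>2)) * (1 - sech (real n * x))
        + real n * s / c\<^sup>2 * (real n * x * (coth x - 1)) = lower_profile n x * lower_slope n x"
    unfolding z lower_profile_def lower_slope_def langevin_def using x
    by (simp add: field_simps power2_eq_square)
  finally show ?thesis by (simp add: lower_profile_def[abs_def])
qed

lemma lower_profile_pos: assumes "x > 0" "n \<ge> 1" shows "lower_profile n x > 0"
proof -
  have "sech (real n * x) < 1" using cosh_gt_1[of "real n * x"] assms by (simp add: sech_def)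
  then show ?thesis using coth_gt_1[OF assms(1)] assms unfolding lower_profile_def by simp
qed

lemma lower_slope_strict_antimono:
  assumes "n \<ge> 1" "0 < x" "x < y" shows "lower_slope n y < lower_slope n x"
proof -
  have "chi (real n * y) < chi (real n * x)" using assms by (intro chi_strict_antimono) auto
  then have "real n * chi (real n * y) < real n * chi (real n * x)" using assms by simp
  then show ?thesis using langevin_strict_mono[OF assms(2,3)] by (simp add: lower_slope_def)
qed

text \<open>The slope is positive near \<open>0\<close>, where \<open>chi\<close> is unbounded, and negative far out, where \<open>chi\<close>
  tends to \<open>0\<close>.\<close>

lemma lower_slope_zero:
  assumes n: "n \<ge> 1"
  obtains x0 where "x0 > 0" "lower_slope n x0 = 0"
proof -
  have "filterlim chi at_top (at_right 0)"
    unfolding chi_def[abs_def] cosh_field_def sinh_field_def by real_asymp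
  moreover have "filterlim (\<lambda>x. real n * x) (at_right 0) (at_right 0)"
    using n by real_asymp
  ultimately have "filterlim (\<lambda>x. chi (real n * x)) at_top (at_right 0)"
    by (rule filterlim_compose)
  \<comment> \<open>The value \<open>2\<close> suffices because \<open>1 + langevin x < 2\<close>.\<close>
  then have "\<forall>\<^sub>F x in at_right 0. chi (real n * x) > 2"
    by (simp add: filterlim_at_top_dense)
  then obtain b where b: "b > 0" "\<And>x. 0 < x \<Longrightarrow> x < b \<Longrightarrow> chi (real n * x) > 2"
    unfolding eventually_at_right_field by auto
  define u where "u = b / 2"
  have u: "u > 0" "chi (real n * u) > 2" using b(1) b(2)[of u] by (auto simp: u_def)
  have "chi (real n * u) \<le> real n * chi (real n * u)" using n u(2) by simp
  then have pos: "lower_slope n u > 0"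
    using u langevin_less_1[OF u(1)] unfolding lower_slope_def by linarith
  have "(chi \<longlongrightarrow> 0) at_top"
    unfolding chi_def[abs_def] cosh_field_def sinh_field_def by real_asymp
  moreover have "filterlim (\<lambda>x. real n * x) at_top at_top" using n by real_asymp
  ultimately have "((\<lambda>x. chi (real n * x)) \<longlongrightarrow> 0) at_top" by (rule filterlim_compose)
  then have "\<forall>\<^sub>F x in at_top. chi (real n * x) < 1 / real n"
    using n by (intro order_tendstoD) auto
  moreover have "\<forall>\<^sub>F x in at_top. x > u" by (rule eventually_gt_at_top)
  ultimately have "\<forall>\<^sub>F x in at_top. chi (real n * x) < 1 / real n \<and> x > u" by (rule eventually_conj)
  then obtain v where v: "chi (real n * v) < 1 / real n" "v > u"
    using eventually_happens[of _ "at_top :: real filter"] by auto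
  have "real n * chi (real n * v) < 1" using v(1) n by (simp add: field_simps)
  then have neg: "lower_slope n v < 0"
    using langevin_pos[of v] u(1) v(2) by (simp add: lower_slope_def)
  have cont: "continuous_on {u..v} (lower_slope n)"
  proof -
    have "continuous_on {u..v} langevin"
      using u by (intro continuous_at_imp_continuous_on ballI DERIV_isCont[OF langevin_deriv]) auto
    moreover have "cosh (real n * x) \<noteq> 1" if "x \<in> {u..v}" for x
      using cosh_gt_1[of "real n * x"] u n that by simp
    then have "continuous_on {u..v} (\<lambda>x. chi (real n * x))"
      unfolding chi_def by (intro continuous_intros) auto
    ultimately show ?thesis
      unfolding lower_slope_def[abs_def] using u by (intro continuous_intros) auto
  qed
  have "\<exists>x\<ge>u. x \<le> v \<and> lower_slope n x = 0"
    using pos neg v(2) cont by (intro IVT2') auto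
  then show thesis using that u(1) by (meson less_le_trans)
qed

lemma lower_profile_unique_max:
  assumes n: "n \<ge> 1" and x0: "x0 > 0" "lower_slope n x0 = 0" and x: "x > 0" "x \<noteq> x0"
  shows "lower_profile n x < lower_profile n x0"
proof -
  have cont: "continuous_on {u..v} (lower_profile n)" if "u > 0" for u v
    using that n by (intro continuous_at_imp_continuous_on ballI DERIV_isCont[OF lower_profile_deriv]) auto
  show ?thesis
  proof (cases "x < x0")
    case True
    show ?thesis
    proof (rule DERIV_pos_imp_increasing_open[OF True _ cont[OF x(1)]])
      show "\<exists>y. (lower_profile n has_real_derivative y) (at t) \<and> y > 0" if "x < t" "t < x0" for t
        using lower_profile_deriv[of t n] lower_profile_pos[of t n] lower_slope_strict_antimono[OF n, of t x0] x0 x n that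
        by (intro exI[of _ "lower_profile n t * lower_slope n t"]) auto
    qed
  next
    case False
    then have "x0 < x" using x(2) by simp
    then show ?thesis
    proof (rule DERIV_neg_imp_decreasing_open[OF _ _ cont[OF x0(1)]])
      show "\<exists>y. (lower_profile n has_real_derivative y) (at t) \<and> y < 0" if "x0 < t" "t < x" for t
        using lower_profile_deriv[of t n] lower_profile_pos[of t n] lower_slope_strict_antimono[OF n, of x0 t] x0 x n that
        by (intro exI[of _ "lower_profile n t * lower_slope n t"]) (auto simp: mult_pos_neg)
    qed
  qed
qed

section \<open>Local extrema\<close>

text \<open>The one-sided form, in which each side is decided by the monotonicity on that side.\<close>

lemma is_local_max_on_pos_iff:
  "is_local_max_on F {0<..} x \<longleftrightarrow>
     x > 0 \<and> (\<forall>\<^sub>F y in at_left x. F y \<le> F x) \<and> (\<forall>\<^sub>F y in at_right x. F y \<le> F x)"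
  by (auto simp: is_local_max_on_def at_within_open[of x "{0<..}"] eventually_at_split)

lemma not_local_max:
  assumes "is_local_max_on F {0<..} x"
  shows "x < z \<Longrightarrow> (\<And>y. x < y \<Longrightarrow> y < z \<Longrightarrow> F x < F y) \<Longrightarrow> False"
    and "z < x \<Longrightarrow> (\<And>y. z < y \<Longrightarrow> y < x \<Longrightarrow> F x < F y) \<Longrightarrow> False"
proof -
  assume z: "x < z" "\<And>y. x < y \<Longrightarrow> y < z \<Longrightarrow> F x < F y"
  have "\<forall>\<^sub>F y in at_right x. F y \<le> F x" using assms by (simp add: is_local_max_on_pos_iff)
  moreover have "\<forall>\<^sub>F y in at_right x. F x < F y" using z by (intro eventually_at_rightI[of x z]) auto
  ultimately have "\<forall>\<^sub>F y in at_right x. False" by eventually_elim simp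
  then show False by simp
next
  assume z: "z < x" "\<And>y. z < y \<Longrightarrow> y < x \<Longrightarrow> F x < F y"
  have "\<forall>\<^sub>F y in at_left x. F y \<le> F x" using assms by (simp add: is_local_max_on_pos_iff)
  moreover have "\<forall>\<^sub>F y in at_left x. F x < F y" using z by (intro eventually_at_leftI[of z x]) auto
  ultimately have "\<forall>\<^sub>F y in at_left x. False" by eventually_elim simp
  then show False by simp
qed

lemma is_local_min_on_uminus: "is_local_min_on F S x \<longleftrightarrow> is_local_max_on (\<lambda>x. - F x) S x"
  by (simp add: is_local_min_on_def is_local_max_on_def)

lemma local_extrema_up_down_up:
  fixes F :: "real \<Rightarrow> real"
  assumes pr: "0 < p" "p < r"
    and up: "\<And>x y. 0 < x \<Longrightarrow> x < y \<Longrightarrow> y \<le> p \<Longrightarrow> F x < F y"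
    and down: "\<And>x y. p \<le> x \<Longrightarrow> x < y \<Longrightarrow> y \<le> r \<Longrightarrow> F y < F x"
    and up': "\<And>x y. r \<le> x \<Longrightarrow> x < y \<Longrightarrow> F x < F y"
  shows "{x. is_local_max_on F {0<..} x} = {p}" "{x. is_local_min_on F {0<..} x} = {r}"
proof -
  have "is_local_max_on F {0<..} p"
    unfolding is_local_max_on_pos_iff
  proof (intro conjI pr(1))
    show "\<forall>\<^sub>F y in at_left p. F y \<le> F p"
    proof (rule eventually_at_leftI[OF _ pr(1)])
      show "F y \<le> F p" if "y \<in> {0<..<p}" for y using up[of y p] that by simp
    qed
    show "\<forall>\<^sub>F y in at_right p. F y \<le> F p"
    proof (rule eventually_at_rightI[OF _ pr(2)])
      show "F y \<le> F p" if "y \<in> {p<..<r}" for y using down[of p y] that by simp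
    qed
  qed
  moreover have "x = p" if loc: "is_local_max_on F {0<..} x" for x
  proof (rule ccontr)
    assume "x \<noteq> p"
    have x: "x > 0" using loc by (simp add: is_local_max_on_pos_iff)
    consider "x < p" | "p < x" "x \<le> r" | "r < x" using \<open>x \<noteq> p\<close> by linarith
    then show False
    proof cases
      case 1
      then show False using not_local_max(1)[OF loc, of p] up x by force
    next
      case 2
      then show False using not_local_max(2)[OF loc, of p] down by force
    next
      case 3
      then show False using not_local_max(1)[OF loc, of "x + 1"] up' by force
    qed
  qed
  ultimately show "{x. is_local_max_on F {0<..} x} = {p}" by blast
  have "is_local_min_on F {0<..} r"
    unfolding is_local_min_on_uminus is_local_max_on_pos_iff neg_le_iff_le
  proof (intro conjI)
    show "0 < r" using pr by simp
    show "\<forall>\<^sub>F y in at_left r. F r \<le> F y"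
    proof (rule eventually_at_leftI[OF _ pr(2)])
      show "F r \<le> F y" if "y \<in> {p<..<r}" for y using down[of y r] that by simp
    qed
    show "\<forall>\<^sub>F y in at_right r. F r \<le> F y"
    proof (rule eventually_at_rightI)
      show "F r \<le> F y" if "y \<in> {r<..<r + 1}" for y using up'[of r y] that by simp
    qed simp
  qed
  moreover have "x = r" if loc: "is_local_min_on F {0<..} x" for x
  proof (rule ccontr)
    assume "x \<noteq> r"
    note loc' = loc[unfolded is_local_min_on_uminus]
    have x: "x > 0" using loc' by (simp add: is_local_max_on_pos_iff)
    consider "x \<le> p" | "p < x" "x < r" | "r < x" using \<open>x \<noteq> r\<close> by linarith
    then show False
    proof cases
      case 1
      then show False using not_local_max(2)[OF loc', of 0] up x by force
    next
      case 2
      then show False using not_local_max(1)[OF loc', of r] down by force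
    next
      case 3
      then show False using not_local_max(2)[OF loc', of r] up' by force
    qed
  qed
  ultimately show "{x. is_local_min_on F {0<..} x} = {r}" by blast
qed

theorem proposition2p4:
  fixes a b :: real and n :: nat and C A B :: "real \<Rightarrow> real"
  assumes "a > 0" and "b > 0" and "n \<ge> 1" and "inverse (a * b) = real n"
    and C: "\<And>\<gamma>. \<gamma> > 0 \<Longrightarrow> C \<gamma> > 0 \<and> L2_norm (g2 b (C \<gamma>) \<gamma>) = 1"
    and A: "\<And>\<gamma>. \<gamma> > 0 \<Longrightarrow> A \<gamma> = lower_frame_bound (g2 b (C \<gamma>) \<gamma>) (rect_lattice a b)"
    and B: "\<And>\<gamma>. \<gamma> > 0 \<Longrightarrow> B \<gamma> = upper_frame_bound (g2 b (C \<gamma>) \<gamma>) (rect_lattice a b)"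
  shows
    "(\<exists>\<gamma>0>0.
        (\<forall>\<gamma>>0. - 1 + 1 / (\<gamma> * a) - coth (\<gamma> * a)
                  = - real n * coth (\<gamma> * real n * a / 2) * sech (\<gamma> * real n * a)
                \<longleftrightarrow> \<gamma> = \<gamma>0) \<and>
        (\<forall>\<gamma>>0. \<gamma> \<noteq> \<gamma>0 \<longrightarrow> A \<gamma> < A \<gamma>0))
   \<and> (n \<in> {1, 2} \<longrightarrow>
        (\<forall>\<gamma>>0. B \<gamma> > 2 \<and> B differentiable (at \<gamma>) \<and> deriv B \<gamma> > 0))
   \<and> (n \<ge> 3 \<longrightarrow>
        (\<exists>\<gamma>max \<gamma>min.
           {\<gamma>. is_local_max_on B {0<..} \<gamma>} = {\<gamma>max} \<and>
           {\<gamma>. is_local_min_on B {0<..} \<gamma>} = {\<gamma>min} \<and>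
           \<gamma>max < arcosh ((1 + sqrt 5) / 2) / (real n * a) \<and>
           arcosh ((1 + sqrt 5) / 2) / (real n * a) < \<gamma>min \<and>
           (B \<gamma>min < 2 \<longrightarrow> (\<forall>\<gamma>>0. B \<gamma>min \<le> B \<gamma>)) \<and>
           (\<forall>\<gamma>>\<gamma>min. B differentiable (at \<gamma>) \<and> deriv B \<gamma> > 0)))"
proof -
  note a = assms(1) and n = assms(3)
  have b: "b = 1 / (real n * a)"
    using assms(1-4) by (simp add: field_simps)
  have A_eq: "A \<gamma> = lower_profile n (a * \<gamma>)" and B_eq: "B \<gamma> = upper_profile n (a * \<gamma>)" if "\<gamma> > 0" for \<gamma>
    using frame_bounds_closed_form[OF a n b that] A[OF that] B[OF that] C[OF that] by auto
  have B_deriv: "(B has_real_derivative upper_profile n (a * \<gamma>) * upper_slope n (a * \<gamma>) * a) (at \<gamma>)" if "\<gamma> > 0" for \<gamma>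
  proof (rule has_field_derivative_transform_within_open)
    show "((\<lambda>\<gamma>. upper_profile n (a * \<gamma>)) has_real_derivative
        upper_profile n (a * \<gamma>) * upper_slope n (a * \<gamma>) * a) (at \<gamma>)"
      using a that by (intro DERIV_chain2[OF upper_profile_deriv]) (auto intro!: derivative_eq_intros)
    show "\<gamma> \<in> {0<..}" using that by simp
  qed (auto simp: B_eq)
  have B_increasing: "B differentiable (at \<gamma>) \<and> deriv B \<gamma> > 0" if "\<gamma> > 0" "upper_slope n (a * \<gamma>) > 0" for \<gamma>
    using B_deriv[OF that(1)] upper_profile_pos[of "a * \<gamma>" n] a n that
    by (auto simp: real_differentiable_def DERIV_imp_deriv)

  have "\<exists>\<gamma>0>0.
        (\<forall>\<gamma>>0. - 1 + 1 / (\<gamma> * a) - coth (\<gamma> * a)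
                  = - real n * coth (\<gamma> * real n * a / 2) * sech (\<gamma> * real n * a)
                \<longleftrightarrow> \<gamma> = \<gamma>0) \<and>
        (\<forall>\<gamma>>0. \<gamma> \<noteq> \<gamma>0 \<longrightarrow> A \<gamma> < A \<gamma>0)"
  proof -
    obtain x0 where x0: "x0 > 0" "lower_slope n x0 = 0" using lower_slope_zero[OF n] .
    have "x0 / a > 0" using x0(1) a by simp
    moreover have "- 1 + 1 / (\<gamma> * a) - coth (\<gamma> * a)
                  = - real n * coth (\<gamma> * real n * a / 2) * sech (\<gamma> * real n * a)
                \<longleftrightarrow> \<gamma> = x0 / a" if "\<gamma> > 0" for \<gamma>
    proof -
      have x: "a * \<gamma> > 0" using a that by simp
      have "real n * (a * \<gamma>) > 0" using x n by simp
      then have "chi (real n * (a * \<gamma>)) = coth (\<gamma> * real n * a / 2) * sech (\<gamma> * real n * a)"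
        using chi_eq[of "real n * (a * \<gamma>)"] by (simp add: mult_ac)
      then have "- 1 + 1 / (\<gamma> * a) - coth (\<gamma> * a)
                  = - real n * coth (\<gamma> * real n * a / 2) * sech (\<gamma> * real n * a)
                \<longleftrightarrow> lower_slope n (a * \<gamma>) = 0"
        by (auto simp: lower_slope_def langevin_def mult.commute[of a \<gamma>] mult.assoc)
      also have "\<dots> \<longleftrightarrow> a * \<gamma> = x0"
        using lower_slope_strict_antimono[OF n x, of x0] lower_slope_strict_antimono[OF n x0(1), of "a * \<gamma>"] x0(2)
        by (cases "a * \<gamma>" x0 rule: linorder_cases) auto
      finally show ?thesis using a by (simp add: field_simps)
    qed
    moreover have "A \<gamma> < A (x0 / a)" if "\<gamma> > 0" "\<gamma> \<noteq> x0 / a" for \<gamma>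
      using lower_profile_unique_max[OF n x0, of "a * \<gamma>"] that a x0(1)
      by (simp add: A_eq field_simps)
    ultimately show ?thesis by blast
  qed
  moreover have "n \<in> {1, 2} \<longrightarrow> (\<forall>\<gamma>>0. B \<gamma> > 2 \<and> B differentiable (at \<gamma>) \<and> deriv B \<gamma> > 0)"
    using a n upper_profile_gt_2 upper_slope_pos_1_2 B_increasing by (simp add: B_eq)
  moreover have "n \<ge> 3 \<longrightarrow>
        (\<exists>\<gamma>max \<gamma>min.
           {\<gamma>. is_local_max_on B {0<..} \<gamma>} = {\<gamma>max} \<and>
           {\<gamma>. is_local_min_on B {0<..} \<gamma>} = {\<gamma>min} \<and>
           \<gamma>max < arcosh ((1 + sqrt 5) / 2) / (real n * a) \<and>
           arcosh ((1 + sqrt 5) / 2) / (real n * a) < \<gamma>min \<and>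
           (B \<gamma>min < 2 \<longrightarrow> (\<forall>\<gamma>>0. B \<gamma>min \<le> B \<gamma>)) \<and>
           (\<forall>\<gamma>>\<gamma>min. B differentiable (at \<gamma>) \<and> deriv B \<gamma> > 0))"
  proof
    assume n3: "n \<ge> 3"
    obtain p r where pr: "0 < p" "p < y_golden / real n" "y_golden / real n < r"
      and slope: "\<And>x. 0 < x \<Longrightarrow> x < p \<Longrightarrow> upper_slope n x > 0"
        "\<And>x. p < x \<Longrightarrow> x < r \<Longrightarrow> upper_slope n x < 0"
        "\<And>x. r < x \<Longrightarrow> upper_slope n x > 0"
      using upper_slope_sign_changes[OF n3] by metis
    have scale: "u < v / a \<longleftrightarrow> a * u < v" "v / a < u \<longleftrightarrow> v < a * u" "v / a \<le> u \<longleftrightarrow> v \<le> a * u" "u \<le> v / a \<longleftrightarrow> a * u \<le> v" for u v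
      using a by (auto simp: field_simps)
    have pr': "0 < p / a" "p / a < r / a" using pr a by (auto simp: divide_strict_right_mono)
    have 1: "B x < B y" if xy: "0 < x" "x < y" "y \<le> p / a" for x y
    proof -
      have "upper_profile n (a * x) < upper_profile n (a * y)"
      proof (rule upper_profile_increasing[OF _ _ n])
        show ax: "0 < a * x" "a * x < a * y" using a xy by auto
        show "0 < upper_slope n t" if "a * x < t" "t < a * y" for t
          using that ax xy(3) by (intro slope(1)) (auto simp: scale)
      qed
      then show ?thesis using xy by (simp add: B_eq)
    qed
    have 2: "B y < B x" if xy: "p / a \<le> x" "x < y" "y \<le> r / a" for x y
    proof -
      have x: "0 < x" using xy(1) pr'(1) by linarith
      have "upper_profile n (a * y) < upper_profile n (a * x)"
      proof (rule upper_profile_decreasing[OF _ _ n])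
        show "0 < a * x" "a * x < a * y" using a x xy by auto
        show "upper_slope n t < 0" if "a * x < t" "t < a * y" for t
          using that xy(1,3) by (intro slope(2)) (auto simp: scale)
      qed
      then show ?thesis using x xy by (simp add: B_eq)
    qed
    have 3: "B x < B y" if xy: "r / a \<le> x" "x < y" for x y
    proof -
      have x: "0 < x" using xy(1) pr' by linarith
      have "upper_profile n (a * x) < upper_profile n (a * y)"
      proof (rule upper_profile_increasing[OF _ _ n])
        show "0 < a * x" "a * x < a * y" using a x xy by auto
        show "0 < upper_slope n t" if "a * x < t" "t < a * y" for t
          using that xy(1) by (intro slope(3)) (auto simp: scale)
      qed
      then show ?thesis using x xy by (simp add: B_eq)
    qed
    have "{\<gamma>. is_local_max_on B {0<..} \<gamma>} = {p / a}" "{\<gamma>. is_local_min_on B {0<..} \<gamma>} = {r / a}"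
      by (rule local_extrema_up_down_up[OF pr' 1 2 3]; assumption)+
    moreover have "p / a < arcosh ((1 + sqrt 5) / 2) / (real n * a)" "arcosh ((1 + sqrt 5) / 2) / (real n * a) < r / a"
      using pr(2,3) a unfolding y_golden_def golden_def by (simp_all add: divide_strict_right_mono flip: divide_divide_eq_left)
    moreover have "B (r / a) > 2"
      using pr pr' a n by (simp add: B_eq upper_profile_gt_2)
    moreover have "B differentiable (at \<gamma>) \<and> deriv B \<gamma> > 0" if "\<gamma> > r / a" for \<gamma>
    proof (rule B_increasing)
      show "\<gamma> > 0" using that pr' by linarith
      show "upper_slope n (a * \<gamma>) > 0" using that by (intro slope(3)) (simp add: scale)
    qed
    ultimately show "\<exists>\<gamma>max \<gamma>min.
           {\<gamma>. is_local_max_on B {0<..} \<gamma>} = {\<gamma>max} \<and>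
           {\<gamma>. is_local_min_on B {0<..} \<gamma>} = {\<gamma>min} \<and>
           \<gamma>max < arcosh ((1 + sqrt 5) / 2) / (real n * a) \<and>
           arcosh ((1 + sqrt 5) / 2) / (real n * a) < \<gamma>min \<and>
           (B \<gamma>min < 2 \<longrightarrow> (\<forall>\<gamma>>0. B \<gamma>min \<le> B \<gamma>)) \<and>
           (\<forall>\<gamma>>\<gamma>min. B differentiable (at \<gamma>) \<and> deriv B \<gamma> > 0)"
      by (intro exI[of _ "p / a"] exI[of _ "r / a"]) auto
  qed
  ultimately show ?thesis by blast
qed

end
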